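(* Let $\boldsymbol u_h=(\sigma_h,\mu_h,\omega_h)^{\intercal}$, with values in $\boldsymbol W_h=V_h^-\times V_h\times V_h^+$, be the solution of the semi-discrete mixed formulation $$\langle\sigma_{h,t},\tau_h\rangle-\langle d^-\tau_h,\mu_h\rangle=0\quad\forall\,\tau_h\in V_h^-,$$ $$\langle\mu_{h,t},v_h\rangle+\langle d^-\sigma_h,v_h\rangle+\langle\omega_h,dv_h\rangle=\langle f,v_h\rangle\quad\forall\,v_h\in V_h,$$ $$\langle\omega_{h,t},\phi_h\rangle-\langle d\mu_h,\phi_h\rangle=0\quad\forall\,\phi_h\in V_h^+,$$ for $t\in(0,T]$, with initial values $\sigma_h(\cdot,0)=I_h^-\delta u_0$, $\mu_h(\cdot,0)=I_hu_1$, $\omega_h(\cdot,0)=I_h^+du_0$; equivalently $\langle\boldsymbol u_{h,t},\boldsymbol v_h\rangle+\langle\mathcal A_h\boldsymbol u_h,\boldsymbol v_h\rangle=\langle\boldsymbol F,\boldsymbol v_h\rangle$ for all $\boldsymbol v_h\in\boldsymbol W_h$, with $\boldsymbol F=(0,f,0)^{\intercal}$. If $f\in L^1((0,T),L^2\Lambda)$, then $$\sup_{0\le t\le T}\|\boldsymbol u_h(\cdot,t)\|\le\|\boldsymbol u_h(\cdot,0)\|+2\int_0^T\|f(\cdot,s)\|\,ds.$$ Furthermore, if $f\in W^{1,1}((0,T),L^2\Lambda)$, then $$\sup_{0\le t\le T}\|\mathcal A_h\boldsymbol u_h(\cdot,t)\|\le\|\mathcal A_h\boldsymbol u_h(\cdot,0)\|+4\|f\|_{L^\infty(L^2)}+2\int_0^T\|f_t\|\,dt.$$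 When $f=0$, these inequalities become equalities and there is energy conservation: $\|\boldsymbol u_h(\cdot,t)\|=\|\boldsymbol u_h(\cdot,0)\|$ and $\|\mathcal A_h\boldsymbol u_h(\cdot,t)\|=\|\mathcal A_h\boldsymbol u_h(\cdot,0)\|$ for all $t>0$ (i.e. $t\in(0,T]$).
   Context: Let $n\ge2$, let $\Omega\subset\mathbb R^n$ be a bounded domain homeomorphic to a ball with piecewise smooth Lipschitz boundary, $T>0$ finite, and fix $0\le k\le n$. $L^2\Lambda^j$ is the space of $L^2$ differential $j$-forms on $\Omega$ with inner product $\langle\cdot,\cdot\rangle$ and norm $\|\cdot\|$ (product inner products and norms are used for triples). $d$ is the exterior derivative, $H\Lambda^j=\{\omega\in L^2\Lambda^j:d\omega\in L^2\Lambda^{j+1}\}$, and $H_0\Lambda^j=\{\omega\in H\Lambda^j:\mathrm{tr}\,\omega=0\text{ on }\partial\Omega\}$; for $j=n$, $H_0\Lambda^n$ is understood as the $L^2$ $n$-forms with zero mean. $\delta$ is the coderivative, $H^*\Lambda^j=\{\omega\in L^2\Lambda^j:\delta\omega\in L^2\Lambda^{j-1}\}$. It is assumed that the harmonic space $\{\omega\in H_0\Lambda^j\cap H^*\Lambda^j:d\omega=0,\delta\omega=0\}$ is trivial for $1\le j\le n-1$. Superscripts $-$, none, $+$ refer to form degrees $k-1,k,k+1$; spaces of forms of degree $-1$ or $n+1$ are $\{0\}$. Subscript $t$ denotes the time derivative, and $\|f\|_{L^\infty(L^2)}=\operatorname{ess\,sup}_{0\le t\le T}\|f(\cdot,t)\|$.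 $u_0,u_1$ are given initial data with $\delta u_0\in H_0\Lambda^-$, $u_1\in H_0\Lambda$, $du_0\in H_0\Lambda^+$. Finite element spaces: $\mathcal T_h$ is a shape regular triangulation of $\Omega$. $\mathcal P_s\Lambda^j$ denotes polynomial $j$-forms with coefficients of degree $\le s$, $\mathcal H_s\Lambda^j$ those with homogeneous coefficients of degree $s$, and $\mathcal P_s^-\Lambda^j=\mathcal P_{s-1}\Lambda^j+\kappa\mathcal H_{s-1}\Lambda^{j+1}$, where $(\kappa\omega)_x(v_1,\dots,v_{j})=\omega_x(x,v_1,\dots,v_{j})$ for a $(j+1)$-form $\omega$. $V_h^j$ is the space of forms in $H_0\Lambda^j$ whose restriction to each simplex $K\in\mathcal T_h$ lies in $\mathcal P_s\Lambda^j(K)$ (degree $s$ decreasing by one as $j$ increases by one) or, alternatively, in $\mathcal P_s^-\Lambda^j(K)$ (same $s$ for all $j$), so that $V_h^-\to V_h\to V_h^+$ is a subcomplex of $H_0\Lambda^-\to H_0\Lambda\to H_0\Lambda^+$ and, in each degree $j\ge1$, $\ker d\cap V_h^j=dV_h^{j-1}$. The discrete coderivative $\delta_h:V_h\to V_h^-$ is defined by $\langle\delta_h\omega_h,v_h\rangle=\langle\omega_h,d^-v_h\rangle$ for all $v_h\in V_h^-$; $\delta_h^+:V_h^+\to V_h$ is its analogue in degree $k+1$. On $\boldsymbol W_h$, $$\mathcal A_h=\begin{pmatrix}0&-\delta_h&0\\ d^-&0&\delta_h^+\\ 0&-d&0\end{pmatrix}.$$ Operator $I_h$: let $\mathfrak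 K$ be the $L^2$-orthogonal complement of $\ker d\cap H_0\Lambda$ in $H_0\Lambda$ and $\mathfrak K_h$ that of $\ker d\cap V_h$ in $V_h$; $\mathfrak K^-,\mathfrak K_h^-$ are the analogues in degree $k-1$. $P_hv\in\mathfrak K_h$ is defined by $\langle dP_hv,d\phi_h\rangle=\langle dv,d\phi_h\rangle$ for all $\phi_h\in\mathfrak K_h$ ($P_h^-$ in degree $k-1$). Every $v\in H_0\Lambda$ is uniquely $v=d^-v_1+v_2$ ($L^2$-orthogonal sum) with $v_1\in\mathfrak K^-$, $v_2\in\mathfrak K$, and $I_hv:=d^-P_h^-v_1+P_hv_2$. $I_h^\mp$ are the same operators in degrees $k\mp1$. *)

theory Defs
  imports
    "HOL-Analysis.Analysis"
    "HOL-Probability.Essential_Supremum"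
    "HOL-Library.Function_Algebras"
begin

section \<open>Differential forms\<close>

text \<open>A \<open>j\<close>-form maps a point to an alternating \<open>j\<close>-linear function, represented on lists of
  \<open>j\<close> vectors and extended by \<open>0\<close> to lists of other lengths. Degrees are integers, so that the
  forms of degree \<open>- 1\<close> (and, by alternation, of degree \<open>n + 1\<close>) are exactly the zero forms.
  Sums and negatives of forms are the pointwise ones of \<^theory>\<open>HOL-Library.Function_Algebras\<close>.\<close>

type_synonym 'a form = "'a \<Rightarrow> 'a list \<Rightarrow> real"

definition alternating :: "int \<Rightarrow> ('a::euclidean_space list \<Rightarrow> real) \<Rightarrow> bool" where
  "alternating j \<alpha> \<longleftrightarrow>
     (\<forall>vs. int (length vs) \<noteq> j \<longrightarrow> \<alpha> vs = 0) \<and>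
     (\<forall>us ws. linear (\<lambda>v. \<alpha> (us @ v # ws))) \<and>
     (\<forall>vs. \<not> distinct vs \<longrightarrow> \<alpha> vs = 0)"

text \<open>The inner product for which the \<open>dx\<^sub>I\<close>, \<open>I\<close> increasing, are orthonormal: each \<open>I\<close> of
  cardinality \<open>j\<close> is counted \<open>j!\<close> times among the repetition-free lists of basis vectors.\<close>

definition alt_inner :: "('a::euclidean_space list \<Rightarrow> real) \<Rightarrow> ('a list \<Rightarrow> real) \<Rightarrow> real" where
  "alt_inner \<alpha> \<beta> = (\<Sum>vs | set vs \<subseteq> Basis \<and> distinct vs. \<alpha> vs * \<beta> vs / fact (length vs))"

definition L2_forms :: "'a::euclidean_space set \<Rightarrow> int \<Rightarrow> 'a form set" where
  "L2_forms \<Omega> j = {\<omega>. (\<forall>x\<in>\<Omega>. alternating j (\<omega> x)) \<and>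
     (\<forall>vs. (\<lambda>x. \<omega> x vs) \<in> borel_measurable (lebesgue_on \<Omega>) \<and>
           integrable (lebesgue_on \<Omega>) (\<lambda>x. (\<omega> x vs)\<^sup>2))}"

definition l2_inner :: "'a::euclidean_space set \<Rightarrow> 'a form \<Rightarrow> 'a form \<Rightarrow> real" where
  "l2_inner \<Omega> \<omega> \<eta> = (LINT x|lebesgue_on \<Omega>. alt_inner (\<omega> x) (\<eta> x))"

definition l2_norm :: "'a::euclidean_space set \<Rightarrow> 'a form \<Rightarrow> real" where
  "l2_norm \<Omega> \<omega> = sqrt (l2_inner \<Omega> \<omega> \<omega>)"

text \<open>Elements of \<open>L\<^sup>2\<close> are functions; equality of \<open>L\<^sup>2\<close> classes is the following relation.\<close>

definition ae_eq :: "'a::euclidean_space set \<Rightarrow> 'a form \<Rightarrow> 'a form \<Rightarrow> bool" where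
  "ae_eq \<Omega> \<omega> \<eta> \<longleftrightarrow> (AE x in lebesgue_on \<Omega>. \<omega> x = \<eta> x)"


section \<open>Smooth forms, classical derivative and coderivative\<close>

fun iter_dderiv :: "'a::euclidean_space list \<Rightarrow> ('a \<Rightarrow> real) \<Rightarrow> 'a \<Rightarrow> real" where
  "iter_dderiv [] f = f"
| "iter_dderiv (v # vs) f = (\<lambda>x. frechet_derivative (iter_dderiv vs f) (at x) v)"

text \<open>\<open>C\<^sup>\<infinity>\<close> on an open set \<open>U\<close>: all iterated directional derivatives are differentiable.\<close>

definition smooth_fun :: "'a::euclidean_space set \<Rightarrow> ('a \<Rightarrow> real) \<Rightarrow> bool" where
  "smooth_fun U f \<longleftrightarrow> (\<forall>vs. iter_dderiv vs f differentiable_on U)"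

definition smooth_forms :: "int \<Rightarrow> 'a::euclidean_space form set" where
  "smooth_forms j = {\<phi>. (\<forall>x. alternating j (\<phi> x)) \<and> (\<forall>vs. smooth_fun UNIV (\<lambda>x. \<phi> x vs))}"

definition test_forms :: "'a::euclidean_space set \<Rightarrow> int \<Rightarrow> 'a form set" where
  "test_forms \<Omega> j = {\<phi>\<in>smooth_forms j. \<exists>C. compact C \<and> C \<subseteq> \<Omega> \<and> (\<forall>x. x \<notin> C \<longrightarrow> \<phi> x = 0)}"

definition classical_d :: "'a::euclidean_space form \<Rightarrow> 'a form" where
  "classical_d \<phi> = (\<lambda>x vs. \<Sum>i<length vs. (- 1) ^ i *
     frechet_derivative (\<lambda>y. \<phi> y (take i vs @ drop (Suc i) vs)) (at x) (vs ! i))"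

text \<open>The formal \<open>L\<^sup>2\<close> adjoint of \<^const>\<open>classical_d\<close>.\<close>

definition classical_codiff :: "'a::euclidean_space form \<Rightarrow> 'a form" where
  "classical_codiff \<phi> = (\<lambda>x vs. - (\<Sum>e\<in>Basis. frechet_derivative (\<lambda>y. \<phi> y (e # vs)) (at x) e))"


section \<open>Weak derivatives, traces and the spaces of the de Rham complex\<close>

definition weak_d :: "'a::euclidean_space set \<Rightarrow> int \<Rightarrow> 'a form \<Rightarrow> 'a form \<Rightarrow> bool" where
  "weak_d \<Omega> j \<omega> \<eta> \<longleftrightarrow> \<omega> \<in> L2_forms \<Omega> j \<and> \<eta> \<in> L2_forms \<Omega> (j + 1) \<and>
     (\<forall>\<phi>\<in>test_forms \<Omega> (j + 1). l2_inner \<Omega> \<omega> (classical_codiff \<phi>) = l2_inner \<Omega> \<eta> \<phi>)"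

definition weak_codiff :: "'a::euclidean_space set \<Rightarrow> int \<Rightarrow> 'a form \<Rightarrow> 'a form \<Rightarrow> bool" where
  "weak_codiff \<Omega> j \<omega> \<eta> \<longleftrightarrow> \<omega> \<in> L2_forms \<Omega> j \<and> \<eta> \<in> L2_forms \<Omega> (j - 1) \<and>
     (\<forall>\<phi>\<in>test_forms \<Omega> (j - 1). l2_inner \<Omega> \<omega> (classical_d \<phi>) = l2_inner \<Omega> \<eta> \<phi>)"

definition H_d :: "'a::euclidean_space set \<Rightarrow> int \<Rightarrow> 'a form set" where
  "H_d \<Omega> j = {\<omega>. \<exists>\<eta>. weak_d \<Omega> j \<omega> \<eta>}"

definition H_codiff :: "'a::euclidean_space set \<Rightarrow> int \<Rightarrow> 'a form set" where
  "H_codiff \<Omega> j = {\<omega>. \<exists>\<eta>. weak_codiff \<Omega> j \<omega> \<eta>}"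

text \<open>Representatives of \<open>d \<omega>\<close> and \<open>\<delta> \<omega>\<close>, which are unique up to \<^const>\<open>ae_eq\<close>.\<close>

definition ext_d :: "'a::euclidean_space set \<Rightarrow> int \<Rightarrow> 'a form \<Rightarrow> 'a form" where
  "ext_d \<Omega> j \<omega> = (SOME \<eta>. weak_d \<Omega> j \<omega> \<eta>)"

definition codiff :: "'a::euclidean_space set \<Rightarrow> int \<Rightarrow> 'a form \<Rightarrow> 'a form" where
  "codiff \<Omega> j \<omega> = (SOME \<eta>. weak_codiff \<Omega> j \<omega> \<eta>)"

text \<open>The trace of a form in \<^const>\<open>H_d\<close> is in general only a functional on the boundary.
  It is defined by Stokes' formula
  \<open>\<integral>\<^bsub>\<partial>\<Omega>\<^esub> tr \<omega> \<and> tr \<star>\<mu> = \<langle>d \<omega>, \<mu>\<rangle> - \<langle>\<omega>, \<delta> \<mu>\<rangle>\<close> for \<open>\<mu>\<close> smooth up to the boundary.\<close>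

definition boundary_trace :: "'a::euclidean_space set \<Rightarrow> int \<Rightarrow> 'a form \<Rightarrow> 'a form \<Rightarrow> real" where
  "boundary_trace \<Omega> j \<omega> \<mu> = l2_inner \<Omega> (ext_d \<Omega> j \<omega>) \<mu> - l2_inner \<Omega> \<omega> (classical_codiff \<mu>)"

definition H0 :: "'a::euclidean_space set \<Rightarrow> int \<Rightarrow> 'a form set" where
  "H0 \<Omega> j =
     (if j = int DIM('a) then {\<omega>\<in>L2_forms \<Omega> j. \<forall>vs. (LINT x|lebesgue_on \<Omega>. \<omega> x vs) = 0}
      else {\<omega>\<in>H_d \<Omega> j. \<forall>\<mu>\<in>smooth_forms (j + 1). boundary_trace \<Omega> j \<omega> \<mu> = 0})"

definition trivial_harmonic :: "'a::euclidean_space set \<Rightarrow> int \<Rightarrow> bool" where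
  "trivial_harmonic \<Omega> j \<longleftrightarrow> (\<forall>\<omega>\<in>H0 \<Omega> j \<inter> H_codiff \<Omega> j.
     weak_d \<Omega> j \<omega> 0 \<and> weak_codiff \<Omega> j \<omega> 0 \<longrightarrow> ae_eq \<Omega> \<omega> 0)"


section \<open>The domain and its triangulation\<close>

definition lipschitz_boundary :: "'a::euclidean_space set \<Rightarrow> bool" where
  "lipschitz_boundary \<Omega> \<longleftrightarrow> (\<forall>p\<in>frontier \<Omega>. \<exists>U e L g. open U \<and> p \<in> U \<and> norm e = 1 \<and>
     L-lipschitz_on UNIV (g :: 'a \<Rightarrow> real) \<and>
     \<Omega> \<inter> U = {x\<in>U. g (x - (x \<bullet> e) *\<^sub>R e) < x \<bullet> e})"

text \<open>The boundary is a union of finitely many compact pieces of smooth hypersurfaces.\<close>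

definition piecewise_smooth_boundary :: "'a::euclidean_space set \<Rightarrow> bool" where
  "piecewise_smooth_boundary \<Omega> \<longleftrightarrow> (\<exists>\<S>. finite \<S> \<and> frontier \<Omega> = \<Union>\<S> \<and>
     (\<forall>S\<in>\<S>. compact S \<and> (\<exists>U \<rho>. open U \<and> S \<subseteq> U \<and> smooth_fun U \<rho> \<and>
        (\<forall>x\<in>S. \<rho> x = 0 \<and> frechet_derivative \<rho> (at x) \<noteq> (\<lambda>v. 0)))))"

definition admissible_domain :: "'a::euclidean_space set \<Rightarrow> bool" where
  "admissible_domain \<Omega> \<longleftrightarrow> open \<Omega> \<and> connected \<Omega> \<and> bounded \<Omega> \<and>
     \<Omega> homeomorphic ball (0::'a) 1 \<and> lipschitz_boundary \<Omega> \<and> piecewise_smooth_boundary \<Omega>"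

definition triangulation_of :: "'a::euclidean_space set set \<Rightarrow> 'a set \<Rightarrow> bool" where
  "triangulation_of \<T> \<Omega> \<longleftrightarrow>
     triangulation \<T> \<and> (\<forall>K\<in>\<T>. int DIM('a) simplex K) \<and> \<Union>\<T> = closure \<Omega>"

definition shape_regular :: "real \<Rightarrow> 'a::euclidean_space set set \<Rightarrow> bool" where
  "shape_regular C \<T> \<longleftrightarrow> (\<forall>K\<in>\<T>. \<exists>x \<rho>. 0 < \<rho> \<and> cball x \<rho> \<subseteq> K \<and> diameter K \<le> C * \<rho>)"


section \<open>Finite element spaces\<close>

definition monomial :: "('a::euclidean_space \<Rightarrow> nat) \<Rightarrow> 'a \<Rightarrow> real" where
  "monomial a x = (\<Prod>i\<in>Basis. (x \<bullet> i) ^ a i)"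

definition poly_combination :: "('a::euclidean_space \<Rightarrow> nat) set \<Rightarrow> ('a \<Rightarrow> real) \<Rightarrow> bool" where
  "poly_combination A p \<longleftrightarrow> (\<exists>c. p = (\<lambda>x. \<Sum>a\<in>A. c a * monomial a x))"

text \<open>Multi-indices vanish outside \<^const>\<open>Basis\<close>, so both index sets below are finite; they are
  empty, and the form spaces zero, for negative \<open>s\<close>.\<close>

definition poly_forms :: "int \<Rightarrow> int \<Rightarrow> 'a::euclidean_space form set" where
  "poly_forms s j = {p. (\<forall>x. alternating j (p x)) \<and> (\<forall>vs. poly_combination
     {a. (\<forall>i. i \<notin> Basis \<longrightarrow> a i = 0) \<and> int (\<Sum>i\<in>Basis. a i) \<le> s} (\<lambda>x. p x vs))}"

definition hom_poly_forms :: "int \<Rightarrow> int \<Rightarrow> 'a::euclidean_space form set" where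
  "hom_poly_forms s j = {p. (\<forall>x. alternating j (p x)) \<and> (\<forall>vs. poly_combination
     {a. (\<forall>i. i \<notin> Basis \<longrightarrow> a i = 0) \<and> int (\<Sum>i\<in>Basis. a i) = s} (\<lambda>x. p x vs))}"

definition koszul :: "'a form \<Rightarrow> 'a form" where
  "koszul \<omega> = (\<lambda>x vs. \<omega> x (x # vs))"

definition trimmed_poly_forms :: "int \<Rightarrow> int \<Rightarrow> 'a::euclidean_space form set" where
  "trimmed_poly_forms s j =
     {p + koszul q |p q. p \<in> poly_forms (s - 1) j \<and> q \<in> hom_poly_forms (s - 1) (j + 1)}"

text \<open>In the family \<open>Full\<close> the polynomial degree drops by one with each form degree, and \<open>r\<close> is
  the degree attached to \<open>0\<close>-forms; in the family \<open>Trimmed\<close> it is \<open>r\<close> throughout.\<close>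

datatype fe_family = Full | Trimmed

fun local_space :: "fe_family \<Rightarrow> int \<Rightarrow> int \<Rightarrow> 'a::euclidean_space form set" where
  "local_space Full r j = poly_forms (r - j) j"
| "local_space Trimmed r j = trimmed_poly_forms r j"

text \<open>The polynomial degrees in form degrees \<open>k - 1\<close>, \<open>k\<close>, \<open>k + 1\<close> are meaningful (form degree
  \<open>n + 1\<close> being irrelevant).\<close>

fun fe_degree_ok :: "fe_family \<Rightarrow> int \<Rightarrow> int \<Rightarrow> int \<Rightarrow> bool" where
  "fe_degree_ok Full n k r \<longleftrightarrow> min (k + 1) n \<le> r"
| "fe_degree_ok Trimmed n k r \<longleftrightarrow> 1 \<le> r"

definition fe_space ::
    "fe_family \<Rightarrow> int \<Rightarrow> 'a::euclidean_space set \<Rightarrow> 'a set set \<Rightarrow> int \<Rightarrow> 'a form set" where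
  "fe_space F r \<Omega> \<T> j =
     {v\<in>H0 \<Omega> j. \<forall>K\<in>\<T>. \<exists>p\<in>local_space F r j. AE x in lebesgue_on K. v x = p x}"

text \<open>In the following, \<open>V\<close> is a family of spaces of forms indexed by the degree.\<close>

definition subcomplex_at :: "'a::euclidean_space set \<Rightarrow> (int \<Rightarrow> 'a form set) \<Rightarrow> int \<Rightarrow> bool" where
  "subcomplex_at \<Omega> V j \<longleftrightarrow> V j \<subseteq> H0 \<Omega> j \<and> (\<forall>v\<in>V j. ext_d \<Omega> j v \<in> V (j + 1))"

text \<open>\<open>ker d \<inter> V\<^sup>j = d V\<^bsup>j - 1\<^esup>\<close>\<close>

definition exact_at :: "'a::euclidean_space set \<Rightarrow> (int \<Rightarrow> 'a form set) \<Rightarrow> int \<Rightarrow> bool" where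
  "exact_at \<Omega> V j \<longleftrightarrow>
     (\<forall>v. v \<in> V j \<and> weak_d \<Omega> j v 0 \<longrightarrow> (\<exists>w\<in>V (j - 1). ae_eq \<Omega> v (ext_d \<Omega> (j - 1) w))) \<and>
     (\<forall>w\<in>V (j - 1). ext_d \<Omega> (j - 1) w \<in> V j \<and> weak_d \<Omega> j (ext_d \<Omega> (j - 1) w) 0)"

definition disc_codiff ::
    "'a::euclidean_space set \<Rightarrow> (int \<Rightarrow> 'a form set) \<Rightarrow> int \<Rightarrow> 'a form \<Rightarrow> 'a form" where
  "disc_codiff \<Omega> V j w = (SOME s. s \<in> V (j - 1) \<and>
     (\<forall>v\<in>V (j - 1). l2_inner \<Omega> s v = l2_inner \<Omega> w (ext_d \<Omega> (j - 1) v)))"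


section \<open>The operators \<open>P\<^sub>h\<close> and \<open>I\<^sub>h\<close>\<close>

text \<open>The \<open>L\<^sup>2\<close>-orthogonal complement of \<open>ker d \<inter> X\<close> in \<open>X\<close>.\<close>

definition ker_compl :: "'a::euclidean_space set \<Rightarrow> int \<Rightarrow> 'a form set \<Rightarrow> 'a form set" where
  "ker_compl \<Omega> j X = {v\<in>X. \<forall>w\<in>X. weak_d \<Omega> j w 0 \<longrightarrow> l2_inner \<Omega> v w = 0}"

definition P_h ::
    "'a::euclidean_space set \<Rightarrow> (int \<Rightarrow> 'a form set) \<Rightarrow> int \<Rightarrow> 'a form \<Rightarrow> 'a form" where
  "P_h \<Omega> V j v = (SOME p. p \<in> ker_compl \<Omega> j (V j) \<and> (\<forall>\<phi>\<in>ker_compl \<Omega> j (V j).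
     l2_inner \<Omega> (ext_d \<Omega> j p) (ext_d \<Omega> j \<phi>) = l2_inner \<Omega> (ext_d \<Omega> j v) (ext_d \<Omega> j \<phi>)))"

definition I_h ::
    "'a::euclidean_space set \<Rightarrow> (int \<Rightarrow> 'a form set) \<Rightarrow> int \<Rightarrow> 'a form \<Rightarrow> 'a form" where
  "I_h \<Omega> V j v =
     (let (v1, v2) = SOME (v1, v2). v1 \<in> ker_compl \<Omega> (j - 1) (H0 \<Omega> (j - 1)) \<and>
            v2 \<in> ker_compl \<Omega> j (H0 \<Omega> j) \<and> ae_eq \<Omega> v (ext_d \<Omega> (j - 1) v1 + v2)
      in ext_d \<Omega> (j - 1) (P_h \<Omega> V (j - 1) v1) + P_h \<Omega> V j v2)"


section \<open>Time-dependent forms\<close>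

text \<open>The Bochner space \<open>L\<^sup>1((0,T), L\<^sup>2\<Lambda>\<^sup>j)\<close>.\<close>

definition strongly_measurable ::
    "'a::euclidean_space set \<Rightarrow> real \<Rightarrow> int \<Rightarrow> (real \<Rightarrow> 'a form) \<Rightarrow> bool" where
  "strongly_measurable \<Omega> T j f \<longleftrightarrow> (\<exists>s :: nat \<Rightarrow> real \<Rightarrow> 'a form.
     (\<forall>i. simple_function (lebesgue_on {0<..<T}) (s i) \<and> (\<forall>t\<in>{0<..<T}. s i t \<in> L2_forms \<Omega> j)) \<and>
     (AE t in lebesgue_on {0<..<T}. (\<lambda>i. l2_norm \<Omega> (s i t - f t)) \<longlonglongrightarrow> 0))"

definition bochner_L1 :: "'a::euclidean_space set \<Rightarrow> real \<Rightarrow> int \<Rightarrow> (real \<Rightarrow> 'a form) set" where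
  "bochner_L1 \<Omega> T j = {f. (AE t in lebesgue_on {0<..<T}. f t \<in> L2_forms \<Omega> j) \<and>
     strongly_measurable \<Omega> T j f \<and> integrable (lebesgue_on {0<..<T}) (\<lambda>t. l2_norm \<Omega> (f t))}"

text \<open>\<open>f \<in> W\<^bsup>1,1\<^esup>((0,T), L\<^sup>2\<Lambda>\<^sup>j)\<close> with distributional derivative \<open>f\<^sub>t = g\<close>. The identity
  \<open>\<integral> \<phi>' f dt = - \<integral> \<phi> g dt\<close> of Bochner integrals is expressed by its inner products with all
  \<open>v \<in> L\<^sup>2\<Lambda>\<^sup>j\<close>.\<close>

definition has_weak_time_derivative ::
    "'a::euclidean_space set \<Rightarrow> real \<Rightarrow> int \<Rightarrow> (real \<Rightarrow> 'a form) \<Rightarrow> (real \<Rightarrow> 'a form) \<Rightarrow> bool" where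
  "has_weak_time_derivative \<Omega> T j f g \<longleftrightarrow> f \<in> bochner_L1 \<Omega> T j \<and> g \<in> bochner_L1 \<Omega> T j \<and>
     (\<forall>\<phi> C. smooth_fun UNIV (\<phi> :: real \<Rightarrow> real) \<and> compact C \<and> C \<subseteq> {0<..<T} \<and>
        (\<forall>t. t \<notin> C \<longrightarrow> \<phi> t = 0) \<longrightarrow>
      (\<forall>v\<in>L2_forms \<Omega> j.
        (LINT t|lebesgue_on {0<..<T}. deriv \<phi> t * l2_inner \<Omega> (f t) v) =
        - (LINT t|lebesgue_on {0<..<T}. \<phi> t * l2_inner \<Omega> (g t) v)))"

text \<open>\<open>u\<close> is absolutely continuous on \<open>[0,T]\<close> with values in \<open>L\<^sup>2\<Lambda>\<^sup>j\<close>, with \<open>u\<^sub>t = g\<close> almost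
  everywhere: \<open>u(t) = u(0) + \<integral>\<^sub>0\<^sup>t g ds\<close>, again tested against all \<open>v \<in> L\<^sup>2\<Lambda>\<^sup>j\<close>.\<close>

definition has_ac_time_derivative ::
    "'a::euclidean_space set \<Rightarrow> real \<Rightarrow> int \<Rightarrow> (real \<Rightarrow> 'a form) \<Rightarrow> (real \<Rightarrow> 'a form) \<Rightarrow> bool" where
  "has_ac_time_derivative \<Omega> T j u g \<longleftrightarrow>
     (\<forall>t\<in>{0..T}. u t \<in> L2_forms \<Omega> j) \<and> g \<in> bochner_L1 \<Omega> T j \<and>
     (\<forall>t\<in>{0..T}. \<forall>v\<in>L2_forms \<Omega> j.
        l2_inner \<Omega> (u t) v = l2_inner \<Omega> (u 0) v + (LINT s|lebesgue_on {0..t}. l2_inner \<Omega> (g s) v))"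

definition Linf_L2_norm :: "'a::euclidean_space set \<Rightarrow> real \<Rightarrow> (real \<Rightarrow> 'a form) \<Rightarrow> ereal" where
  "Linf_L2_norm \<Omega> T f = esssup (lebesgue_on {0..T}) (\<lambda>t. ereal (l2_norm \<Omega> (f t)))"


section \<open>The semi-discrete mixed formulation\<close>

type_synonym 'a form3 = "'a form \<times> 'a form \<times> 'a form"

fun inner3 :: "'a::euclidean_space set \<Rightarrow> 'a form3 \<Rightarrow> 'a form3 \<Rightarrow> real" where
  "inner3 \<Omega> (\<sigma>, \<mu>, \<omega>) (\<tau>, v, \<phi>) = l2_inner \<Omega> \<sigma> \<tau> + l2_inner \<Omega> \<mu> v + l2_inner \<Omega> \<omega> \<phi>"

definition norm3 :: "'a::euclidean_space set \<Rightarrow> 'a form3 \<Rightarrow> real" where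
  "norm3 \<Omega> u = sqrt (inner3 \<Omega> u u)"

definition W_h :: "(int \<Rightarrow> 'a form set) \<Rightarrow> int \<Rightarrow> 'a form3 set" where
  "W_h V k = V (k - 1) \<times> V k \<times> V (k + 1)"

fun A_h ::
    "'a::euclidean_space set \<Rightarrow> (int \<Rightarrow> 'a form set) \<Rightarrow> int \<Rightarrow> 'a form3 \<Rightarrow> 'a form3" where
  "A_h \<Omega> V k (\<sigma>, \<mu>, \<omega>) =
     (- disc_codiff \<Omega> V k \<mu>, ext_d \<Omega> (k - 1) \<sigma> + disc_codiff \<Omega> V (k + 1) \<omega>, - ext_d \<Omega> k \<mu>)"

text \<open>In the next two definitions, \<open>g\<close> is the load, the following triple is the time derivative
  and the last one the value of the solution, all at a fixed time.\<close>

fun mixed_equations ::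
    "'a::euclidean_space set \<Rightarrow> (int \<Rightarrow> 'a form set) \<Rightarrow> int \<Rightarrow> 'a form \<Rightarrow> 'a form3 \<Rightarrow> 'a form3 \<Rightarrow> bool"
where
  "mixed_equations \<Omega> V k g (\<sigma>', \<mu>', \<omega>') (\<sigma>, \<mu>, \<omega>) \<longleftrightarrow>
     (\<forall>\<tau>\<in>V (k - 1). l2_inner \<Omega> \<sigma>' \<tau> - l2_inner \<Omega> (ext_d \<Omega> (k - 1) \<tau>) \<mu> = 0) \<and>
     (\<forall>v\<in>V k. l2_inner \<Omega> \<mu>' v + l2_inner \<Omega> (ext_d \<Omega> (k - 1) \<sigma>) v
        + l2_inner \<Omega> \<omega> (ext_d \<Omega> k v) = l2_inner \<Omega> g v) \<and>
     (\<forall>\<phi>\<in>V (k + 1). l2_inner \<Omega> \<omega>' \<phi> - l2_inner \<Omega> (ext_d \<Omega> k \<mu>) \<phi> = 0)"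

definition operator_equation ::
    "'a::euclidean_space set \<Rightarrow> (int \<Rightarrow> 'a form set) \<Rightarrow> int \<Rightarrow> 'a form \<Rightarrow> 'a form3 \<Rightarrow> 'a form3 \<Rightarrow> bool"
where
  "operator_equation \<Omega> V k g u' u \<longleftrightarrow>
     (\<forall>v\<in>W_h V k. inner3 \<Omega> u' v + inner3 \<Omega> (A_h \<Omega> V k u) v = inner3 \<Omega> (0, g, 0) v)"

text \<open>As \<open>f\<close> is only integrable in time, an evolution equation \<open>E\<close> is required to hold for almost
  every \<open>t\<close>, for an absolutely continuous \<open>u\<close> with values in \<^const>\<open>W_h\<close>.\<close>

definition evolution_solution ::
    "'a::euclidean_space set \<Rightarrow> real \<Rightarrow> (int \<Rightarrow> 'a form set) \<Rightarrow> int \<Rightarrow>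
     ('a form \<Rightarrow> 'a form3 \<Rightarrow> 'a form3 \<Rightarrow> bool) \<Rightarrow> (real \<Rightarrow> 'a form) \<Rightarrow> (real \<Rightarrow> 'a form3) \<Rightarrow> bool" where
  "evolution_solution \<Omega> T V k E f u \<longleftrightarrow> (\<forall>t\<in>{0..T}. u t \<in> W_h V k) \<and>
     (\<exists>u'. has_ac_time_derivative \<Omega> T (k - 1) (\<lambda>t. fst (u t)) (\<lambda>t. fst (u' t)) \<and>
           has_ac_time_derivative \<Omega> T k (\<lambda>t. fst (snd (u t))) (\<lambda>t. fst (snd (u' t))) \<and>
           has_ac_time_derivative \<Omega> T (k + 1) (\<lambda>t. snd (snd (u t))) (\<lambda>t. snd (snd (u' t))) \<and>
           (AE t in lebesgue_on {0<..<T}. E (f t) (u' t) (u t)))"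

fun initial_condition ::
    "'a::euclidean_space set \<Rightarrow> (int \<Rightarrow> 'a form set) \<Rightarrow> int \<Rightarrow> 'a form \<Rightarrow> 'a form \<Rightarrow> 'a form3 \<Rightarrow> bool"
where
  "initial_condition \<Omega> V k u0 u1 (\<sigma>, \<mu>, \<omega>) \<longleftrightarrow>
     ae_eq \<Omega> \<sigma> (I_h \<Omega> V (k - 1) (codiff \<Omega> k u0)) \<and>
     ae_eq \<Omega> \<mu> (I_h \<Omega> V k u1) \<and>
     ae_eq \<Omega> \<omega> (I_h \<Omega> V (k + 1) (ext_d \<Omega> k u0))"

end

theory Submission
  imports Defs
begin

text \<open>In an orthonormal basis of \<open>W\<^sub>h\<close> the scheme is a system \<open>c' + a c = \<phi>\<close> with a skew-symmetric
  matrix \<open>a\<close>, so that \<open>(|c|\<^sup>2)' = 2 c \<cdot> \<phi>\<close>. At a time where \<open>|c|\<close> attains its maximum \<open>M\<close> this gives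
  \<open>M\<^sup>2 \<le> |c(0)|\<^sup>2 + 2 M \<integral>|\<phi>|\<close>, hence \<open>M \<le> |c(0)| + 2 \<integral>|\<phi>|\<close>. Differentiated in time, the equation
  says that \<open>c'\<close> solves the same system with load \<open>\<phi>'\<close>, and the bound for \<open>c'\<close> turns into one
  for \<open>a c = \<phi> - c'\<close>.

  Forms are functions, not \<open>L\<^sup>2\<close> classes, and \<open>d\<close> is a choice of representative. All linear algebra is
  therefore done modulo the null space of the \<open>L\<^sup>2\<close> seminorm; \<open>d\<close> is well-defined and linear there by
  the fundamental lemma of the calculus of variations.\<close>

section \<open>Semi-inner products and finite-dimensional subspaces\<close>

text \<open>The finite element space is cut out by conditions (zero trace, piecewise polynomial) and
  comes with no spanning set. Modulo null forms it is spanned by monomials truncated to pieces of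
  the mesh, which jump and so need not lie in the space; Gram-Schmidt is therefore set up for
  generators taken from a larger ambient space. A finite basis is what reduces \<open>u'\<close>,
  known only through integrals of inner products, to finitely many scalar integrands, and squares of
  scalar primitives are handled by Fubini.

  In the bound for \<open>a c\<close> the triangle inequality evaluates the load at time
  \<open>t\<close> and at time 0, which costs twice the essential supremum; the constant 4 of the
  statement leaves room to spare. Evaluating the load at fixed times needs a continuous
  representative, and the lemma of du Bois-Reymond supplies one for each coefficient. For vanishing
  \<open>f\<close> the equality for \<open>A_h\<close> also needs the integral of the norm of
  \<open>f_t\<close> to vanish: each fixed form gives orthogonality to \<open>f_t\<close> only
  almost everywhere, with its own exceptional set, so countably many forms must suffice.\<close>

locale semi_inner_product = vector_space sc
  for sc :: "real \<Rightarrow> 'v::ab_group_add \<Rightarrow> 'v" +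
  fixes X :: "'v set" and ip :: "'v \<Rightarrow> 'v \<Rightarrow> real"
  assumes subspace_X: "subspace X"
    and ip_commute: "ip x y = ip y x"
    and ip_add_left: "\<lbrakk>x \<in> X; y \<in> X; z \<in> X\<rbrakk> \<Longrightarrow> ip (x + y) z = ip x z + ip y z"
    and ip_scale_left: "\<lbrakk>x \<in> X; z \<in> X\<rbrakk> \<Longrightarrow> ip (sc a x) z = a * ip x z"
    and ip_nonneg: "x \<in> X \<Longrightarrow> 0 \<le> ip x x"
begin

lemma X_zero: "0 \<in> X" and X_add: "x \<in> X \<Longrightarrow> y \<in> X \<Longrightarrow> x + y \<in> X"
  and X_scale: "x \<in> X \<Longrightarrow> sc a x \<in> X"
  and X_diff: "x \<in> X \<Longrightarrow> y \<in> X \<Longrightarrow> x - y \<in> X"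
  and X_sum: "(\<And>i. i \<in> I \<Longrightarrow> e i \<in> X) \<Longrightarrow> sum e I \<in> X"
  using subspace_X subspace_0 subspace_add subspace_scale subspace_diff subspace_sum by blast+

lemma ip_zero_left: "z \<in> X \<Longrightarrow> ip 0 z = 0"
  using ip_scale_left[of 0 z 0] X_zero by simp

lemma ip_add_right: "\<lbrakk>x \<in> X; y \<in> X; z \<in> X\<rbrakk> \<Longrightarrow> ip z (x + y) = ip z x + ip z y"
  using ip_add_left[of x y z] by (simp add: ip_commute)

lemma ip_scale_right: "\<lbrakk>x \<in> X; z \<in> X\<rbrakk> \<Longrightarrow> ip z (sc a x) = a * ip z x"
  using ip_scale_left[of x z a] by (simp add: ip_commute)

lemma ip_diff_left: "\<lbrakk>x \<in> X; y \<in> X; z \<in> X\<rbrakk> \<Longrightarrow> ip (x - y) z = ip x z - ip y z"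
  using ip_add_left[of "x - y" y z] X_diff by simp

lemma ip_diff_right: "\<lbrakk>x \<in> X; y \<in> X; z \<in> X\<rbrakk> \<Longrightarrow> ip z (x - y) = ip z x - ip z y"
  using ip_diff_left[of x y z] by (simp add: ip_commute)

lemma ip_sum_left:
  "\<lbrakk>\<And>i. i \<in> I \<Longrightarrow> e i \<in> X; z \<in> X\<rbrakk> \<Longrightarrow> ip (\<Sum>i\<in>I. sc (c i) (e i)) z = (\<Sum>i\<in>I. c i * ip (e i) z)"
proof (induction I rule: infinite_finite_induct)
  case (insert i I)
  then have "(\<Sum>i\<in>I. sc (c i) (e i)) \<in> X" by (intro X_sum X_scale) auto
  with insert show ?case by (simp add: ip_add_left ip_scale_left X_scale)
qed (auto simp: ip_zero_left)

section \<open>Cauchy-Schwarz and null vectors\<close>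

lemma Cauchy_Schwarz:
  assumes x: "x \<in> X" and y: "y \<in> X"
  shows "(ip x y)\<^sup>2 \<le> ip x x * ip y y"
proof -
  have expand: "0 \<le> ip x x - 2 * a * ip x y + a\<^sup>2 * ip y y" for a
  proof -
    have "0 \<le> ip (x - sc a y) (x - sc a y)"
      using x y by (intro ip_nonneg X_diff X_scale)
    also have "\<dots> = ip x x - 2 * a * ip x y + a\<^sup>2 * ip y y"
      using x y by (simp add: ip_diff_left ip_diff_right X_diff X_scale ip_scale_left ip_scale_right
          ip_commute[of y x] algebra_simps power2_eq_square)
    finally show ?thesis .
  qed
  show ?thesis
  proof (cases "ip y y = 0")
    case True
    have "ip x y = 0"
    proof (rule ccontr)
      assume "ip x y \<noteq> 0"
      \<comment> \<open>With \<open>ip y y = 0\<close> the expanded square is affine in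
        \<open>a\<close>, and at this \<open>a\<close> it would equal -1.\<close>
      with expand[of "(ip x x + 1) / (2 * ip x y)"] True show False by simp
    qed
    then show ?thesis by (simp add: True)
  next
    case False
    with ip_nonneg[OF y] have pos: "ip y y > 0" by simp
    have "0 \<le> ip x x - (ip x y)\<^sup>2 / ip y y"
      using expand[of "ip x y / ip y y"] pos by (simp add: power2_eq_square field_simps)
    then show ?thesis using pos by (simp add: field_simps)
  qed
qed

lemma abs_ip_le: "\<lbrakk>x \<in> X; y \<in> X\<rbrakk> \<Longrightarrow> \<bar>ip x y\<bar> \<le> sqrt (ip x x) * sqrt (ip y y)"
  using Cauchy_Schwarz[of x y] by (metis real_sqrt_abs real_sqrt_le_mono real_sqrt_mult)

text \<open>By Cauchy-Schwarz a null vector is orthogonal to all of \<open>X\<close>. This is what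
  lets \<open>ip\<close> pass to the quotient by the null vectors.\<close>

lemma ip_null_left: "\<lbrakk>x \<in> X; y \<in> X; ip x x = 0\<rbrakk> \<Longrightarrow> ip x y = 0"
  using Cauchy_Schwarz[of x y] by simp

lemma ip_null_cong: "\<lbrakk>x \<in> X; y \<in> X; z \<in> X; ip (x - y) (x - y) = 0\<rbrakk> \<Longrightarrow> ip x z = ip y z"
  using ip_null_left[of "x - y" z] X_diff by (simp add: ip_diff_left)

lemma null_add: "\<lbrakk>x \<in> X; y \<in> X; ip x x = 0; ip y y = 0\<rbrakk> \<Longrightarrow> ip (x + y) (x + y) = 0"
  by (simp add: ip_add_left ip_add_right X_add ip_null_left)

text \<open>A basis modulo null vectors: the residual of an expansion only has to be null. So
  \<open>B\<close> can be finite even when \<open>S\<close>, a set of functions free to change on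
  null sets, has infinite dimension.\<close>

definition orthonormal_basis :: "'v set \<Rightarrow> 'v set \<Rightarrow> bool" where
  "orthonormal_basis B S \<longleftrightarrow> finite B \<and> B \<subseteq> S \<and>
     (\<forall>b\<in>B. \<forall>b'\<in>B. ip b b' = (if b = b' then 1 else 0)) \<and>
     (\<forall>v\<in>S. ip (v - (\<Sum>b\<in>B. sc (ip v b) b)) (v - (\<Sum>b\<in>B. sc (ip v b) b)) = 0)"

lemma orthonormal_expand:
  assumes B: "orthonormal_basis B S" and S: "S \<subseteq> X" and v: "v \<in> S" and w: "w \<in> X"
  shows "ip v w = (\<Sum>b\<in>B. ip v b * ip b w)"
proof -
  have BX: "b \<in> X" if "b \<in> B" for b using B S that by (auto simp: orthonormal_basis_def)
  have "ip v w = ip (\<Sum>b\<in>B. sc (ip v b) b) w"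
    using B S v w BX by (intro ip_null_cong X_sum X_scale) (auto simp: orthonormal_basis_def)
  then show ?thesis using BX w by (simp add: ip_sum_left)
qed

text \<open>The squared seminorm of \<open>w\<close> minus its projection is nonnegative. Here
  \<open>w\<close> may lie outside \<open>S\<close>; this serves for the load, which need not be a
  finite element form.\<close>

lemma Bessel:
  assumes B: "orthonormal_basis B S" and S: "S \<subseteq> X" and w: "w \<in> X"
  shows "(\<Sum>b\<in>B. (ip w b)\<^sup>2) \<le> ip w w"
proof -
  define p where "p = (\<Sum>b\<in>B. sc (ip w b) b)"
  have BX: "b \<in> X" if "b \<in> B" for b using B S that by (auto simp: orthonormal_basis_def)
  have p: "p \<in> X" unfolding p_def using BX by (intro X_sum X_scale)
  have fin: "finite B" using B by (auto simp: orthonormal_basis_def)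
  have ps: "ip p z = (\<Sum>b\<in>B. ip w b * ip b z)" if "z \<in> X" for z
    unfolding p_def using BX that by (simp add: ip_sum_left)
  have pb: "ip p b = ip w b" if "b \<in> B" for b
  proof -
    have "ip p b = (\<Sum>b'\<in>B. if b' = b then ip w b' else 0)"
      unfolding ps[OF BX[OF that]] using B that
      by (intro sum.cong refl) (auto simp: orthonormal_basis_def)
    then show ?thesis using fin that by simp
  qed
  have pw: "ip p w = (\<Sum>b\<in>B. (ip w b)\<^sup>2)"
    using ps[OF w] by (simp add: ip_commute[of _ w] power2_eq_square)
  have "ip p p = (\<Sum>b\<in>B. ip w b * ip b p)"
    by (rule ps[OF p])
  also have "\<dots> = (\<Sum>b\<in>B. (ip w b)\<^sup>2)"
    by (intro sum.cong refl) (simp add: pb[symmetric] power2_eq_square ip_commute[of p])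
  finally have pp: "ip p p = (\<Sum>b\<in>B. (ip w b)\<^sup>2)" .
  have "0 \<le> ip (w - p) (w - p)" using w p by (intro ip_nonneg X_diff)
  also have "\<dots> = ip w w - (\<Sum>b\<in>B. (ip w b)\<^sup>2)"
    using w p by (simp add: ip_diff_left ip_diff_right X_diff ip_commute[of w p] pp pw)
  finally show ?thesis by simp
qed

lemma orthonormal_Parseval:
  assumes B: "orthonormal_basis B S" and S: "S \<subseteq> X" and v: "v \<in> S"
  shows "ip v v = (\<Sum>b\<in>B. (ip v b)\<^sup>2)"
proof -
  have "ip v v = (\<Sum>b\<in>B. ip v b * ip b v)" using orthonormal_expand[OF B S v] S v by blast
  also have "\<dots> = (\<Sum>b\<in>B. (ip v b)\<^sup>2)"
    by (intro sum.cong refl) (simp only: ip_commute[of _ v] power2_eq_square)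
  finally show ?thesis .
qed

text \<open>A functional that is linear on \<open>S\<close> and kills null vectors factors through
  the quotient, so it does not see the residual \<open>v - p\<close>. Inner products with
  \<open>ext_d\<close> of the argument are of this kind, although \<open>ext_d\<close> itself is a
  mere choice of representatives.\<close>

lemma orthonormal_functional:
  assumes B: "orthonormal_basis B S" and S: "S \<subseteq> X" and sub: "subspace S"
    and add: "\<And>x y. x \<in> S \<Longrightarrow> y \<in> S \<Longrightarrow> L (x + y) = L x + L y"
    and scale: "\<And>a x. x \<in> S \<Longrightarrow> L (sc a x) = a * L x"
    and null: "\<And>x. x \<in> S \<Longrightarrow> ip x x = 0 \<Longrightarrow> L x = 0"
    and v: "v \<in> S"
  shows "L v = (\<Sum>b\<in>B. ip v b * L b)"
proof -
  have BS: "b \<in> S" if "b \<in> B" for b using B that by (auto simp: orthonormal_basis_def)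
  define p where "p = (\<Sum>b\<in>B. sc (ip v b) b)"
  have p: "p \<in> S" unfolding p_def using sub BS by (intro subspace_sum subspace_scale) auto
  have "L (\<Sum>b\<in>A. sc (c b) b) = (\<Sum>b\<in>A. c b * L b)" if "A \<subseteq> B" for A c
    using that
  proof (induction A rule: infinite_finite_induct)
    case (insert b A)
    then have "(\<Sum>b\<in>A. sc (c b) b) \<in> S"
      using sub BS by (intro subspace_sum subspace_scale) auto
    moreover have "sc (c b) b \<in> S" using insert sub BS by (auto intro: subspace_scale)
    ultimately show ?case using insert BS by (simp add: add scale)
  qed (use scale[of 0 0] subspace_0[OF sub] in auto)
  then have Lp: "L p = (\<Sum>b\<in>B. ip v b * L b)" unfolding p_def by blast
  have "L v = L ((v - p) + p)" by simp
  also have "\<dots> = L (v - p) + L p" using sub v p by (intro add subspace_diff)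
  also have "L (v - p) = 0"
    using B v sub p unfolding p_def by (intro null subspace_diff) (auto simp: orthonormal_basis_def)
  finally show ?thesis using Lp by simp
qed

text \<open>The representer is the combination of the basis with coefficients \<open>L b\<close>. It
  provides the discrete coderivative.\<close>

lemma orthonormal_Riesz:
  assumes B: "orthonormal_basis B S" and S: "S \<subseteq> X" and sub: "subspace S"
    and "\<And>x y. x \<in> S \<Longrightarrow> y \<in> S \<Longrightarrow> L (x + y) = L x + L y"
    and "\<And>a x. x \<in> S \<Longrightarrow> L (sc a x) = a * L x"
    and "\<And>x. x \<in> S \<Longrightarrow> ip x x = 0 \<Longrightarrow> L x = 0"
  shows "\<exists>s\<in>S. \<forall>v\<in>S. ip s v = L v"
proof (intro bexI ballI)
  have BS: "b \<in> S" if "b \<in> B" for b using B that by (auto simp: orthonormal_basis_def)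
  show "(\<Sum>b\<in>B. sc (L b) b) \<in> S"
    using sub BS by (intro subspace_sum subspace_scale) auto
  fix v assume v: "v \<in> S"
  have "L v = (\<Sum>b\<in>B. ip v b * L b)" by (rule orthonormal_functional[where L = L, OF B S sub assms(4-6) v])
  also have "\<dots> = ip (\<Sum>b\<in>B. sc (L b) b) v"
    using BS S v by (subst ip_sum_left) (auto simp: ip_commute[of v] mult.commute)
  finally show "ip (\<Sum>b\<in>B. sc (L b) b) v = L v" ..
qed

text \<open>One Gram-Schmidt step, for \<open>S\<close> spanned by \<open>S'\<close> and one further
  vector \<open>w\<close>: the part \<open>w'\<close> of \<open>w\<close> orthogonal to
  \<open>B\<close> is either null, and \<open>B\<close> is kept, or is normalised and added.\<close>

lemma orthonormal_basis_insert:
  assumes B: "orthonormal_basis B S'" and S: "S \<subseteq> X" "subspace S" "S' \<subseteq> S" and w: "w \<in> S"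
    and decomp: "\<And>v. v \<in> S \<Longrightarrow> \<exists>a. v - sc a w \<in> S'"
  shows "\<exists>B. orthonormal_basis B S"
proof -
  define p where "p v = (\<Sum>b\<in>B. sc (ip v b) b)" for v
  have fin: "finite B" and BS': "\<And>b. b \<in> B \<Longrightarrow> b \<in> S'"
    and on: "\<And>b b'. b \<in> B \<Longrightarrow> b' \<in> B \<Longrightarrow> ip b b' = (if b = b' then 1 else 0)"
    using B by (auto simp: orthonormal_basis_def)
  have BS: "\<And>b. b \<in> B \<Longrightarrow> b \<in> S" and BX: "\<And>b. b \<in> B \<Longrightarrow> b \<in> X" using BS' S by blast+
  have pS: "p v \<in> S" for v unfolding p_def using S BS by (intro subspace_sum subspace_scale) auto
  have pX: "p v \<in> X" for v using pS S by blast
  have pb: "ip (p v) b = ip v b" if "b \<in> B" for b v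
  proof -
    have "ip (p v) b = (\<Sum>b'\<in>B. if b' = b then ip v b' else 0)"
      unfolding p_def using BX that on by (subst ip_sum_left) (auto intro!: sum.cong)
    then show ?thesis using fin that by simp
  qed
  have p_add: "p (x + y) = p x + p y" if "x \<in> X" "y \<in> X" for x y
    unfolding p_def sum.distrib[symmetric] using that BX
    by (intro sum.cong refl) (simp add: ip_add_left scale_left_distrib)
  have p_scale: "p (sc a x) = sc a (p x)" if "x \<in> X" for x a
    unfolding p_def scale_sum_right using that BX
    by (intro sum.cong refl) (simp add: ip_scale_left)
  define w' where "w' = w - p w"
  have wX: "w \<in> X" and w'S: "w' \<in> S" and w'X: "w' \<in> X"
    using w S pS subspace_diff unfolding w'_def by blast+
  have w'b: "ip w' b = 0" "ip b w' = 0" if "b \<in> B" for b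
    using pb[OF that] wX pX BX[OF that] ip_commute[of b w'] by (auto simp: w'_def ip_diff_left)
  \<comment> \<open>By linearity of \<open>p\<close>, this difference is the residual of
    \<open>v - sc a w\<close>, a vector of \<open>S'\<close>, and such residuals are null.\<close>
  have res: "\<exists>a. ip (v - p v - sc a w') (v - p v - sc a w') = 0" if v: "v \<in> S" for v
  proof -
    obtain a where a: "v - sc a w \<in> S'" using decomp[OF v] by blast
    have vX: "v \<in> X" using v S by blast
    have "p v = p (v - sc a w) + sc a (p w)"
      using p_add[of "v - sc a w" "sc a w"] p_scale[OF wX] X_diff X_scale vX wX by simp
    then have "v - p v - sc a w' = (v - sc a w) - p (v - sc a w)"
      by (simp add: w'_def scale_right_diff_distrib)
    moreover have "ip ((v - sc a w) - p (v - sc a w)) ((v - sc a w) - p (v - sc a w)) = 0"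
      using B a unfolding p_def orthonormal_basis_def by blast
    ultimately show ?thesis by metis
  qed
  show ?thesis
  proof (cases "ip w' w' = 0")
    case True
    \<comment> \<open>Adding a multiple of the null vector \<open>w'\<close> keeps a null vector
      null, so \<open>B\<close> already serves all of \<open>S\<close>.\<close>
    have "ip (v - p v) (v - p v) = 0" if v: "v \<in> S" for v
    proof -
      obtain a where a: "ip (v - p v - sc a w') (v - p v - sc a w') = 0" using res[OF v] by blast
      have X: "v - p v \<in> X" using v S pX X_diff by blast
      have "ip ((v - p v - sc a w') + sc a w') ((v - p v - sc a w') + sc a w') = 0"
        using a X w'X True by (intro null_add) (auto simp: X_diff X_scale ip_scale_left ip_scale_right)
      then show ?thesis by simp
    qed
    then have "orthonormal_basis B S"
      using fin BS on unfolding orthonormal_basis_def p_def by blast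
    then show ?thesis ..
  next
    case False
    with ip_nonneg[OF w'X] have pos: "ip w' w' > 0" by simp
    define e where "e = sc (1 / sqrt (ip w' w')) w'"
    have eS: "e \<in> S" and eX: "e \<in> X" using w'S S subspace_scale unfolding e_def by blast+
    have ee: "ip e e = 1" using pos w'X unfolding e_def
      by (simp add: ip_scale_left ip_scale_right X_scale real_div_sqrt field_simps)
    have eb: "ip e b = 0" "ip b e = 0" if "b \<in> B" for b
      using w'b[OF that] w'X BX[OF that] unfolding e_def by (simp_all add: ip_scale_left ip_scale_right)
    have enB: "e \<notin> B" using ee eb by fastforce
    have w'e: "w' = sc (sqrt (ip w' w')) e" using pos by (simp add: e_def)
    have pe: "ip (p v) e = 0" for v
      unfolding p_def using BX eX eb by (subst ip_sum_left) auto
    have "ip (v - (sc (ip v e) e + p v)) (v - (sc (ip v e) e + p v)) = 0" if v: "v \<in> S" for v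
    proof -
      obtain a where a: "ip (v - p v - sc a w') (v - p v - sc a w') = 0" using res[OF v] by blast
      define k where "k = a * sqrt (ip w' w')"
      have k: "sc a w' = sc k e" by (subst w'e) (simp add: k_def)
      have vX: "v \<in> X" using v S by blast
      \<comment> \<open>Null vectors are orthogonal to \<open>e\<close>; this identifies the unknown
        factor \<open>k\<close> as the coefficient \<open>ip v e\<close>.\<close>
      have "ip (v - p v - sc k e) e = 0"
        using a[unfolded k] by (rule ip_null_left[rotated 2]) (intro vX pX eX X_diff X_scale)+
      then have "ip v e = k"
        using vX pX eX pe ee by (simp add: ip_diff_left ip_scale_left X_diff X_scale)
      moreover have "v - (sc k e + p v) = v - p v - sc k e" by simp
      ultimately show ?thesis using a[unfolded k] by metis
    qed
    moreover have "(\<Sum>b\<in>insert e B. sc (ip v b) b) = sc (ip v e) e + p v" for v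
      using fin enB by (simp add: p_def)
    ultimately have "orthonormal_basis (insert e B) S"
      using fin BS on eS ee eb enB unfolding orthonormal_basis_def by force
    then show ?thesis ..
  qed
qed

text \<open>Induction on the number of generators, which are only required to lie in
  \<open>X\<close>, not in \<open>S\<close>. The vectors of \<open>S\<close> that do without the
  generator \<open>e i\<close> form a subspace \<open>S'\<close>, and either \<open>S' = S\<close>
  or one more vector completes it.\<close>

lemma ex_orthonormal_basis:
  assumes "finite I" "subspace S" "S \<subseteq> X" "\<And>i. i \<in> I \<Longrightarrow> e i \<in> X"
    and "\<And>v. v \<in> S \<Longrightarrow> \<exists>c. ip (v - (\<Sum>i\<in>I. sc (c i) (e i))) (v - (\<Sum>i\<in>I. sc (c i) (e i))) = 0"
  shows "\<exists>B. orthonormal_basis B S"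
  using assms
proof (induction I arbitrary: S rule: finite_induct)
  case empty
  then have "orthonormal_basis {} S" by (auto simp: orthonormal_basis_def)
  then show ?case ..
next
  case (insert i I)
  define N where "N v \<longleftrightarrow> (\<exists>c. ip (v - (\<Sum>i\<in>I. sc (c i) (e i))) (v - (\<Sum>i\<in>I. sc (c i) (e i))) = 0)" for v
  define S' where "S' = {v\<in>S. N v}"
  have combX: "(\<Sum>i\<in>I. sc (c i) (e i)) \<in> X" for c using insert by (intro X_sum X_scale) auto
  have sub: "subspace S'"
  proof (rule subspaceI)
    have "N 0" unfolding N_def by (rule exI[of _ "\<lambda>_. 0"]) (simp add: ip_zero_left X_zero)
    then show "0 \<in> S'" using insert subspace_0 by (auto simp: S'_def)
  next
    fix x y assume x: "x \<in> S'" and y: "y \<in> S'"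
    then obtain c c' where c: "ip (x - (\<Sum>i\<in>I. sc (c i) (e i))) (x - (\<Sum>i\<in>I. sc (c i) (e i))) = 0"
      and c': "ip (y - (\<Sum>i\<in>I. sc (c' i) (e i))) (y - (\<Sum>i\<in>I. sc (c' i) (e i))) = 0"
      by (auto simp: S'_def N_def)
    have eq: "x + y - (\<Sum>i\<in>I. sc (c i + c' i) (e i))
      = (x - (\<Sum>i\<in>I. sc (c i) (e i))) + (y - (\<Sum>i\<in>I. sc (c' i) (e i)))"
      by (simp add: scale_left_distrib sum.distrib)
    have "N (x + y)" unfolding N_def
      by (rule exI[of _ "\<lambda>i. c i + c' i"], unfold eq, rule null_add)
        (use x y c c' insert combX in \<open>auto simp: S'_def intro!: X_diff\<close>)
    then show "x + y \<in> S'" using x y insert subspace_add by (auto simp: S'_def)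
  next
    fix a x assume x: "x \<in> S'"
    then obtain c where c: "ip (x - (\<Sum>i\<in>I. sc (c i) (e i))) (x - (\<Sum>i\<in>I. sc (c i) (e i))) = 0"
      by (auto simp: S'_def N_def)
    have eq: "sc a x - (\<Sum>i\<in>I. sc (a * c i) (e i)) = sc a (x - (\<Sum>i\<in>I. sc (c i) (e i)))"
      by (simp add: scale_right_diff_distrib scale_sum_right)
    have X: "x - (\<Sum>i\<in>I. sc (c i) (e i)) \<in> X" using x insert combX by (auto simp: S'_def intro!: X_diff)
    have "N (sc a x)" unfolding N_def
      by (rule exI[of _ "\<lambda>i. a * c i"], unfold eq)
        (use c X in \<open>simp add: ip_scale_left ip_scale_right X_scale\<close>)
    then show "sc a x \<in> S'" using x insert subspace_scale by (auto simp: S'_def)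
  qed
  have "\<exists>B. orthonormal_basis B S'"
  proof (rule insert.IH[OF sub])
    show "S' \<subseteq> X" using insert.prems(2) by (auto simp: S'_def)
    show "e i \<in> X" if "i \<in> I" for i using insert.prems(3) that by blast
  qed (simp add: S'_def N_def)
  then obtain B where B: "orthonormal_basis B S'" ..
  show ?case
  proof (cases "S' = S")
    case True
    with B show ?thesis by auto
  next
    case False
    \<comment> \<open>A vector outside \<open>S'\<close> has a nonzero coefficient at
      \<open>e i\<close>, so subtracting a suitable multiple of it removes \<open>e i\<close> from
      any other vector of \<open>S\<close>.\<close>
    then obtain w where w: "w \<in> S" "\<not> N w" by (auto simp: S'_def)
    define L where "L c = (\<Sum>i\<in>I. sc (c i) (e i))" for c
    have ins: "(\<Sum>i\<in>insert i I. sc (c i) (e i)) = sc (c i) (e i) + L c" for c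
      using insert by (simp add: L_def)
    obtain c where c: "ip (w - (sc (c i) (e i) + L c)) (w - (sc (c i) (e i) + L c)) = 0"
      using insert.prems(4)[OF w(1)] unfolding ins by blast
    have ci: "c i \<noteq> 0"
    proof
      assume "c i = 0"
      with c have "N w" unfolding N_def L_def[symmetric] by auto
      with w show False by simp
    qed
    have "\<exists>a. v - sc a w \<in> S'" if v: "v \<in> S" for v
    proof -
      obtain c' where c': "ip (v - (sc (c' i) (e i) + L c')) (v - (sc (c' i) (e i) + L c')) = 0"
        using insert.prems(4)[OF v] unfolding ins by blast
      define a where "a = c' i / c i"
      have La: "L (\<lambda>j. c' j - a * c j) = L c' - sc a (L c)"
        by (simp add: L_def scale_left_diff_distrib sum_subtractf scale_sum_right)
      have eq: "v - sc a w - L (\<lambda>j. c' j - a * c j)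
          = (v - (sc (c' i) (e i) + L c')) + sc (- a) (w - (sc (c i) (e i) + L c))"
        using ci unfolding La by (simp add: scale_right_diff_distrib scale_right_distrib) (simp add: a_def)
      have X: "w - (sc (c i) (e i) + L c) \<in> X" "v - (sc (c' i) (e i) + L c') \<in> X"
        using w v insert combX by (auto simp: L_def intro!: X_diff X_add X_scale)
      have "N (v - sc a w)" unfolding N_def L_def[symmetric]
        by (rule exI[of _ "\<lambda>j. c' j - a * c j"], unfold eq, rule null_add)
          (use c c' X in \<open>auto simp: X_scale ip_scale_left ip_scale_right simp del: scale_minus_left\<close>)
      then show ?thesis using v w insert subspace_diff subspace_scale by (auto simp: S'_def)
    qed
    moreover have "S' \<subseteq> S" by (auto simp: S'_def)
    ultimately show ?thesis
      using orthonormal_basis_insert[OF B insert.prems(2,1) _ w(1)] by blast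
  qed
qed

end


section \<open>Absolutely continuous functions\<close>

lemma AE_lebesgue_on_iff:
  "S \<in> sets lebesgue \<Longrightarrow> (AE x in lebesgue_on S. P x) \<longleftrightarrow> (AE x in lebesgue. x \<in> S \<longrightarrow> P x)"
  by (simp add: AE_restrict_space_iff)

lemma AE_lebesgue_on_subset:
  assumes "AE x in lebesgue_on S. P x" "S' \<subseteq> S" "S \<in> sets lebesgue" "S' \<in> sets lebesgue"
  shows "AE x in lebesgue_on S'. P x"
  using assms by (auto simp: AE_lebesgue_on_iff elim!: eventually_mono)

lemma integrable_lebesgue_on_subset:
  fixes f :: "'a::euclidean_space \<Rightarrow> real"
  assumes "integrable (lebesgue_on S) f" "S' \<subseteq> S" "S \<in> sets lebesgue" "S' \<in> sets lebesgue"
  shows "integrable (lebesgue_on S') f"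
proof -
  have "set_integrable lebesgue S f"
    using assms by (simp add: set_integrable_def integrable_restrict_space)
  then have "set_integrable lebesgue S' f"
    by (rule set_integrable_subset) (use assms in auto)
  then show ?thesis using assms by (simp add: set_integrable_def integrable_restrict_space)
qed

lemma integral_lebesgue_on_if:
  fixes f :: "'a::euclidean_space \<Rightarrow> real"
  assumes "S' \<subseteq> S" "S \<in> sets lebesgue" "S' \<in> sets lebesgue"
  shows "(LINT x|lebesgue_on S. (if x \<in> S' then f x else 0)) = (LINT x|lebesgue_on S'. f x)"
proof -
  have "(LINT x|lebesgue_on S. (if x \<in> S' then f x else 0))
      = (LINT x|lebesgue. (if x \<in> S then if x \<in> S' then f x else 0 else 0))"
    by (rule Lebesgue_Measure.integral_restrict_UNIV[symmetric]) (rule assms)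
  also have "\<dots> = (LINT x|lebesgue. (if x \<in> S' then f x else 0))"
    using assms by (intro Bochner_Integration.integral_cong) auto
  also have "\<dots> = (LINT x|lebesgue_on S'. f x)"
    by (rule Lebesgue_Measure.integral_restrict_UNIV) (rule assms)
  finally show ?thesis .
qed

lemma sigma_finite_lebesgue: "sigma_finite_measure (lebesgue :: 'a::euclidean_space measure)"
proof
  obtain A :: "'a set set" where A: "countable A" "A \<subseteq> sets lborel" "\<Union>A = space lborel"
    "\<forall>a\<in>A. emeasure lborel a \<noteq> \<infinity>"
    using lborel.sigma_finite_countable by blast
  then show "\<exists>A::'a set set. countable A \<and> A \<subseteq> sets lebesgue \<and> \<Union>A = space lebesgue \<and> (\<forall>a\<in>A. emeasure lebesgue a \<noteq> \<infinity>)"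
    by (intro exI[of _ A]) (auto simp: subset_iff)
qed

lemma sigma_finite_lebesgue_on: "S \<in> sets lebesgue \<Longrightarrow> sigma_finite_measure (lebesgue_on S)"
  by (intro sigma_finite_measure_restrict_space sigma_finite_lebesgue)

text \<open>Integration by parts for merely integrable functions: Fubini on the two triangles into
  which the diagonal cuts the square \<open>{0..t} \<times> {0..t}\<close>. Their integrals add up
  to the product of the two full integrals.\<close>

lemma integral_times_primitive:
  fixes g h :: "real \<Rightarrow> real"
  assumes g: "integrable (lebesgue_on {0..t}) g" and h: "integrable (lebesgue_on {0..t}) h"
  shows integrable_times_primitive:
      "integrable (lebesgue_on {0..t}) (\<lambda>s. h s * (LINT r|lebesgue_on {0..s}. g r))" (is ?A)
    and "(LINT s|lebesgue_on {0..t}. h s * (LINT r|lebesgue_on {0..s}. g r))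
       + (LINT s|lebesgue_on {0..t}. g s * (LINT r|lebesgue_on {0..s}. h r))
       = (LINT s|lebesgue_on {0..t}. g s) * (LINT s|lebesgue_on {0..t}. h s)" (is ?B)
proof -
  define M where "M = lebesgue_on {0..t}"
  have Mspace: "space M = {0..t}" by (simp add: M_def)
  interpret sigma_finite_measure M unfolding M_def by (rule sigma_finite_lebesgue_on) simp
  interpret pair_sigma_finite M M ..
  have [measurable]: "g \<in> borel_measurable M" "h \<in> borel_measurable M" and
    gM: "integrable M g" and hM: "integrable M h"
    using g h by (auto simp: M_def)
  \<comment> \<open>Makes the triangle \<open>r \<le> s\<close> measurable in the product of
    \<open>M\<close> with itself.\<close>
  have id[measurable]: "(\<lambda>x::real. x) \<in> borel_measurable M"
    unfolding M_def by (metis id_borel_measurable_lebesgue_on id_def measurable_cong)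
  have prod: "integrable (M \<Otimes>\<^sub>M M) (\<lambda>(s, r). p s * q r)" if "integrable M p" "integrable M q" for p q :: "real \<Rightarrow> real"
  proof (rule Fubini_integrable)
    have [measurable]: "p \<in> borel_measurable M" "q \<in> borel_measurable M" using that by auto
    show "(\<lambda>(s, r). p s * q r) \<in> borel_measurable (M \<Otimes>\<^sub>M M)" by measurable
    show "integrable M (\<lambda>x. LINT y|M. norm (case (x, y) of (s, r) \<Rightarrow> p s * q r))"
      using that by (simp add: abs_mult)
    show "AE x in M. integrable M (\<lambda>y. case (x, y) of (s, r) \<Rightarrow> p s * q r)"
      using that by simp
  qed
  have tri: "integrable (M \<Otimes>\<^sub>M M) (\<lambda>(s, r). if r \<le> s then p s * q r else 0)"
    if "integrable M p" "integrable M q" for p q :: "real \<Rightarrow> real"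
  proof (rule Bochner_Integration.integrable_bound[OF prod[OF that]])
    have [measurable]: "p \<in> borel_measurable M" "q \<in> borel_measurable M" using that by auto
    show "(\<lambda>(s, r). if r \<le> s then p s * q r else 0) \<in> borel_measurable (M \<Otimes>\<^sub>M M)" by measurable
  qed auto
  have inner: "(LINT r|M. (if r \<le> s then p s * q r else 0)) = p s * (LINT r|lebesgue_on {0..s}. q r)"
    if "s \<in> space M" for s and p q :: "real \<Rightarrow> real"
  proof -
    have "(LINT r|M. (if r \<le> s then p s * q r else 0)) = (LINT r|M. (if r \<in> {0..s} then p s * q r else 0))"
      by (intro Bochner_Integration.integral_cong) (auto simp: Mspace)
    also have "\<dots> = (LINT r|lebesgue_on {0..s}. p s * q r)"
      unfolding M_def by (rule integral_lebesgue_on_if) (use that Mspace in auto)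
    finally show ?thesis by simp
  qed
  have "integrable M (\<lambda>s. LINT r|M. (if r \<le> s then h s * g r else 0))"
    using integrable_fst[OF tri[OF hM gM]] by simp
  then show ?A
    unfolding M_def[symmetric] by (subst Bochner_Integration.integrable_cong[OF refl inner[where p=h and q=g, symmetric]])
  have eq1: "(LINT s|M. h s * (LINT r|lebesgue_on {0..s}. g r))
      = (LINT s|M. (LINT r|M. (if r \<le> s then h s * g r else 0)))"
    by (rule Bochner_Integration.integral_cong[OF refl inner[where p=h and q=g, symmetric]])
  have "(LINT s|M. g s * (LINT r|lebesgue_on {0..s}. h r))
      = (LINT s|M. (LINT r|M. (if r \<le> s then g s * h r else 0)))"
    by (rule Bochner_Integration.integral_cong[OF refl inner[where p=g and q=h, symmetric]])
  also have "\<dots> = (LINT r|M. (LINT s|M. (if r \<le> s then g s * h r else 0)))"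
    using Fubini_integral[of "\<lambda>s r. if r \<le> s then g s * h r else 0"] tri[OF gM hM] by simp
  also have "\<dots> = (LINT s|M. (LINT r|M. (if s \<le> r then h s * g r else 0)))"
    by (simp only: mult.commute[of "g _" "h _"])
  finally have eq2: "(LINT s|M. g s * (LINT r|lebesgue_on {0..s}. h r))
      = (LINT s|M. (LINT r|M. (if s \<le> r then h s * g r else 0)))" .
  have int2: "integrable (M \<Otimes>\<^sub>M M) (\<lambda>(s, r). if s \<le> r then h s * g r else 0)"
    by (rule Bochner_Integration.integrable_bound[OF prod[OF hM gM]]) auto
  have "(LINT s|M. h s * (LINT r|lebesgue_on {0..s}. g r)) + (LINT s|M. g s * (LINT r|lebesgue_on {0..s}. h r))
    = (LINT s|M. (LINT r|M. (if r \<le> s then h s * g r else 0)) + (LINT r|M. (if s \<le> r then h s * g r else 0)))"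
    unfolding eq1 eq2
    using integrable_fst[OF tri[OF hM gM]] integrable_fst[OF int2]
    by (intro Bochner_Integration.integral_add[symmetric]) simp_all
  also have "\<dots> = (LINT s|M. h s * (LINT r|M. g r))"
  proof (intro Bochner_Integration.integral_cong refl)
    fix s assume s: "s \<in> space M"
    have i1: "integrable M (\<lambda>r. if r \<le> s then h s * g r else 0)"
      and i2: "integrable M (\<lambda>r. if s \<le> r then h s * g r else 0)"
      by (rule Bochner_Integration.integrable_bound[OF integrable_mult_right[OF gM, of "h s"]]; simp)+
    have "(LINT r|M. (if r \<le> s then h s * g r else 0)) + (LINT r|M. (if s \<le> r then h s * g r else 0))
      = (LINT r|M. (if r \<le> s then h s * g r else 0) + (if s \<le> r then h s * g r else 0))"
      using i1 i2 by simp
    also have "\<dots> = (LINT r|M. h s * g r)"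
    proof (rule integral_cong_AE)
      show "(\<lambda>r. (if r \<le> s then h s * g r else 0) + (if s \<le> r then h s * g r else 0)) \<in> borel_measurable M"
        using i1 i2 by (intro borel_measurable_add borel_measurable_integrable)
      show "(\<lambda>r. h s * g r) \<in> borel_measurable M"
        using gM by simp
      \<comment> \<open>The two triangles overlap on the diagonal, a single point for each fixed
        \<open>s\<close>.\<close>
      have "AE r in lebesgue. r \<notin> {s}"
        by (rule AE_not_in) (simp add: null_sets_completionI)
      then have "AE r in lebesgue. r \<in> {0..t} \<longrightarrow>
          (if r \<le> s then h s * g r else 0) + (if s \<le> r then h s * g r else 0) = h s * g r"
        by eventually_elim auto
      then show "AE r in M. (if r \<le> s then h s * g r else 0) + (if s \<le> r then h s * g r else 0) = h s * g r"
        unfolding M_def by (simp only: AE_lebesgue_on_iff lmeasurable_interval fmeasurableD)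
    qed
    finally show "(LINT r|M. (if r \<le> s then h s * g r else 0)) + (LINT r|M. (if s \<le> r then h s * g r else 0))
      = h s * (LINT r|M. g r)" by simp
  qed
  finally show ?B unfolding M_def by (simp add: mult.commute)
qed

text \<open>\<open>c\<close> is absolutely continuous on \<open>{0..T}\<close> with almost
  everywhere derivative \<open>g\<close>. The integral form is the one in which the time derivatives
  of the scheme are given.\<close>

definition primitive :: "real \<Rightarrow> (real \<Rightarrow> real) \<Rightarrow> (real \<Rightarrow> real) \<Rightarrow> bool" where
  "primitive T c g \<longleftrightarrow> integrable (lebesgue_on {0..T}) g \<and>
     (\<forall>t\<in>{0..T}. c t = c 0 + (LINT s|lebesgue_on {0..t}. g s))"

lemma primitive_integrable: "primitive T c g \<Longrightarrow> t \<le> T \<Longrightarrow> integrable (lebesgue_on {0..t}) g"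
  unfolding primitive_def by (rule integrable_lebesgue_on_subset[of "{0..T}"]) auto

lemma primitive_eq: "primitive T c g \<Longrightarrow> t \<in> {0..T} \<Longrightarrow> c t = c 0 + (LINT s|lebesgue_on {0..t}. g s)"
  unfolding primitive_def by blast

lemma primitive_continuous:
  assumes p: "primitive T c g" shows "continuous_on {0..T} c"
proof -
  have g: "g integrable_on {0..T}"
    by (rule integrable_on_lebesgue_on[OF primitive_integrable[OF p order_refl]]) simp
  have "continuous_on {0..T} (\<lambda>t. c 0 + integral {0..t} g)"
    by (intro continuous_intros indefinite_integral_continuous_1 g)
  moreover have "c 0 + integral {0..t} g = c t" if t: "t \<in> {0..T}" for t
    using primitive_eq[OF p t] lebesgue_integral_eq_integral[OF primitive_integrable[OF p, of t]] t
    by simp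
  ultimately show ?thesis by (rule continuous_on_eq)
qed

lemma primitive_zero: "primitive T (\<lambda>_. 0) (\<lambda>_. 0)"
  by (simp add: primitive_def)

lemma primitive_add:
  assumes c: "primitive T c g" and c': "primitive T c' g'"
  shows "primitive T (\<lambda>t. c t + c' t) (\<lambda>t. g t + g' t)"
  unfolding primitive_def
proof (intro conjI ballI)
  show "integrable (lebesgue_on {0..T}) (\<lambda>t. g t + g' t)"
    using primitive_integrable[OF c order_refl] primitive_integrable[OF c' order_refl] by simp
  fix t assume t: "t \<in> {0..T}"
  have "(LINT s|lebesgue_on {0..t}. g s + g' s) = (LINT s|lebesgue_on {0..t}. g s) + (LINT s|lebesgue_on {0..t}. g' s)"
    using primitive_integrable[OF c, of t] primitive_integrable[OF c', of t] t by simp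
  then show "c t + c' t = c 0 + c' 0 + (LINT s|lebesgue_on {0..t}. g s + g' s)"
    using primitive_eq[OF c t] primitive_eq[OF c' t] by linarith
qed

lemma primitive_scale:
  assumes c: "primitive T c g" shows "primitive T (\<lambda>t. a * c t) (\<lambda>t. a * g t)"
  unfolding primitive_def
proof (intro conjI ballI)
  show "integrable (lebesgue_on {0..T}) (\<lambda>t. a * g t)"
    using primitive_integrable[OF c order_refl] by simp
  show "a * c t = a * c 0 + (LINT s|lebesgue_on {0..t}. a * g s)" if "t \<in> {0..T}" for t
    by (simp add: primitive_eq[OF c that] distrib_left[symmetric])
qed

lemma primitive_sum:
  "(\<And>i. i \<in> I \<Longrightarrow> primitive T (c i) (g i)) \<Longrightarrow> primitive T (\<lambda>t. \<Sum>i\<in>I. c i t) (\<lambda>t. \<Sum>i\<in>I. g i t)"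
  by (induction I rule: infinite_finite_induct) (auto intro: primitive_zero primitive_add)

lemma primitive_integral:
  assumes T: "0 \<le> T" and g: "integrable (lebesgue_on {0..T}) g"
  shows "primitive T (\<lambda>t. \<alpha> + (LINT s|lebesgue_on {0..t}. g s)) g"
proof -
  have "integrable (lebesgue_on {0..0}) g"
    by (rule integrable_lebesgue_on_subset[OF g]) (use T in auto)
  then have "(LINT s|lebesgue_on {0}. g s) = 0"
    using lebesgue_integral_eq_integral[of "{0..0}" g] by simp
  then show ?thesis using g by (simp add: primitive_def)
qed

text \<open>With \<open>G = c - c 0\<close> the claim reduces to integration by parts for the pair
  \<open>g\<close>, \<open>g\<close>, which says that twice the integral of \<open>g * G\<close> is
  the square of \<open>G t\<close>.\<close>

lemma primitive_square:
  assumes p: "primitive T c g" and t: "t \<in> {0..T}"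
  shows primitive_times_integrable: "integrable (lebesgue_on {0..t}) (\<lambda>s. c s * g s)"
    and "(c t)\<^sup>2 = (c 0)\<^sup>2 + 2 * (LINT s|lebesgue_on {0..t}. c s * g s)"
proof -
  define G where "G s = (LINT r|lebesgue_on {0..s}. g r)" for s
  have g: "integrable (lebesgue_on {0..t}) g" using primitive_integrable[OF p, of t] t by simp
  have c: "c s = c 0 + G s" if "s \<in> {0..t}" for s
    using primitive_eq[OF p, of s] t that by (simp add: G_def)
  have gG: "integrable (lebesgue_on {0..t}) (\<lambda>s. g s * G s)"
    unfolding G_def by (rule integrable_times_primitive[OF g g])
  have cg: "c s * g s = c 0 * g s + g s * G s" if "s \<in> space (lebesgue_on {0..t})" for s
    using c[of s] that by (simp add: algebra_simps)
  show "integrable (lebesgue_on {0..t}) (\<lambda>s. c s * g s)"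
    using g gG by (subst Bochner_Integration.integrable_cong[OF refl cg]) auto
  have "(LINT s|lebesgue_on {0..t}. c s * g s) = (LINT s|lebesgue_on {0..t}. c 0 * g s + g s * G s)"
    by (intro Bochner_Integration.integral_cong refl cg)
  also have "\<dots> = c 0 * G t + (LINT s|lebesgue_on {0..t}. g s * G s)"
    using g gG by (simp add: G_def)
  finally have I: "(LINT s|lebesgue_on {0..t}. c s * g s) = c 0 * G t + (LINT s|lebesgue_on {0..t}. g s * G s)" .
  have II: "2 * (LINT s|lebesgue_on {0..t}. g s * G s) = G t * G t"
    using integral_times_primitive[OF g g] unfolding G_def[symmetric] by simp
  have "c t = c 0 + G t" by (rule c) (use t in simp)
  then show "(c t)\<^sup>2 = (c 0)\<^sup>2 + 2 * (LINT s|lebesgue_on {0..t}. c s * g s)"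
    using I II by (simp add: power2_eq_square algebra_simps)
qed

text \<open>Inside the interval the points with \<open>G > m\<close> form an open null set, hence
  none exist; the end points follow by continuity.\<close>

lemma AE_le_continuous_imp_le:
  fixes G :: "real \<Rightarrow> real"
  assumes T: "0 < T" and G: "continuous_on {0..T} G"
    and ae: "AE t in lebesgue_on {0..T}. G t \<le> m" and t: "t \<in> {0..T}"
  shows "G t \<le> m"
proof -
  let ?U = "{0<..<T} \<inter> G -` {m<..}"
  have "continuous_on {0<..<T} G" by (rule continuous_on_subset[OF G]) auto
  then have op: "open ?U" by (rule continuous_open_preimage) auto
  have "AE t in lebesgue. t \<in> {0..T} \<longrightarrow> G t \<le> m" using ae by (simp add: AE_lebesgue_on_iff)
  then obtain N where N: "N \<in> null_sets lebesgue" "{t. \<not> (t \<in> {0..T} \<longrightarrow> G t \<le> m)} \<subseteq> N"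
    by (auto simp: eventually_ae_filter)
  have "negligible ?U"
    by (rule negligible_subset[of N]) (use N in \<open>auto simp: negligible_iff_null_sets\<close>)
  with op have "?U = {}" using open_not_negligible by blast
  then have *: "G s \<le> m" if "s \<in> {0<..<T}" for s using that by force
  have cl: "closure {0<..<T} = {0..T}" using T by simp
  show ?thesis
    by (rule continuous_le_on_closure[of "{0<..<T}" G t m]) (use G t * in \<open>auto simp: cl\<close>)
qed


section \<open>Skew-symmetric linear evolution equations\<close>

lemma skew_sum_eq_0:
  fixes a :: "'i \<Rightarrow> 'i \<Rightarrow> real"
  assumes "\<And>i j. i \<in> I \<Longrightarrow> j \<in> I \<Longrightarrow> a i j = - a j i"
  shows "(\<Sum>i\<in>I. x i * (\<Sum>j\<in>I. a i j * x j)) = 0"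
proof -
  have "(\<Sum>i\<in>I. x i * (\<Sum>j\<in>I. a i j * x j)) = (\<Sum>i\<in>I. \<Sum>j\<in>I. x i * a i j * x j)"
    by (simp add: sum_distrib_left mult.assoc)
  also have "\<dots> = (\<Sum>j\<in>I. \<Sum>i\<in>I. x i * a i j * x j)" by (rule sum.swap)
  also have "\<dots> = (\<Sum>j\<in>I. \<Sum>i\<in>I. - (x j * a j i * x i))"
  proof (intro sum.cong refl)
    fix i j assume "i \<in> I" "j \<in> I"
    then show "x i * a i j * x j = - (x j * a j i * x i)"
      by (subst assms) (simp_all add: mult_ac)
  qed
  also have "\<dots> = - (\<Sum>i\<in>I. x i * (\<Sum>j\<in>I. a i j * x j))"
    by (simp add: sum_distrib_left mult.assoc sum_negf)
  finally show ?thesis by simp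
qed

locale skew_evolution =
  fixes T :: real and I :: "'i set" and a :: "'i \<Rightarrow> 'i \<Rightarrow> real"
    and c g \<phi> :: "'i \<Rightarrow> real \<Rightarrow> real"
  assumes T: "0 < T" and finite_I: "finite I"
    and skew: "\<And>i j. i \<in> I \<Longrightarrow> j \<in> I \<Longrightarrow> a i j = - a j i"
    and prim: "\<And>i. i \<in> I \<Longrightarrow> primitive T (c i) (g i)"
    and eq: "AE s in lebesgue_on {0..T}. \<forall>i\<in>I. g i s = \<phi> i s - (\<Sum>j\<in>I. a i j * c j s)"
begin

lemma energy:
  assumes t: "t \<in> {0..T}"
  shows "(\<Sum>i\<in>I. (c i t)\<^sup>2) = (\<Sum>i\<in>I. (c i 0)\<^sup>2) + 2 * (LINT s|lebesgue_on {0..t}. (\<Sum>i\<in>I. c i s * g i s))"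
proof -
  have "(\<Sum>i\<in>I. (c i t)\<^sup>2) = (\<Sum>i\<in>I. (c i 0)\<^sup>2 + 2 * (LINT s|lebesgue_on {0..t}. c i s * g i s))"
    by (intro sum.cong refl primitive_square(2)[OF prim t])
  also have "\<dots> = (\<Sum>i\<in>I. (c i 0)\<^sup>2) + 2 * (\<Sum>i\<in>I. (LINT s|lebesgue_on {0..t}. c i s * g i s))"
    by (simp add: sum.distrib sum_distrib_left)
  also have "(\<Sum>i\<in>I. (LINT s|lebesgue_on {0..t}. c i s * g i s)) = (LINT s|lebesgue_on {0..t}. (\<Sum>i\<in>I. c i s * g i s))"
    using primitive_times_integrable[OF prim t] by (simp add: Bochner_Integration.integral_sum)
  finally show ?thesis .
qed

lemma energy_rate: "AE s in lebesgue_on {0..T}. (\<Sum>i\<in>I. c i s * g i s) = (\<Sum>i\<in>I. c i s * \<phi> i s)"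
  using eq
proof eventually_elim
  case (elim s)
  have "(\<Sum>i\<in>I. c i s * g i s) = (\<Sum>i\<in>I. c i s * \<phi> i s - c i s * (\<Sum>j\<in>I. a i j * c j s))"
  proof (intro sum.cong refl)
    fix i assume "i \<in> I"
    then have "g i s = \<phi> i s - (\<Sum>j\<in>I. a i j * c j s)" using elim by blast
    then show "c i s * g i s = c i s * \<phi> i s - c i s * (\<Sum>j\<in>I. a i j * c j s)"
      by (simp only: right_diff_distrib)
  qed
  moreover have "(\<Sum>i\<in>I. c i s * (\<Sum>j\<in>I. a i j * c j s)) = 0"
    by (rule skew_sum_eq_0) (rule skew)
  ultimately show ?case by (simp add: sum_subtractf)
qed

lemma continuous_L2_set: "continuous_on {0..T} (\<lambda>t. L2_set (\<lambda>i. c i t) I)"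
  unfolding L2_set_def using primitive_continuous[OF prim] by (intro continuous_intros) auto

text \<open>The majorant \<open>F\<close> stands for the norm of the full load \<open>f\<close>, of
  which the coefficients \<open>\<phi>\<close> see only a projection.\<close>

lemma bound:
  assumes F: "integrable (lebesgue_on {0..T}) F"
    and le: "AE s in lebesgue_on {0..T}. L2_set (\<lambda>i. \<phi> i s) I \<le> F s"
    and t: "t \<in> {0..T}"
  shows "L2_set (\<lambda>i. c i t) I \<le> L2_set (\<lambda>i. c i 0) I + 2 * (LINT s|lebesgue_on {0..T}. F s)"
proof -
  have "\<exists>t0\<in>{0..T}. \<forall>s\<in>{0..T}. L2_set (\<lambda>i. c i s) I \<le> L2_set (\<lambda>i. c i t0) I"
    using continuous_attains_sup[OF _ _ continuous_L2_set] T by auto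
  then obtain t0 where t0: "t0 \<in> {0..T}"
    and max: "\<And>s. s \<in> {0..T} \<Longrightarrow> L2_set (\<lambda>i. c i s) I \<le> L2_set (\<lambda>i. c i t0) I" by blast
  define m where "m = L2_set (\<lambda>i. c i t0) I"
  define m0 where "m0 = L2_set (\<lambda>i. c i 0) I"
  define b where "b = (LINT s|lebesgue_on {0..T}. F s)"
  have m: "0 \<le> m" "0 \<le> m0" by (auto simp: m_def m0_def)
  have F0: "AE s in lebesgue_on {0..T}. 0 \<le> F s"
    using le by eventually_elim (meson L2_set_nonneg order_trans)
  have b: "0 \<le> b" unfolding b_def using F0 by (rule integral_nonneg_AE)
  have sq: "(L2_set f I)\<^sup>2 = (\<Sum>i\<in>I. (f i)\<^sup>2)" for f :: "'i \<Rightarrow> real"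
    by (simp add: L2_set_def sum_nonneg)
  \<comment> \<open>Up to \<open>t0\<close> the energy rate is at most \<open>m * F\<close>, and
    since \<open>m * F\<close> is nonnegative its integral may be extended to
    \<open>T\<close>.\<close>
  have "(LINT s|lebesgue_on {0..t0}. (\<Sum>i\<in>I. c i s * g i s)) \<le> (LINT s|lebesgue_on {0..T}. m * F s)"
  proof (rule integral_mono_lebesgue_on_AE)
    show "integrable (lebesgue_on {0..T}) (\<lambda>s. m * F s)" using F by simp
    show "AE s in lebesgue_on {0..T}. 0 \<le> m * F s" using F0 m by (auto elim: eventually_mono)
    have "AE s in lebesgue_on {0..T}. (\<Sum>i\<in>I. c i s * g i s) \<le> m * F s"
      using energy_rate le AE_space
    proof eventually_elim
      case (elim s)
      have "(\<Sum>i\<in>I. c i s * g i s) \<le> (\<Sum>i\<in>I. \<bar>c i s\<bar> * \<bar>\<phi> i s\<bar>)"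
        unfolding elim(1) by (intro sum_mono) (metis abs_ge_self abs_mult)
      also have "\<dots> \<le> L2_set (\<lambda>i. c i s) I * L2_set (\<lambda>i. \<phi> i s) I" by (rule L2_set_mult_ineq)
      also have "\<dots> \<le> m * F s" using max[of s] elim m by (intro mult_mono) (auto simp: m_def)
      finally show ?case .
    qed
    then show "AE s in lebesgue_on {0..t0}. (\<Sum>i\<in>I. c i s * g i s) \<le> m * F s"
      by (rule AE_lebesgue_on_subset) (use t0 in auto)
  qed (use t0 in auto)
  then have "m\<^sup>2 \<le> m0\<^sup>2 + 2 * (m * b)"
    using energy[OF t0] unfolding m_def m0_def sq b_def by simp
  \<comment> \<open>Completing the square and using \<open>m0 * b \<ge> 0\<close> gives
    \<open>m - b \<le> m0 + b\<close>; this is where the factor 2 in front of the integral comes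
    from.\<close>
  then have "(m - b)\<^sup>2 \<le> m0\<^sup>2 + b\<^sup>2" by (simp add: power2_eq_square algebra_simps)
  also have "\<dots> \<le> (m0 + b)\<^sup>2" using m b by (simp add: power2_eq_square algebra_simps)
  finally have "m - b \<le> m0 + b" using m b by (simp add: power2_le_iff_abs_le)
  then show ?thesis using max[OF t] by (simp add: m_def m0_def b_def)
qed

lemma conserved:
  assumes "AE s in lebesgue_on {0..T}. \<forall>i\<in>I. \<phi> i s = 0" and t: "t \<in> {0..T}"
  shows "L2_set (\<lambda>i. c i t) I = L2_set (\<lambda>i. c i 0) I"
proof -
  have ae: "AE s in lebesgue_on {0..T}. (\<Sum>i\<in>I. c i s * g i s) = 0"
    using energy_rate assms(1) by eventually_elim simp
  have "(LINT s|lebesgue_on {0..t}. (\<Sum>i\<in>I. c i s * g i s)) = 0"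
    by (rule integral_eq_zero_AE, rule AE_lebesgue_on_subset[OF ae]) (use t in auto)
  then show ?thesis using energy[OF t] by (simp add: L2_set_def)
qed

text \<open>Differentiating the equation in time: \<open>c' = \<phi> - a c\<close> again solves it, with load \<open>\<phi>'\<close>.\<close>

lemma differentiated:
  assumes "\<And>i. i \<in> I \<Longrightarrow> primitive T (\<Phi> i) (\<psi> i)"
    and ae: "AE s in lebesgue_on {0..T}. \<forall>i\<in>I. \<phi> i s = \<Phi> i s"
  shows "skew_evolution T I a (\<lambda>i t. \<Phi> i t + (\<Sum>j\<in>I. - a i j * c j t))
     (\<lambda>i t. \<psi> i t + (\<Sum>j\<in>I. - a i j * g j t)) \<psi>"
proof
  show "0 < T" "finite I" and "\<And>i j. i \<in> I \<Longrightarrow> j \<in> I \<Longrightarrow> a i j = - a j i"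
    by (fact T finite_I skew)+
  show "primitive T (\<lambda>t. \<Phi> i t + (\<Sum>j\<in>I. - a i j * c j t)) (\<lambda>t. \<psi> i t + (\<Sum>j\<in>I. - a i j * g j t))"
    if "i \<in> I" for i
    using assms(1)[OF that] by (intro primitive_add primitive_sum primitive_scale prim)
  show "AE s in lebesgue_on {0..T}. \<forall>i\<in>I. \<psi> i s + (\<Sum>j\<in>I. - a i j * g j s)
      = \<psi> i s - (\<Sum>j\<in>I. a i j * (\<Phi> j s + (\<Sum>k\<in>I. - a j k * c k s)))"
    using eq ae
  proof eventually_elim
    case (elim s)
    \<comment> \<open>By the original equation the bracket on the right is \<open>g j s\<close>
      itself, so the two sides agree term by term.\<close>
    have "g j s = \<Phi> j s + (\<Sum>k\<in>I. - a j k * c k s)" if "j \<in> I" for j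
      using elim that by (simp add: sum_negf)
    then show ?case by (simp add: sum_negf)
  qed
qed

text \<open>Writing \<open>z = \<Phi> - a c\<close>, the system for \<open>z\<close> bounds
  \<open>z t\<close> by \<open>z 0\<close>. Passing from \<open>a c\<close> to \<open>z\<close> at
  time \<open>t\<close> and back at time 0 costs one norm of \<open>\<Phi>\<close> each, whence
  \<open>2 * m\<close>. As \<open>\<Phi>\<close> is continuous, the almost everywhere bound by
  \<open>m\<close> holds at these two times as well.\<close>

lemma operator_bound:
  assumes \<Phi>: "\<And>i. i \<in> I \<Longrightarrow> primitive T (\<Phi> i) (\<psi> i)"
    and ae: "AE s in lebesgue_on {0..T}. \<forall>i\<in>I. \<phi> i s = \<Phi> i s"
    and F: "integrable (lebesgue_on {0..T}) F"
    and le: "AE s in lebesgue_on {0..T}. L2_set (\<lambda>i. \<psi> i s) I \<le> F s"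
    and m: "AE s in lebesgue_on {0..T}. L2_set (\<lambda>i. \<phi> i s) I \<le> m"
    and t: "t \<in> {0..T}"
  shows "L2_set (\<lambda>i. \<Sum>j\<in>I. a i j * c j t) I
     \<le> L2_set (\<lambda>i. \<Sum>j\<in>I. a i j * c j 0) I + 2 * m + 2 * (LINT s|lebesgue_on {0..T}. F s)"
proof -
  interpret z: skew_evolution T I a "\<lambda>i t. \<Phi> i t + (\<Sum>j\<in>I. - a i j * c j t)"
    "\<lambda>i t. \<psi> i t + (\<Sum>j\<in>I. - a i j * g j t)" \<psi>
    by (rule differentiated) fact+
  define y where "y i t = (\<Sum>j\<in>I. a i j * c j t)" for i t
  have z: "\<Phi> i t + (\<Sum>j\<in>I. - a i j * c j t) = \<Phi> i t - y i t" for i t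
    by (simp add: y_def sum_negf)
  have \<Phi>m: "L2_set (\<lambda>i. \<Phi> i s) I \<le> m" if "s \<in> {0..T}" for s
  proof (rule AE_le_continuous_imp_le[OF T _ _ that])
    show "continuous_on {0..T} (\<lambda>s. L2_set (\<lambda>i. \<Phi> i s) I)"
      unfolding L2_set_def using primitive_continuous[OF \<Phi>] by (intro continuous_intros) auto
    show "AE s in lebesgue_on {0..T}. L2_set (\<lambda>i. \<Phi> i s) I \<le> m"
      using m ae by eventually_elim (simp cong: L2_set_cong)
  qed
  have neg: "L2_set (\<lambda>i. - f i) I = L2_set f I" for f :: "'i \<Rightarrow> real" by (simp add: L2_set_def)
  have "L2_set (\<lambda>i. y i t) I = L2_set (\<lambda>i. \<Phi> i t + - (\<Phi> i t - y i t)) I" by simp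
  also have "\<dots> \<le> L2_set (\<lambda>i. \<Phi> i t) I + L2_set (\<lambda>i. \<Phi> i t - y i t) I"
    using L2_set_triangle_ineq[of "\<lambda>i. \<Phi> i t" "\<lambda>i. - (\<Phi> i t - y i t)" I] neg[of "\<lambda>i. \<Phi> i t - y i t"] by simp
  also have "L2_set (\<lambda>i. \<Phi> i t - y i t) I
      \<le> L2_set (\<lambda>i. \<Phi> i 0 - y i 0) I + 2 * (LINT s|lebesgue_on {0..T}. F s)"
    using z.bound[OF F le t] unfolding z .
  also have "L2_set (\<lambda>i. \<Phi> i 0 - y i 0) I \<le> L2_set (\<lambda>i. \<Phi> i 0) I + L2_set (\<lambda>i. y i 0) I"
    using L2_set_triangle_ineq[of "\<lambda>i. \<Phi> i 0" "\<lambda>i. - y i 0" I] neg[of "\<lambda>i. y i 0"] by simp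
  finally show ?thesis using \<Phi>m[OF t] \<Phi>m[of 0] T unfolding y_def by simp
qed

text \<open>With zero load the differentiated system has the unknown \<open>- a c\<close>, whose
  norm is conserved in turn.\<close>

lemma operator_conserved:
  assumes 0: "AE s in lebesgue_on {0..T}. \<forall>i\<in>I. \<phi> i s = 0" and t: "t \<in> {0..T}"
  shows "L2_set (\<lambda>i. \<Sum>j\<in>I. a i j * c j t) I = L2_set (\<lambda>i. \<Sum>j\<in>I. a i j * c j 0) I"
proof -
  interpret z: skew_evolution T I a "\<lambda>i t. 0 + (\<Sum>j\<in>I. - a i j * c j t)"
    "\<lambda>i t. 0 + (\<Sum>j\<in>I. - a i j * g j t)" "\<lambda>i t. 0"
    by (rule differentiated) (use 0 in \<open>auto simp: primitive_zero\<close>)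
  show ?thesis using z.conserved[OF _ t] by (simp add: sum_negf L2_set_def)
qed

end


section \<open>Smooth functions of compact support\<close>

text \<open>The standard smooth function flat at 0, together with the powers of \<open>1 / t\<close>
  that differentiation produces: the linear span of the family in \<open>m\<close> is closed under
  derivatives.\<close>

definition flat_exp :: "nat \<Rightarrow> real \<Rightarrow> real" where
  "flat_exp m t = (if 0 < t then exp (- 1 / t) / t ^ m else 0)"

lemma flat_exp_has_derivative:
  "(flat_exp m has_real_derivative flat_exp (m + 2) t - real m * flat_exp (m + 1) t) (at t)"
proof (cases t "0::real" rule: linorder_cases)
  case less
  have "((\<lambda>_. 0) has_real_derivative 0) (at t)" by simp
  then have "(flat_exp m has_real_derivative 0) (at t)"
    by (rule has_field_derivative_transform_within_open[of _ _ _ "{..<0}"])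
      (use less in \<open>auto simp: flat_exp_def\<close>)
  then show ?thesis using less by (simp add: flat_exp_def)
next
  case equal
  \<comment> \<open>The difference quotient at 0 from the right, after the substitution
    \<open>1 / h\<close>: the exponential beats every power.\<close>
  have "((\<lambda>h. (1 / h) ^ (m + 1) / exp (1 / h)) \<longlongrightarrow> 0) (at_right (0::real))"
    using filterlim_compose[OF tendsto_power_div_exp_0[of "m + 1"] filterlim_inverse_at_top_right]
    by (simp add: inverse_eq_divide)
  then have "((\<lambda>h. flat_exp m h / h) \<longlongrightarrow> 0) (at_right 0)"
    by (rule Lim_transform_eventually)
      (auto simp: eventually_at_filter flat_exp_def exp_minus field_simps power_divide intro!: always_eventually)
  moreover have "((\<lambda>h. flat_exp m h / h) \<longlongrightarrow> 0) (at_left 0)"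
    by (rule Lim_transform_eventually[OF tendsto_const])
      (auto simp: eventually_at_filter flat_exp_def intro!: always_eventually)
  ultimately have "((\<lambda>h. flat_exp m h / h) \<longlongrightarrow> 0) (at 0)"
    by (simp add: filterlim_split_at_real)
  then show ?thesis using equal by (simp add: DERIV_def flat_exp_def)
next
  case greater
  have "((\<lambda>t. exp (- 1 / t) / t ^ m) has_real_derivative
      exp (- 1 / t) / t ^ (m + 2) - real m * (exp (- 1 / t) / t ^ (m + 1))) (at t)"
  proof -
    have "((\<lambda>t. exp (- 1 / t) / t ^ m) has_real_derivative
        (exp (- 1 / t) * (1 / (t * t)) * t ^ m - exp (- 1 / t) * (real m * t ^ (m - 1))) / (t ^ m * t ^ m)) (at t)"
      using greater by (auto intro!: derivative_eq_intros)
    also have "(exp (- 1 / t) * (1 / (t * t)) * t ^ m - exp (- 1 / t) * (real m * t ^ (m - 1))) / (t ^ m * t ^ m)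
        = exp (- 1 / t) / t ^ (m + 2) - real m * (exp (- 1 / t) / t ^ (m + 1))"
      using greater by (cases m) (simp_all add: field_simps)
    finally show ?thesis .
  qed
  then have "(flat_exp m has_real_derivative
      exp (- 1 / t) / t ^ (m + 2) - real m * (exp (- 1 / t) / t ^ (m + 1))) (at t)"
    by (rule has_field_derivative_transform_within_open[of _ _ _ "{0<..}"])
      (use greater in \<open>auto simp: flat_exp_def\<close>)
  then show ?thesis using greater by (simp add: flat_exp_def)
qed

text \<open>An algebra of functions that is closed under directional derivatives and contains enough
  functions of compact support.\<close>

inductive_set bump_algebra :: "('a::euclidean_space \<Rightarrow> real) set" where
  const: "(\<lambda>_. c) \<in> bump_algebra"
| flat: "(\<lambda>x. flat_exp m (x \<bullet> v + a)) \<in> bump_algebra"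
| add: "f \<in> bump_algebra \<Longrightarrow> g \<in> bump_algebra \<Longrightarrow> (\<lambda>x. f x + g x) \<in> bump_algebra"
| mult: "f \<in> bump_algebra \<Longrightarrow> g \<in> bump_algebra \<Longrightarrow> (\<lambda>x. f x * g x) \<in> bump_algebra"

lemma bump_algebra_prod:
  "(\<And>i. i \<in> I \<Longrightarrow> f i \<in> bump_algebra) \<Longrightarrow> (\<lambda>x. \<Prod>i\<in>I. f i x) \<in> bump_algebra"
  by (induction I rule: infinite_finite_induct) (auto intro: bump_algebra.intros)

lemma bump_algebra_derivative:
  assumes "f \<in> bump_algebra"
  shows "\<exists>D. (\<forall>x. (f has_derivative (\<lambda>v. D v x)) (at x)) \<and> (\<forall>v. D v \<in> bump_algebra)"
  using assms
proof induction
  case (const c)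
  show ?case by (rule exI[of _ "\<lambda>_ _. 0"]) (auto intro: bump_algebra.const)
next
  case (flat m v a)
  let ?D = "\<lambda>w x. (flat_exp (m + 2) (x \<bullet> v + a) + (- real m) * flat_exp (m + 1) (x \<bullet> v + a)) * (w \<bullet> v)"
  have "((\<lambda>x. flat_exp m (x \<bullet> v + a)) has_derivative (\<lambda>w. ?D w x)) (at x)" for x
  proof -
    have 1: "((\<lambda>x. x \<bullet> v + a) has_derivative (\<lambda>w. w \<bullet> v)) (at x)"
      by (auto intro!: derivative_eq_intros)
    have 2: "(flat_exp m has_derivative
        (\<lambda>s. (flat_exp (m + 2) (x \<bullet> v + a) + (- real m) * flat_exp (m + 1) (x \<bullet> v + a)) * s)) (at (x \<bullet> v + a))"
      using flat_exp_has_derivative[of m "x \<bullet> v + a"] by (simp add: has_field_derivative_def)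
    show ?thesis using has_derivative_compose[OF 1 2] .
  qed
  moreover have "?D w \<in> bump_algebra" for w by (intro bump_algebra.intros)
  ultimately show ?case by (intro exI[of _ ?D] conjI allI)
next
  case (add f g)
  then obtain D E where "\<And>x. (f has_derivative (\<lambda>v. D v x)) (at x)" "\<And>v. D v \<in> bump_algebra"
    "\<And>x. (g has_derivative (\<lambda>v. E v x)) (at x)" "\<And>v. E v \<in> bump_algebra" by blast
  then show ?case
    by (intro exI[of _ "\<lambda>v x. D v x + E v x"]) (auto intro: has_derivative_add bump_algebra.add)
next
  case (mult f g)
  then obtain D E where *: "\<And>x. (f has_derivative (\<lambda>v. D v x)) (at x)" "\<And>v. D v \<in> bump_algebra"
    "\<And>x. (g has_derivative (\<lambda>v. E v x)) (at x)" "\<And>v. E v \<in> bump_algebra" by blast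
  have "((\<lambda>x. f x * g x) has_derivative (\<lambda>v. f x * E v x + D v x * g x)) (at x)" for x
    using has_derivative_mult[OF *(1,3)] .
  with * mult show ?case
    by (intro exI[of _ "\<lambda>v x. f x * E v x + D v x * g x"]) (auto intro!: bump_algebra.intros)
qed

lemma bump_algebra_frechet:
  assumes "f \<in> bump_algebra"
  shows "(\<lambda>x. frechet_derivative f (at x) v) \<in> bump_algebra" and "f differentiable (at x)"
proof -
  obtain D where D: "\<And>x. (f has_derivative (\<lambda>v. D v x)) (at x)" "\<And>v. D v \<in> bump_algebra"
    using bump_algebra_derivative[OF assms] by blast
  have "frechet_derivative f (at x) = (\<lambda>v. D v x)" for x
    using frechet_derivative_at[OF D(1)] by (rule sym)
  then show "(\<lambda>x. frechet_derivative f (at x) v) \<in> bump_algebra" using D by simp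
  show "f differentiable (at x)" using D by (auto simp: differentiable_def)
qed

lemma bump_algebra_differentiable_on: "f \<in> bump_algebra \<Longrightarrow> f differentiable_on S"
  by (simp add: bump_algebra_frechet differentiable_at_imp_differentiable_on)

lemma bump_algebra_continuous: "f \<in> bump_algebra \<Longrightarrow> continuous_on S f"
  by (intro differentiable_imp_continuous_on bump_algebra_differentiable_on)

text \<open>Only the first derivatives need to lie in the algebra. This covers primitives of bumps,
  which are not claimed to belong to it.\<close>

lemma smooth_fun_if_derivative_bump:
  assumes "f differentiable_on UNIV" "\<And>v. (\<lambda>x. frechet_derivative f (at x) v) \<in> bump_algebra"
  shows "smooth_fun UNIV f"
proof -
  have "vs \<noteq> [] \<Longrightarrow> iter_dderiv vs f \<in> bump_algebra" for vs
  proof (induction vs)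
    case (Cons v vs)
    then show ?case by (cases "vs = []") (simp_all add: assms(2) bump_algebra_frechet)
  qed simp
  then show ?thesis
    unfolding smooth_fun_def using assms(1) bump_algebra_differentiable_on by (metis iter_dderiv.simps(1))
qed

lemma bump_algebra_smooth: "f \<in> bump_algebra \<Longrightarrow> smooth_fun UNIV f"
  by (rule smooth_fun_if_derivative_bump) (auto intro: bump_algebra_differentiable_on bump_algebra_frechet)

text \<open>Supported in the box and increasing to its indicator as \<open>N\<close> grows, since
  \<open>exp (- 1 / (N s))\<close> tends to 1 for \<open>s > 0\<close>. The arguments of
  \<open>flat_exp\<close> are spelled out in the shape of the rule
  \<open>bump_algebra.flat\<close>.\<close>

definition box_bump :: "nat \<Rightarrow> 'a \<Rightarrow> 'a \<Rightarrow> 'a::euclidean_space \<Rightarrow> real" where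
  "box_bump N l u x = (\<Prod>b\<in>Basis.
     flat_exp 0 (x \<bullet> (real N *\<^sub>R b) + - (real N * (l \<bullet> b))) * flat_exp 0 (x \<bullet> (- real N *\<^sub>R b) + real N * (u \<bullet> b)))"

lemma box_bump_in_algebra: "box_bump N l u \<in> bump_algebra"
  unfolding box_bump_def by (intro bump_algebra_prod bump_algebra.intros)

lemma flat_exp_0_bounds: "0 \<le> flat_exp 0 t" "flat_exp 0 t \<le> 1"
  by (auto simp: flat_exp_def)

lemma box_bump_bounds: "0 \<le> box_bump N l u x" "box_bump N l u x \<le> 1"
  unfolding box_bump_def
  by (auto intro!: prod_nonneg prod_le_1 mult_nonneg_nonneg mult_le_one simp: flat_exp_0_bounds)

lemma box_bump_eq_0:
  assumes "x \<notin> box l u" shows "box_bump N l u x = 0"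
proof -
  obtain b where b: "b \<in> Basis" "x \<bullet> b \<le> l \<bullet> b \<or> u \<bullet> b \<le> x \<bullet> b"
    using assms by (auto simp: mem_box not_less)
  have "real N * (x \<bullet> b) \<le> real N * (l \<bullet> b) \<or> real N * (u \<bullet> b) \<le> real N * (x \<bullet> b)"
    using b by (auto intro: mult_left_mono)
  then have "flat_exp 0 (x \<bullet> (real N *\<^sub>R b) + - (real N * (l \<bullet> b))) *
      flat_exp 0 (x \<bullet> (- real N *\<^sub>R b) + real N * (u \<bullet> b)) = 0"
    by (auto simp: flat_exp_def)
  then show ?thesis unfolding box_bump_def using b by (intro prod_zero) auto
qed

lemma box_bump_tendsto:
  assumes "x \<in> box l u" shows "(\<lambda>N. box_bump N l u x) \<longlonglongrightarrow> 1"
proof -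
  have lim: "(\<lambda>N. flat_exp 0 (real N * s)) \<longlonglongrightarrow> 1" if s: "0 < s" for s
  proof -
    have "(\<lambda>N. exp (- 1 / s * inverse (real N))) \<longlonglongrightarrow> exp (- 1 / s * 0)"
      by (intro tendsto_intros lim_inverse_n)
    then have "(\<lambda>N. exp (- 1 / s * inverse (real N))) \<longlonglongrightarrow> 1" by simp
    then show ?thesis
      by (rule Lim_transform_eventually)
        (use s in \<open>auto simp: flat_exp_def field_simps intro!: eventually_sequentiallyI[of 1]\<close>)
  qed
  have "(\<lambda>N. \<Prod>b\<in>Basis. flat_exp 0 (real N * (x \<bullet> b - l \<bullet> b)) * flat_exp 0 (real N * (u \<bullet> b - x \<bullet> b)))
      \<longlonglongrightarrow> (\<Prod>b\<in>(Basis :: 'a set). 1 * 1)"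
    using assms by (intro tendsto_prod tendsto_mult lim) (auto simp: mem_box)
  then show ?thesis unfolding box_bump_def by (simp add: algebra_simps)
qed

text \<open>The fundamental lemma of the calculus of variations. Dominated convergence along
  \<open>box_bump\<close> shows that \<open>h\<close> has integral 0 over every closed box inside
  \<open>\<Omega>\<close>, and Lebesgue differentiation over shrinking cubes then gives
  \<open>h = 0\<close> almost everywhere.\<close>

lemma AE_eq_0_if_orthogonal_to_bumps:
  fixes h :: "'a::euclidean_space \<Rightarrow> real"
  assumes \<Omega>: "open \<Omega>" and h: "integrable (lebesgue_on \<Omega>) h"
    and orth: "\<And>\<psi> C. \<lbrakk>\<psi> \<in> bump_algebra; compact C; C \<subseteq> \<Omega>; \<And>x. x \<notin> C \<Longrightarrow> \<psi> x = 0\<rbrakk>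
      \<Longrightarrow> (LINT x|lebesgue_on \<Omega>. \<psi> x * h x) = 0"
  shows "AE x in lebesgue_on \<Omega>. h x = 0"
proof -
  have \<Omega>L: "\<Omega> \<in> sets lebesgue" using \<Omega> by auto
  have [measurable]: "h \<in> borel_measurable (lebesgue_on \<Omega>)" using h by auto
  define k where "k x = (if x \<in> \<Omega> then h x else 0)" for x
  have k: "integrable lebesgue k" unfolding k_def using h \<Omega>L by (simp add: Lebesgue_Measure.integrable_restrict_UNIV)
  have k_on: "integrable (lebesgue_on S) k" if "S \<in> sets lebesgue" for S
    using integrable_lebesgue_on_subset[of UNIV k S] k that by (simp add: lebesgue_on_UNIV_eq)
  have int0: "integral (cbox l u) k = 0" if sub: "cbox l u \<subseteq> \<Omega>" for l u
  proof -
    have "(\<lambda>N. LINT x|lebesgue_on \<Omega>. box_bump N l u x * h x) \<longlonglongrightarrow>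
        (LINT x|lebesgue_on \<Omega>. indicator (box l u) x * h x)"
    proof (rule integral_dominated_convergence[where w = "\<lambda>x. \<bar>h x\<bar>"])
      have bm: "box_bump N l u \<in> borel_measurable (lebesgue_on \<Omega>)" for N
        by (rule continuous_imp_measurable_on_sets_lebesgue[OF bump_algebra_continuous[OF box_bump_in_algebra] \<Omega>L])
      show "(\<lambda>x. box_bump N l u x * h x) \<in> borel_measurable (lebesgue_on \<Omega>)" for N
        using bm by (intro borel_measurable_times) auto
      have "box l u \<in> sets (lebesgue_on \<Omega>)"
        using sub \<Omega>L box_subset_cbox[of l u] by (subst sets_restrict_space_iff) auto
      then show "(\<lambda>x. indicator (box l u) x * h x) \<in> borel_measurable (lebesgue_on \<Omega>)" by measurable
      show "integrable (lebesgue_on \<Omega>) (\<lambda>x. \<bar>h x\<bar>)" using h by simp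
      show "AE x in lebesgue_on \<Omega>. (\<lambda>N. box_bump N l u x * h x) \<longlonglongrightarrow> indicator (box l u) x * h x"
      proof (intro AE_I2 tendsto_mult tendsto_const)
        show "(\<lambda>N. box_bump N l u x) \<longlonglongrightarrow> indicator (box l u) x" for x
          using box_bump_tendsto[of x l u] box_bump_eq_0[of x l u] by (cases "x \<in> box l u") simp_all
      qed
      show "AE x in lebesgue_on \<Omega>. norm (box_bump N l u x * h x) \<le> \<bar>h x\<bar>" for N
        using box_bump_bounds[of N l u] by (auto simp: abs_mult intro!: mult_left_le_one_le AE_I2)
    qed
    moreover have "(LINT x|lebesgue_on \<Omega>. box_bump N l u x * h x) = 0" for N
      using sub box_bump_eq_0[of _ l u N] box_subset_cbox[of l u]
      by (intro orth[of _ "cbox l u"] box_bump_in_algebra) auto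
    ultimately have "(LINT x|lebesgue_on \<Omega>. indicator (box l u) x * h x) = 0"
      by (simp add: LIMSEQ_const_iff)
    also have "(LINT x|lebesgue_on \<Omega>. indicator (box l u) x * h x) = (LINT x|lebesgue_on \<Omega>. (if x \<in> box l u then k x else 0))"
      by (intro Bochner_Integration.integral_cong) (auto simp: k_def indicator_def)
    also have "\<dots> = (LINT x|lebesgue_on (box l u). k x)"
      using sub \<Omega>L box_subset_cbox[of l u] by (intro integral_lebesgue_on_if) auto
    also have "\<dots> = integral (box l u) k"
      by (rule lebesgue_integral_eq_integral) (auto intro: k_on)
    finally show ?thesis by (simp add: integral_open_interval)
  qed
  obtain N where N: "negligible N" and lim: "\<And>x e. \<lbrakk>x \<notin> N; 0 < e\<rbrakk> \<Longrightarrow>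
      \<exists>d>0. \<forall>s. 0 < s \<and> s < d \<longrightarrow> norm (integral (cbox x (x + s *\<^sub>R One)) k /\<^sub>R s ^ DIM('a) - k x) < e"
  proof (rule integrable_ccontinuous_explicit[of k])
    show "k integrable_on cbox a b" for a b
      by (rule integrable_on_lebesgue_on) (auto intro: k_on)
  qed blast
  have "k x = 0" if x: "x \<in> \<Omega>" "x \<notin> N" for x
  proof (rule ccontr)
    assume "k x \<noteq> 0"
    then obtain d where d: "d > 0" "\<And>s. 0 < s \<Longrightarrow> s < d \<Longrightarrow>
        norm (integral (cbox x (x + s *\<^sub>R One)) k /\<^sub>R s ^ DIM('a) - k x) < norm (k x)"
      using lim[OF x(2), of "norm (k x)"] by auto
    obtain r where r: "r > 0" "cball x r \<subseteq> \<Omega>" using \<Omega> x(1) open_contains_cball by blast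
    \<comment> \<open>The first bound makes the cube small enough for the differentiation theorem.
      The second keeps it in the ball of radius \<open>r\<close>, because the Euclidean norm is at
      most the sum of the coordinates.\<close>
    define s where "s = min (d / 2) (r / DIM('a))"
    have s: "0 < s" "s < d" "s * DIM('a) \<le> r" using d r by (auto simp: s_def min_def field_simps)
    have "cbox x (x + s *\<^sub>R One) \<subseteq> cball x r"
    proof
      fix y assume y: "y \<in> cbox x (x + s *\<^sub>R One)"
      have "norm (y - x) \<le> (\<Sum>b\<in>Basis. \<bar>(y - x) \<bullet> b\<bar>)" by (rule norm_le_l1)
      also have "\<dots> \<le> (\<Sum>b\<in>(Basis :: 'a set). s)"
      proof (intro sum_mono)
        fix b :: 'a assume b: "b \<in> Basis"
        then have "x \<bullet> b \<le> y \<bullet> b" "y \<bullet> b \<le> x \<bullet> b + s"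
          using y by (auto simp: mem_box inner_add_left)
        then show "\<bar>(y - x) \<bullet> b\<bar> \<le> s" by (simp add: inner_diff_left)
      qed
      also have "\<dots> \<le> r" using s by (simp add: mult.commute)
      finally show "y \<in> cball x r" by (simp add: dist_norm norm_minus_commute)
    qed
    then have "integral (cbox x (x + s *\<^sub>R One)) k = 0" using r by (intro int0) auto
    then show False using d(2)[OF s(1,2)] by simp
  qed
  then have "{x. \<not> (x \<in> \<Omega> \<longrightarrow> h x = 0)} \<subseteq> N" by (auto simp: k_def)
  then have "AE x in lebesgue. x \<in> \<Omega> \<longrightarrow> h x = 0"
    using N by (auto simp: eventually_ae_filter negligible_iff_null_sets)
  then show ?thesis using \<Omega>L by (simp add: AE_lebesgue_on_iff)
qed


section \<open>Weak derivatives in time\<close>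

lemma integrable_open_interval:
  fixes h :: "real \<Rightarrow> real"
  shows "integrable (lebesgue_on {a<..<b}) h \<longleftrightarrow> integrable (lebesgue_on {a..b}) h"
  using absolutely_integrable_on_open_interval[where f = h and a = a and b = b]
  by (simp add: box_real cbox_interval set_integrable_def integrable_restrict_space)

lemma integral_lebesgue_on_open_interval:
  fixes h :: "real \<Rightarrow> real"
  shows "(LINT t|lebesgue_on {a<..<b}. h t) = (LINT t|lebesgue_on {a..b}. h t)"
proof (cases "integrable (lebesgue_on {a..b}) h")
  case True
  then show ?thesis
    using lebesgue_integral_eq_integral[of "{a<..<b}" h] lebesgue_integral_eq_integral[of "{a..b}" h]
      integral_open_interval_real[of a b h] integrable_open_interval[of a b h] by simp
next
  case False
  then show ?thesis using integrable_open_interval[of a b h] by (simp add: not_integrable_integral_eq)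
qed

lemma AE_open_interval: "(AE t::real in lebesgue_on {a<..<b}. P t) \<longleftrightarrow> (AE t in lebesgue_on {a..b}. P t)"
proof
  assume "AE t in lebesgue_on {a<..<b}. P t"
  then have P: "AE t in lebesgue. t \<in> {a<..<b} \<longrightarrow> P t" by (simp add: AE_lebesgue_on_iff)
  have "AE t in lebesgue. t \<notin> {a, b}"
    by (rule AE_not_in) (simp add: negligible_iff_null_sets[symmetric])
  with P have "AE t in lebesgue. t \<in> {a..b} \<longrightarrow> P t" by eventually_elim auto
  then show "AE t in lebesgue_on {a..b}. P t" by (simp add: AE_lebesgue_on_iff)
qed (auto elim: AE_lebesgue_on_subset)

text \<open>The primitive of \<open>\<kappa>\<close> is constant beyond the support, and the
  vanishing mean makes that constant 0. So it has compact support and is an admissible test function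
  in time.\<close>

lemma bump_primitive:
  assumes T: "0 < T" and \<kappa>: "\<kappa> \<in> bump_algebra" and C: "compact C" "C \<subseteq> {0<..<T}" and supp: "\<And>t. t \<notin> C \<Longrightarrow> \<kappa> t = 0"
    and mean: "(LINT t|lebesgue_on {0..T}. \<kappa> t) = 0"
  obtains \<phi> D where "smooth_fun UNIV \<phi>" "deriv \<phi> = \<kappa>" "compact D" "D \<subseteq> {0<..<T}" "\<And>t. t \<notin> D \<Longrightarrow> \<phi> t = 0"
    "\<And>t. \<phi> t = (LINT s|lebesgue_on {0..t}. \<kappa> s)"
proof -
  define \<phi> where "\<phi> t = (LINT s|lebesgue_on {0..t}. \<kappa> s)" for t
  have \<kappa>i: "integrable (lebesgue_on {a..b}) \<kappa>" for a b
    by (rule continuous_imp_integrable_real[OF bump_algebra_continuous[OF \<kappa>]])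
  have \<phi>: "\<phi> t = integral {0..t} \<kappa>" for t
    unfolding \<phi>_def by (rule lebesgue_integral_eq_integral[OF \<kappa>i]) simp
  obtain a b where ab: "0 < a" "b < T" "C \<subseteq> {a..b}" "0 < b"
  proof (cases "C = {}")
    case True
    show ?thesis by (rule that[of 1 "T / 2"]) (use T True in auto)
  next
    case False
    have "Inf C \<in> C" "Sup C \<in> C"
      using C False closed_contains_Inf closed_contains_Sup
      by (auto simp: compact_eq_bounded_closed bounded_imp_bdd_below bounded_imp_bdd_above)
    moreover have "C \<subseteq> {Inf C..Sup C}"
      using C by (auto simp: compact_eq_bounded_closed intro!: cInf_lower cSup_upper
          bounded_imp_bdd_below bounded_imp_bdd_above)
    ultimately show ?thesis using C by (intro that[of "Inf C" "Sup C"]) auto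
  qed
  have left: "\<phi> t = 0" if "t < a" for t
  proof -
    have "\<kappa> s = 0" if "s \<in> {0..t}" for s using that \<open>t < a\<close> ab by (intro supp) auto
    then have "integral {0..t} \<kappa> = integral {0..t} (\<lambda>_. 0)" by (intro integral_cong)
    then show ?thesis by (simp add: \<phi>)
  qed
  have right: "\<phi> t = 0" if "b < t" for t
  proof -
    have zero: "integral {b..s} \<kappa> = 0" for s
    proof -
      have "integral {b<..<s} \<kappa> = integral {b<..<s} (\<lambda>_. 0)"
        using ab supp by (intro integral_cong) force
      then show ?thesis by (simp add: integral_open_interval_real)
    qed
    have int: "\<kappa> integrable_on {0..s}" for s
      by (rule integrable_on_lebesgue_on[OF \<kappa>i]) simp
    have "integral {0..s} \<kappa> = integral {0..b} \<kappa>" if "b < s" for s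
      using Henstock_Kurzweil_Integration.integral_combine[of 0 b s \<kappa>] ab that int zero[of s] by simp
    \<comment> \<open>Beyond \<open>b\<close> the integral no longer depends on the upper limit, and
      at \<open>T\<close> it is the mean of \<open>\<kappa>\<close>.\<close>
    from this[OF that] this[of T] mean show ?thesis
      using ab lebesgue_integral_eq_integral[OF \<kappa>i, of 0 T] by (simp add: \<phi>)
  qed
  \<comment> \<open>The formula for \<open>\<phi>\<close> is an honest primitive only for positive
    \<open>t\<close>, as \<open>{0..t}\<close> is empty for negative \<open>t\<close>. Left of
    \<open>a\<close> the derivative comes from \<open>\<phi>\<close> being locally 0.\<close>
  have der: "(\<phi> has_real_derivative \<kappa> t) (at t)" for t
  proof (cases "t < a")
    case True
    have "((\<lambda>_. 0) has_real_derivative 0) (at t)" by simp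
    then have "(\<phi> has_real_derivative 0) (at t)"
      by (rule has_field_derivative_transform_within_open[of _ _ _ "{..<a}"]) (use True left in auto)
    moreover have "t \<notin> C" using True ab by auto
    ultimately show ?thesis using supp[of t] by simp
  next
    case False
    then have t: "0 < t" using ab by simp
    have "((\<lambda>x. integral {0..x} \<kappa>) has_real_derivative \<kappa> t) (at t within {0..t + 1})"
      by (rule integral_has_real_derivative[OF bump_algebra_continuous[OF \<kappa>]]) (use t in auto)
    moreover have "at t within {0..t + 1} = at t"
      by (rule at_within_interior) (use t in simp)
    ultimately show ?thesis by (simp add: \<phi>[abs_def])
  qed
  have fd: "frechet_derivative \<phi> (at t) v = \<kappa> t * v" for t v
    using frechet_derivative_at[OF has_field_derivative_imp_has_derivative[OF der[of t]]] by metis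
  show ?thesis
  proof (rule that)
    have "(\<lambda>x. frechet_derivative \<phi> (at x) v) \<in> bump_algebra" for v
      unfolding fd using \<kappa> by (intro bump_algebra.intros)
    then show "smooth_fun UNIV \<phi>"
      using der by (intro smooth_fun_if_derivative_bump) 
        (auto simp: differentiable_on_def real_differentiable_def intro: real_differentiableE)
    show "deriv \<phi> = \<kappa>" using der DERIV_imp_deriv by blast
    show "compact {a..b}" "{a..b} \<subseteq> {0<..<T}" using ab by auto
    show "\<phi> t = 0" if "t \<notin> {a..b}" for t using that left right by force
  qed (simp add: \<phi>_def)
qed

text \<open>The lemma of du Bois-Reymond: \<open>K = A - G\<close>, with \<open>G\<close> the
  primitive of \<open>B\<close>, integrates to 0 against every bump of mean zero, and hence is
  constant. The constant is the average of \<open>K\<close> with weight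
  \<open>\<theta>0\<close>.\<close>

lemma weak_time_derivative_imp_primitive:
  assumes T: "0 < T" and A: "integrable (lebesgue_on {0..T}) A" and B: "integrable (lebesgue_on {0..T}) B"
    and weak: "\<And>\<phi> C. \<lbrakk>smooth_fun UNIV \<phi>; compact C; C \<subseteq> {0<..<T}; \<And>t. t \<notin> C \<Longrightarrow> \<phi> t = 0\<rbrakk>
      \<Longrightarrow> (LINT t|lebesgue_on {0..T}. deriv \<phi> t * A t) = - (LINT t|lebesgue_on {0..T}. \<phi> t * B t)"
  shows "\<exists>\<alpha>. AE t in lebesgue_on {0..T}. A t = \<alpha> + (LINT s|lebesgue_on {0..t}. B s)"
proof -
  define G where "G t = (LINT s|lebesgue_on {0..t}. B s)" for t
  have prim: "primitive T G B"
    using primitive_integral[of T B 0] T B by (simp add: G_def[abs_def])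
  have bump_int: "integrable (lebesgue_on {0..T}) (\<lambda>t. \<psi> t * f t)"
    if \<psi>: "\<psi> \<in> bump_algebra" and f: "integrable (lebesgue_on {0..T}) f" for \<psi> f
  proof -
    have "bounded (\<psi> ` {0..T})"
      by (intro compact_imp_bounded compact_continuous_image bump_algebra_continuous \<psi>) simp
    then obtain M where M: "\<And>t. t \<in> {0..T} \<Longrightarrow> norm (\<psi> t) \<le> M"
      unfolding bounded_iff by blast
    show ?thesis
    proof (rule Bochner_Integration.integrable_bound)
      show "integrable (lebesgue_on {0..T}) (\<lambda>t. M * f t)" using f by simp
      show "(\<lambda>t. \<psi> t * f t) \<in> borel_measurable (lebesgue_on {0..T})"
        using f by (intro borel_measurable_times borel_measurable_integrable
            continuous_imp_measurable_on_sets_lebesgue bump_algebra_continuous \<psi>) auto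
      show "AE t in lebesgue_on {0..T}. norm (\<psi> t * f t) \<le> norm (M * f t)"
      proof (rule AE_I2)
        fix t assume "t \<in> space (lebesgue_on {0..T})"
        then have "\<bar>\<psi> t\<bar> \<le> \<bar>M\<bar>" using M[of t] by simp
        then show "norm (\<psi> t * f t) \<le> norm (M * f t)" by (simp add: abs_mult mult_right_mono)
      qed
    qed
  qed
  have Gi: "integrable (lebesgue_on {0..T}) G"
    by (rule continuous_imp_integrable_real[OF primitive_continuous[OF prim]])
  define K where "K t = A t - G t" for t
  have K: "integrable (lebesgue_on {0..T}) K" unfolding K_def using A Gi by simp
  have K0: "(LINT t|lebesgue_on {0..T}. \<kappa> t * K t) = 0"
    if \<kappa>: "\<kappa> \<in> bump_algebra" "compact C" "C \<subseteq> {0<..<T}" "\<And>t. t \<notin> C \<Longrightarrow> \<kappa> t = 0"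
      "(LINT t|lebesgue_on {0..T}. \<kappa> t) = 0" for \<kappa> C
  proof -
    obtain \<phi> D where \<phi>: "smooth_fun UNIV \<phi>" "deriv \<phi> = \<kappa>" "compact D" "D \<subseteq> {0<..<T}" "\<And>t. t \<notin> D \<Longrightarrow> \<phi> t = 0"
      "\<And>t. \<phi> t = (LINT s|lebesgue_on {0..t}. \<kappa> s)"
      using bump_primitive[OF T \<kappa>] by blast
    have \<kappa>i: "integrable (lebesgue_on {0..T}) \<kappa>"
      by (rule continuous_imp_integrable_real[OF bump_algebra_continuous[OF \<kappa>(1)]])
    have "(LINT t|lebesgue_on {0..T}. \<kappa> t * A t) = - (LINT t|lebesgue_on {0..T}. B t * \<phi> t)"
      using weak[OF \<phi>(1,3,4,5)] by (simp add: \<phi>(2) mult.commute)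
    \<comment> \<open>Integration by parts; the boundary term carries the mean of
      \<open>\<kappa>\<close> as a factor and vanishes.\<close>
    moreover have "(LINT t|lebesgue_on {0..T}. \<kappa> t * G t) + (LINT t|lebesgue_on {0..T}. B t * \<phi> t) = 0"
      using integral_times_primitive(2)[OF B \<kappa>i] \<kappa>(5) unfolding G_def \<phi>(6) by simp
    ultimately show ?thesis
      using bump_int[OF \<kappa>(1) A] bump_int[OF \<kappa>(1) Gi] unfolding K_def by (simp add: right_diff_distrib)
  qed
  \<comment> \<open>A fixed bump of nonzero mean in the middle of the interval. Adding a multiple of
    it to an arbitrary bump \<open>\<psi>\<close> makes the mean zero, so that \<open>K0\<close>
    applies.\<close>
  define \<theta>0 where "\<theta>0 = box_bump 1 (T / 3) (2 * T / 3)"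
  have \<theta>0: "\<theta>0 \<in> bump_algebra" by (simp add: \<theta>0_def box_bump_in_algebra)
  have \<theta>0i: "integrable (lebesgue_on {0..T}) \<theta>0"
    by (rule continuous_imp_integrable_real[OF bump_algebra_continuous[OF \<theta>0]])
  have \<theta>0s: "\<theta>0 t = 0" if "t \<notin> {T / 3..2 * T / 3}" for t
    unfolding \<theta>0_def by (rule box_bump_eq_0) (use that in \<open>auto simp: box_real\<close>)
  define w where "w = (LINT t|lebesgue_on {0..T}. \<theta>0 t)"
  have "w \<noteq> 0"
  proof
    assume "w = 0"
    then have "AE t in lebesgue_on {0..T}. \<theta>0 t = 0"
      using integral_nonneg_eq_0_iff_AE[OF \<theta>0i] by (auto simp: w_def \<theta>0_def box_bump_bounds)
    then have "\<theta>0 (T / 2) \<le> 0"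
      using T by (intro AE_le_continuous_imp_le[OF T bump_algebra_continuous[OF \<theta>0]])
        (auto elim!: eventually_mono)
    moreover have "\<theta>0 (T / 2) > 0"
      using T by (simp add: \<theta>0_def box_bump_def flat_exp_def)
    ultimately show False by simp
  qed
  define \<alpha> where "\<alpha> = (LINT t|lebesgue_on {0..T}. \<theta>0 t * K t) / w"
  have "AE t in lebesgue_on {0<..<T}. K t - \<alpha> = 0"
  proof (rule AE_eq_0_if_orthogonal_to_bumps)
    show "integrable (lebesgue_on {0<..<T}) (\<lambda>t. K t - \<alpha>)"
      unfolding integrable_open_interval using K
      by (rule Bochner_Integration.integrable_diff) (intro continuous_imp_integrable_real continuous_intros)
    fix \<psi> C assume \<psi>: "\<psi> \<in> bump_algebra" "compact C" "C \<subseteq> {0<..<T}" "\<And>t. t \<notin> C \<Longrightarrow> \<psi> t = 0"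
    have \<psi>i: "integrable (lebesgue_on {0..T}) \<psi>"
      by (rule continuous_imp_integrable_real[OF bump_algebra_continuous[OF \<psi>(1)]])
    define p where "p = (LINT t|lebesgue_on {0..T}. \<psi> t)"
    define q where "q = - p / w"
    have "(LINT t|lebesgue_on {0..T}. (\<psi> t + q * \<theta>0 t) * K t) = 0"
    proof (rule K0)
      show "(\<lambda>t. \<psi> t + q * \<theta>0 t) \<in> bump_algebra"
        using \<psi>(1) \<theta>0 by (intro bump_algebra.intros)
      show "compact (C \<union> {T / 3..2 * T / 3})" using \<psi> by auto
      show "C \<union> {T / 3..2 * T / 3} \<subseteq> {0<..<T}" using \<psi> T by auto
      show "\<psi> t + q * \<theta>0 t = 0" if "t \<notin> C \<union> {T / 3..2 * T / 3}" for t
        using that \<psi>(4)[of t] \<theta>0s[of t] by simp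
      show "(LINT t|lebesgue_on {0..T}. \<psi> t + q * \<theta>0 t) = 0"
        using \<psi>i \<theta>0i \<open>w \<noteq> 0\<close> by (simp add: p_def[symmetric] w_def[symmetric] q_def)
    qed
    moreover have "(LINT t|lebesgue_on {0..T}. (\<psi> t + q * \<theta>0 t) * K t)
        = (LINT t|lebesgue_on {0..T}. \<psi> t * K t) + q * (LINT t|lebesgue_on {0..T}. \<theta>0 t * K t)"
      using bump_int[OF \<psi>(1) K] bump_int[OF \<theta>0 K] by (simp add: distrib_right mult.assoc)
    ultimately have "(LINT t|lebesgue_on {0..T}. \<psi> t * K t) = p * \<alpha>" by (simp add: \<alpha>_def q_def)
    then show "(LINT t|lebesgue_on {0<..<T}. \<psi> t * (K t - \<alpha>)) = 0"
      unfolding integral_lebesgue_on_open_interval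
      using bump_int[OF \<psi>(1) K] \<psi>i by (simp add: right_diff_distrib p_def)
  qed auto
  then show ?thesis
    unfolding AE_open_interval by (intro exI[of _ \<alpha>]) (auto simp: K_def G_def elim!: eventually_mono)
qed


section \<open>Square-integrable forms\<close>

definition square_integrable :: "'a::euclidean_space set \<Rightarrow> ('a \<Rightarrow> real) \<Rightarrow> bool" where
  "square_integrable \<Omega> h \<longleftrightarrow> h \<in> borel_measurable (lebesgue_on \<Omega>) \<and> integrable (lebesgue_on \<Omega>) (\<lambda>x. (h x)\<^sup>2)"

lemma square_integrable_times:
  assumes g: "square_integrable \<Omega> g" and h: "square_integrable \<Omega> h"
  shows "integrable (lebesgue_on \<Omega>) (\<lambda>x. g x * h x)"
proof (rule Bochner_Integration.integrable_bound)
  show "integrable (lebesgue_on \<Omega>) (\<lambda>x. (g x)\<^sup>2 + (h x)\<^sup>2)"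
    using g h by (simp add: square_integrable_def)
  show "(\<lambda>x. g x * h x) \<in> borel_measurable (lebesgue_on \<Omega>)"
    using g h by (auto simp: square_integrable_def)
  have "\<bar>a * b\<bar> \<le> a\<^sup>2 + b\<^sup>2" for a b :: real
  proof -
    have "0 \<le> \<bar>a * b\<bar>" "2 * \<bar>a * b\<bar> \<le> a\<^sup>2 + b\<^sup>2"
      using sum_squares_bound[of "\<bar>a\<bar>" "\<bar>b\<bar>"] by (simp_all add: abs_mult mult.assoc)
    then show ?thesis by linarith
  qed
  then show "AE x in lebesgue_on \<Omega>. norm (g x * h x) \<le> norm ((g x)\<^sup>2 + (h x)\<^sup>2)" by simp
qed

lemma square_integrable_add:
  assumes g: "square_integrable \<Omega> g" and h: "square_integrable \<Omega> h"
  shows "square_integrable \<Omega> (\<lambda>x. g x + h x)"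
proof -
  have "integrable (lebesgue_on \<Omega>) (\<lambda>x. (g x)\<^sup>2 + (h x)\<^sup>2 + 2 * (g x * h x))"
    using g h square_integrable_times[OF g h]
    by (intro Bochner_Integration.integrable_add integrable_mult_right) (auto simp: square_integrable_def)
  moreover have "(g x)\<^sup>2 + (h x)\<^sup>2 + 2 * (g x * h x) = (g x + h x)\<^sup>2" for x
    by (simp add: power2_sum)
  ultimately show ?thesis using g h by (auto simp: square_integrable_def)
qed

lemma square_integrable_scale: "square_integrable \<Omega> h \<Longrightarrow> square_integrable \<Omega> (\<lambda>x. c * h x)"
  by (auto simp: square_integrable_def power_mult_distrib)

lemma square_integrable_zero: "square_integrable \<Omega> (\<lambda>x. 0)"
  by (simp add: square_integrable_def)

lemma square_integrable_imp_integrable: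
  assumes \<Omega>: "\<Omega> \<in> lmeasurable" and h: "square_integrable \<Omega> h"
  shows "integrable (lebesgue_on \<Omega>) h"
proof -
  interpret finite_measure "lebesgue_on \<Omega>" using \<Omega> by (rule finite_measure_lebesgue_on)
  have "square_integrable \<Omega> (\<lambda>x. 1)" by (simp add: square_integrable_def)
  from square_integrable_times[OF this h] show ?thesis by simp
qed

lemma square_integrable_continuous:
  assumes \<Omega>: "\<Omega> \<in> sets lebesgue" "bounded \<Omega>" and h: "continuous_on UNIV h"
  shows "square_integrable \<Omega> h"
proof -
  have \<Omega>m: "\<Omega> \<in> lmeasurable" using \<Omega> by (simp add: bounded_set_imp_lmeasurable)
  interpret finite_measure "lebesgue_on \<Omega>" using \<Omega>m by (rule finite_measure_lebesgue_on)
  have "bounded (h ` closure \<Omega>)"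
    using \<Omega> h by (intro compact_imp_bounded compact_continuous_image) (auto intro: continuous_on_subset)
  then obtain M where M: "\<And>x. x \<in> closure \<Omega> \<Longrightarrow> norm (h x) \<le> M" unfolding bounded_iff by blast
  have meas: "h \<in> borel_measurable (lebesgue_on \<Omega>)"
    by (rule continuous_imp_measurable_on_sets_lebesgue[OF continuous_on_subset[OF h] \<Omega>(1)]) simp
  moreover have "integrable (lebesgue_on \<Omega>) (\<lambda>x. (h x)\<^sup>2)"
  proof (rule integrable_const_bound)
    show "AE x in lebesgue_on \<Omega>. norm ((h x)\<^sup>2) \<le> M\<^sup>2"
    proof (rule AE_I2)
      fix x assume "x \<in> space (lebesgue_on \<Omega>)"
      then have "\<bar>h x\<bar> \<le> M" using M[of x] closure_subset[of \<Omega>] by auto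
      then show "norm ((h x)\<^sup>2) \<le> M\<^sup>2" by (simp add: abs_le_square_iff[symmetric])
    qed
    show "(\<lambda>x. (h x)\<^sup>2) \<in> borel_measurable (lebesgue_on \<Omega>)" using meas by measurable
  qed
  ultimately show ?thesis by (simp add: square_integrable_def)
qed

section \<open>The pointwise inner product of alternating maps\<close>

definition basis_lists :: "'a::euclidean_space list set" where
  "basis_lists = {vs. set vs \<subseteq> Basis \<and> distinct vs}"

lemma length_basis_lists: "vs \<in> basis_lists \<Longrightarrow> length vs \<le> DIM('a)"
  for vs :: "'a::euclidean_space list"
  unfolding basis_lists_def using card_mono[of "Basis :: 'a set" "set vs"] by (simp add: distinct_card)

lemma finite_basis_lists: "finite (basis_lists :: 'a::euclidean_space list set)"
proof (rule finite_subset)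
  show "basis_lists \<subseteq> {vs :: 'a list. set vs \<subseteq> Basis \<and> length vs \<le> DIM('a)}"
    using length_basis_lists by (auto simp: basis_lists_def)
qed (simp add: finite_lists_length_le)

lemma alt_inner_eq: "alt_inner \<alpha> \<beta> = (\<Sum>vs\<in>basis_lists. \<alpha> vs * \<beta> vs / fact (length vs))"
  by (simp add: alt_inner_def basis_lists_def)

definition alt_scale :: "real \<Rightarrow> ('a list \<Rightarrow> real) \<Rightarrow> 'a list \<Rightarrow> real" where
  "alt_scale c \<alpha> = (\<lambda>vs. c * \<alpha> vs)"

definition form_scale :: "real \<Rightarrow> 'a form \<Rightarrow> 'a form" where
  "form_scale c \<omega> = (\<lambda>x vs. c * \<omega> x vs)"

lemma sum_apply: "(\<Sum>i\<in>I. f i) x = (\<Sum>i\<in>I. f i x)"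
  by (induction I rule: infinite_finite_induct) auto

interpretation alt: vector_space alt_scale
  by standard (auto simp: alt_scale_def fun_eq_iff algebra_simps)

interpretation form: vector_space form_scale
  by standard (auto simp: form_scale_def fun_eq_iff algebra_simps)

interpretation alt: semi_inner_product alt_scale UNIV alt_inner
proof
  show "alt_inner \<alpha> \<beta> = alt_inner \<beta> \<alpha>" for \<alpha> \<beta> :: "'a list \<Rightarrow> real"
    by (simp add: alt_inner_eq mult.commute)
  show "alt_inner (\<alpha> + \<beta>) \<gamma> = alt_inner \<alpha> \<gamma> + alt_inner \<beta> \<gamma>" for \<alpha> \<beta> \<gamma> :: "'a list \<Rightarrow> real"
    by (simp add: alt_inner_eq sum.distrib[symmetric] distrib_right add_divide_distrib)
  show "alt_inner (alt_scale c \<alpha>) \<beta> = c * alt_inner \<alpha> \<beta>" for c and \<alpha> \<beta> :: "'a list \<Rightarrow> real"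
    by (simp add: alt_inner_eq alt_scale_def sum_distrib_left mult.assoc)
  show "0 \<le> alt_inner \<alpha> \<alpha>" for \<alpha> :: "'a list \<Rightarrow> real"
    by (simp add: alt_inner_eq sum_nonneg)
qed (rule alt.subspace_UNIV)

lemma alternating_add: "alternating j \<alpha> \<Longrightarrow> alternating j \<beta> \<Longrightarrow> alternating j (\<alpha> + \<beta>)"
  unfolding alternating_def by (auto intro: linear_compose_add)

lemma alternating_scale: "alternating j \<alpha> \<Longrightarrow> alternating j (alt_scale c \<alpha>)"
  unfolding alternating_def alt_scale_def
  by (auto simp: linear_iff algebra_simps)

lemma alternating_zero: "alternating j 0"
  unfolding alternating_def by (auto simp: linear_zero zero_fun_def)

lemma subspace_alternating: "alt.subspace {\<alpha>. alternating j \<alpha>}"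
  by (rule alt.subspaceI) (auto simp: alternating_add alternating_scale alternating_zero)

text \<open>The inner product reads values on basis lists only, so the point functions of these
  finitely many lists generate everything modulo null maps. They need not be alternating, which
  \<open>ex_orthonormal_basis\<close> permits.\<close>

lemma ex_orthonormal_alternating: "\<exists>B. alt.orthonormal_basis B {\<alpha>. alternating j (\<alpha> :: 'a::euclidean_space list \<Rightarrow> real)}"
proof (rule alt.ex_orthonormal_basis[OF finite_basis_lists subspace_alternating])
  fix \<alpha> :: "'a list \<Rightarrow> real"
  let ?e = "\<lambda>vs ws. if ws = vs then 1 else 0 :: real"
  have "(\<alpha> - (\<Sum>vs\<in>basis_lists. alt_scale (\<alpha> vs) (?e vs))) ws = 0" if "ws \<in> basis_lists" for ws
    using that by (simp add: sum_apply alt_scale_def if_distrib finite_basis_lists cong: if_cong)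
  then have "alt_inner (\<alpha> - (\<Sum>vs\<in>basis_lists. alt_scale (\<alpha> vs) (?e vs)))
      (\<alpha> - (\<Sum>vs\<in>basis_lists. alt_scale (\<alpha> vs) (?e vs))) = 0"
    unfolding alt_inner_eq by (intro sum.neutral ballI) simp
  then show "\<exists>c. alt_inner (\<alpha> - (\<Sum>vs\<in>basis_lists. alt_scale (c vs) (?e vs)))
      (\<alpha> - (\<Sum>vs\<in>basis_lists. alt_scale (c vs) (?e vs))) = 0" by blast
qed auto

text \<open>The ambient space of the semi-inner product. It asks for nothing beyond the values that
  the inner product reads, so that it also holds codifferentials of test forms and truncated,
  non-alternating pieces of polynomials.\<close>

definition L2_fields :: "'a::euclidean_space set \<Rightarrow> 'a form set" where
  "L2_fields \<Omega> = {\<omega>. \<forall>vs\<in>basis_lists. square_integrable \<Omega> (\<lambda>x. \<omega> x vs)}"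

lemma subspace_L2_fields: "form.subspace (L2_fields \<Omega>)"
  by (rule form.subspaceI)
    (auto simp: L2_fields_def form_scale_def square_integrable_add square_integrable_scale square_integrable_zero)

lemma integrable_alt_inner:
  assumes "\<omega> \<in> L2_fields \<Omega>" "\<eta> \<in> L2_fields \<Omega>"
  shows "integrable (lebesgue_on \<Omega>) (\<lambda>x. alt_inner (\<omega> x) (\<eta> x))"
  unfolding alt_inner_eq using assms
  by (intro Bochner_Integration.integrable_sum integrable_divide square_integrable_times) (auto simp: L2_fields_def)

interpretation L2: semi_inner_product form_scale "L2_fields \<Omega>" "l2_inner \<Omega>" for \<Omega> :: "'a::euclidean_space set"
proof
  show "form.subspace (L2_fields \<Omega>)" by (rule subspace_L2_fields)
  show "l2_inner \<Omega> \<omega> \<eta> = l2_inner \<Omega> \<eta> \<omega>" for \<omega> \<eta>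
    unfolding l2_inner_def by (intro Bochner_Integration.integral_cong refl alt.ip_commute)
  show "l2_inner \<Omega> (\<omega> + \<eta>) \<zeta> = l2_inner \<Omega> \<omega> \<zeta> + l2_inner \<Omega> \<eta> \<zeta>"
    if "\<omega> \<in> L2_fields \<Omega>" "\<eta> \<in> L2_fields \<Omega>" "\<zeta> \<in> L2_fields \<Omega>" for \<omega> \<eta> \<zeta>
    using that by (simp add: l2_inner_def alt.ip_add_left integrable_alt_inner)
  show "l2_inner \<Omega> (form_scale c \<omega>) \<eta> = c * l2_inner \<Omega> \<omega> \<eta>" for c \<omega> \<eta>
  proof -
    have "form_scale c \<omega> x = alt_scale c (\<omega> x)" for x by (simp add: form_scale_def alt_scale_def)
    then show ?thesis by (simp add: l2_inner_def alt.ip_scale_left)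
  qed
  show "0 \<le> l2_inner \<Omega> \<omega> \<omega>" for \<omega>
    unfolding l2_inner_def by (intro Bochner_Integration.integral_nonneg alt.ip_nonneg) simp
qed

section \<open>Square-integrable forms and test forms\<close>

lemma L2_forms_subset_fields: "L2_forms \<Omega> j \<subseteq> L2_fields \<Omega>"
  by (auto simp: L2_forms_def L2_fields_def square_integrable_def)

lemma L2_forms_fields: "\<omega> \<in> L2_forms \<Omega> j \<Longrightarrow> \<omega> \<in> L2_fields \<Omega>"
  using L2_forms_subset_fields by (rule subsetD)

lemma L2_forms_eq: "L2_forms \<Omega> j = {\<omega>. (\<forall>x\<in>\<Omega>. alternating j (\<omega> x)) \<and> (\<forall>vs. square_integrable \<Omega> (\<lambda>x. \<omega> x vs))}"
  by (auto simp: L2_forms_def square_integrable_def)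

lemma subspace_L2_forms: "form.subspace (L2_forms \<Omega> j)"
proof (rule form.subspaceI)
  show "0 \<in> L2_forms \<Omega> j" by (simp add: L2_forms_eq square_integrable_zero alternating_zero)
  show "\<omega> + \<eta> \<in> L2_forms \<Omega> j" if "\<omega> \<in> L2_forms \<Omega> j" "\<eta> \<in> L2_forms \<Omega> j" for \<omega> \<eta>
    using that by (auto simp: L2_forms_eq square_integrable_add alternating_add)
  show "form_scale c \<omega> \<in> L2_forms \<Omega> j" if "\<omega> \<in> L2_forms \<Omega> j" for c \<omega>
    using that alternating_scale[of j "\<omega> _" c]
    by (auto simp: L2_forms_eq square_integrable_scale form_scale_def alt_scale_def)
qed

lemma l2_inner_null_if_ae_eq: "ae_eq \<Omega> \<omega> 0 \<Longrightarrow> l2_inner \<Omega> \<omega> \<eta> = 0"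
  unfolding l2_inner_def ae_eq_def
  by (rule integral_eq_zero_AE) (auto simp: alt_inner_eq elim!: eventually_mono)

lemma test_form_bump:
  assumes \<psi>: "\<psi> \<in> bump_algebra" "compact C" "C \<subseteq> \<Omega>" "\<And>x. x \<notin> C \<Longrightarrow> \<psi> x = 0" and \<beta>: "alternating j \<beta>"
  shows "(\<lambda>x. alt_scale (\<psi> x) \<beta>) \<in> test_forms \<Omega> j"
  unfolding test_forms_def smooth_forms_def
proof (intro CollectI conjI allI exI[of _ C] impI)
  show "smooth_fun UNIV (\<lambda>x. alt_scale (\<psi> x) \<beta> vs)" for vs
    unfolding alt_scale_def using \<psi>(1) by (intro bump_algebra_smooth bump_algebra.intros)
  show "alternating j (alt_scale (\<psi> x) \<beta>)" for x by (rule alternating_scale[OF \<beta>])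
  show "alt_scale (\<psi> x) \<beta> = 0" if "x \<notin> C" for x using \<psi>(4)[OF that] by simp
qed (fact \<psi>)+

text \<open>In an orthonormal basis of the alternating maps, the test forms \<open>\<psi>\<close>
  times a basis element reduce the claim to the scalar fundamental lemma for each coefficient;
  Parseval at each point reassembles them.\<close>

lemma null_if_orthogonal_to_test_forms:
  assumes \<Omega>: "open \<Omega>" "bounded \<Omega>" and \<eta>: "\<eta> \<in> L2_forms \<Omega> j"
    and orth: "\<And>\<phi>. \<phi> \<in> test_forms \<Omega> j \<Longrightarrow> l2_inner \<Omega> \<eta> \<phi> = 0"
  shows "l2_inner \<Omega> \<eta> \<eta> = 0"
proof -
  have \<Omega>m: "\<Omega> \<in> lmeasurable" using \<Omega> by (simp add: lmeasurable_open)
  obtain B where B: "alt.orthonormal_basis B {\<alpha>. alternating j (\<alpha> :: 'a list \<Rightarrow> real)}"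
    using ex_orthonormal_alternating by blast
  have "AE x in lebesgue_on \<Omega>. alt_inner (\<eta> x) \<beta> = 0" if "\<beta> \<in> B" for \<beta>
  proof (rule AE_eq_0_if_orthogonal_to_bumps[OF \<Omega>(1)])
    show "integrable (lebesgue_on \<Omega>) (\<lambda>x. alt_inner (\<eta> x) \<beta>)"
      unfolding alt_inner_eq using \<eta> \<Omega>m
      by (intro Bochner_Integration.integrable_sum integrable_divide integrable_mult_left
          square_integrable_imp_integrable) (auto simp: L2_forms_eq)
    fix \<psi> C assume "\<psi> \<in> bump_algebra" "compact C" "C \<subseteq> \<Omega>" "\<And>x. x \<notin> C \<Longrightarrow> \<psi> x = 0"
    then have "(\<lambda>x. alt_scale (\<psi> x) \<beta>) \<in> test_forms \<Omega> j"
      using B that by (intro test_form_bump) (auto simp: alt.orthonormal_basis_def)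
    from orth[OF this] show "(LINT x|lebesgue_on \<Omega>. \<psi> x * alt_inner (\<eta> x) \<beta>) = 0"
      by (simp add: l2_inner_def alt.ip_scale_right)
  qed
  then have "AE x in lebesgue_on \<Omega>. \<forall>\<beta>\<in>B. alt_inner (\<eta> x) \<beta> = 0"
    using B by (intro AE_finite_allI) (auto simp: alt.orthonormal_basis_def)
  then have "AE x in lebesgue_on \<Omega>. alt_inner (\<eta> x) (\<eta> x) = 0"
    using AE_space
  proof eventually_elim
    case (elim x)
    then have "alternating j (\<eta> x)" using \<eta> by (auto simp: L2_forms_eq)
    then show ?case using alt.orthonormal_Parseval[OF B, of "\<eta> x"] elim by simp
  qed
  then show ?thesis unfolding l2_inner_def by (rule integral_eq_zero_AE)
qed


section \<open>Weak exterior derivatives\<close>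

lemma smooth_forms_dderiv: "\<phi> \<in> smooth_forms j \<Longrightarrow> iter_dderiv es (\<lambda>y. \<phi> y vs) differentiable_on UNIV"
  unfolding smooth_forms_def smooth_fun_def by (elim CollectE conjE allE)

lemma continuous_in_L2_fields:
  assumes "\<Omega> \<in> sets lebesgue" "bounded \<Omega>" and "\<And>vs. continuous_on UNIV (\<lambda>x. \<phi> x vs)"
  shows "\<phi> \<in> L2_fields \<Omega>"
  by (simp add: L2_fields_def square_integrable_continuous assms)

lemma classical_codiff_in_L2_fields:
  assumes \<Omega>: "\<Omega> \<in> sets lebesgue" "bounded \<Omega>" and \<phi>: "\<phi> \<in> smooth_forms j"
  shows "classical_codiff \<phi> \<in> L2_fields \<Omega>"
proof (rule continuous_in_L2_fields[OF \<Omega>])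
  fix vs :: "'a list"
  have "continuous_on UNIV (\<lambda>x. frechet_derivative (\<lambda>y. \<phi> y (e # vs)) (at x) e)" for e
  proof -
    have "iter_dderiv [e] (\<lambda>y. \<phi> y (e # vs)) differentiable_on UNIV"
      by (rule smooth_forms_dderiv[OF \<phi>])
    then show ?thesis by (simp add: differentiable_imp_continuous_on)
  qed
  then show "continuous_on UNIV (\<lambda>x. classical_codiff \<phi> x vs)"
    unfolding classical_codiff_def by (intro continuous_on_minus continuous_on_sum)
qed

lemma smooth_forms_subset_L2_fields:
  assumes \<Omega>: "\<Omega> \<in> sets lebesgue" "bounded \<Omega>"
  shows "smooth_forms j \<subseteq> L2_fields \<Omega>"
proof
  fix \<phi> :: "'a form" assume \<phi>: "\<phi> \<in> smooth_forms j"
  show "\<phi> \<in> L2_fields \<Omega>"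
  proof (rule continuous_in_L2_fields[OF \<Omega>])
    fix vs
    have "iter_dderiv [] (\<lambda>y. \<phi> y vs) differentiable_on UNIV"
      by (rule smooth_forms_dderiv[OF \<phi>])
    then show "continuous_on UNIV (\<lambda>x. \<phi> x vs)" by (simp add: differentiable_imp_continuous_on)
  qed
qed

locale bounded_open_set =
  fixes \<Omega> :: "'a::euclidean_space set"
  assumes open_domain: "open \<Omega>" and bounded_domain: "bounded \<Omega>"
begin

lemma domain_sets: "\<Omega> \<in> sets lebesgue" using open_domain by auto

lemma domain_lmeasurable: "\<Omega> \<in> lmeasurable"
  using open_domain bounded_domain by (simp add: lmeasurable_open)

lemma test_forms_fields:
  "\<phi> \<in> test_forms \<Omega> j \<Longrightarrow> \<phi> \<in> L2_fields \<Omega>" "\<phi> \<in> test_forms \<Omega> j \<Longrightarrow> classical_codiff \<phi> \<in> L2_fields \<Omega>"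
  using smooth_forms_subset_L2_fields[OF domain_sets bounded_domain]
    classical_codiff_in_L2_fields[OF domain_sets bounded_domain] by (auto simp: test_forms_def)

lemma weak_d_fields: "weak_d \<Omega> j \<omega> \<eta> \<Longrightarrow> \<omega> \<in> L2_fields \<Omega>" "weak_d \<Omega> j \<omega> \<eta> \<Longrightarrow> \<eta> \<in> L2_fields \<Omega>"
  using L2_forms_subset_fields by (auto simp: weak_d_def)

lemma weak_d_zero: "weak_d \<Omega> j 0 0"
  using form.subspace_0[OF subspace_L2_forms]
  by (auto simp: weak_d_def L2.ip_zero_left test_forms_fields)

lemma weak_d_add:
  assumes 1: "weak_d \<Omega> j \<omega> \<eta>" and 2: "weak_d \<Omega> j \<omega>' \<eta>'" shows "weak_d \<Omega> j (\<omega> + \<omega>') (\<eta> + \<eta>')"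
  unfolding weak_d_def
proof (intro conjI ballI)
  show "\<omega> + \<omega>' \<in> L2_forms \<Omega> j" "\<eta> + \<eta>' \<in> L2_forms \<Omega> (j + 1)"
    using 1 2 form.subspace_add[OF subspace_L2_forms] by (auto simp: weak_d_def)
  show "l2_inner \<Omega> (\<omega> + \<omega>') (classical_codiff \<phi>) = l2_inner \<Omega> (\<eta> + \<eta>') \<phi>"
    if "\<phi> \<in> test_forms \<Omega> (j + 1)" for \<phi>
    using that 1 2 weak_d_fields[OF 1] weak_d_fields[OF 2] test_forms_fields[OF that]
    by (simp add: L2.ip_add_left weak_d_def)
qed

lemma weak_d_scale:
  assumes 1: "weak_d \<Omega> j \<omega> \<eta>" shows "weak_d \<Omega> j (form_scale c \<omega>) (form_scale c \<eta>)"
  unfolding weak_d_def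
proof (intro conjI ballI)
  show "form_scale c \<omega> \<in> L2_forms \<Omega> j" "form_scale c \<eta> \<in> L2_forms \<Omega> (j + 1)"
    using 1 form.subspace_scale[OF subspace_L2_forms] by (auto simp: weak_d_def)
  show "l2_inner \<Omega> (form_scale c \<omega>) (classical_codiff \<phi>) = l2_inner \<Omega> (form_scale c \<eta>) \<phi>"
    if "\<phi> \<in> test_forms \<Omega> (j + 1)" for \<phi>
    using that 1 weak_d_fields[OF 1] test_forms_fields[OF that]
    by (simp add: L2.ip_scale_left weak_d_def)
qed

text \<open>A null form pairs to 0 with every codifferential, so its weak derivative is orthogonal
  to all test forms. This makes \<open>d\<close> well defined modulo null forms.\<close>

lemma weak_d_null:
  assumes 1: "weak_d \<Omega> j \<omega> \<eta>" and 0: "l2_inner \<Omega> \<omega> \<omega> = 0" shows "l2_inner \<Omega> \<eta> \<eta> = 0"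
proof (rule null_if_orthogonal_to_test_forms[OF open_domain bounded_domain])
  show "\<eta> \<in> L2_forms \<Omega> (j + 1)" using 1 by (simp add: weak_d_def)
  fix \<phi> assume "\<phi> \<in> test_forms \<Omega> (j + 1)"
  then show "l2_inner \<Omega> \<eta> \<phi> = 0"
    using 1 L2.ip_null_left[OF weak_d_fields(1)[OF 1] test_forms_fields(2) 0] by (auto simp: weak_d_def)
qed

text \<open>The difference of two weak derivatives of \<open>\<omega>\<close> is a weak derivative
  of 0, hence null.\<close>

lemma weak_d_unique:
  assumes 1: "weak_d \<Omega> j \<omega> \<eta>" and 2: "weak_d \<Omega> j \<omega> \<eta>'" and w: "w \<in> L2_fields \<Omega>"
  shows "l2_inner \<Omega> \<eta> w = l2_inner \<Omega> \<eta>' w"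
proof (rule L2.ip_null_cong)
  have "weak_d \<Omega> j (\<omega> + form_scale (- 1) \<omega>) (\<eta> + form_scale (- 1) \<eta>')"
    by (intro weak_d_add weak_d_scale 1 2)
  moreover have "\<omega> + form_scale (- 1) \<omega> = 0" "\<eta> + form_scale (- 1) \<eta>' = \<eta> - \<eta>'"
    by (auto simp: form_scale_def fun_eq_iff)
  ultimately have "weak_d \<Omega> j 0 (\<eta> - \<eta>')" by simp
  then show "l2_inner \<Omega> (\<eta> - \<eta>') (\<eta> - \<eta>') = 0"
    by (rule weak_d_null) (simp add: L2.ip_zero_left L2.X_zero)
qed (use weak_d_fields[OF 1] weak_d_fields[OF 2] w in auto)

lemma ext_d_weak: "\<omega> \<in> H_d \<Omega> j \<Longrightarrow> weak_d \<Omega> j \<omega> (ext_d \<Omega> j \<omega>)"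
  unfolding ext_d_def using someI_ex[of "weak_d \<Omega> j \<omega>"] by (simp add: H_d_def)

lemma ext_d_fields: "\<omega> \<in> H_d \<Omega> j \<Longrightarrow> ext_d \<Omega> j \<omega> \<in> L2_fields \<Omega>"
  using ext_d_weak weak_d_fields by blast

lemma H_d_add: "\<omega> \<in> H_d \<Omega> j \<Longrightarrow> \<eta> \<in> H_d \<Omega> j \<Longrightarrow> \<omega> + \<eta> \<in> H_d \<Omega> j"
  and H_d_scale: "\<omega> \<in> H_d \<Omega> j \<Longrightarrow> form_scale c \<omega> \<in> H_d \<Omega> j"
  unfolding H_d_def using weak_d_add weak_d_scale by blast+

text \<open>Additivity is stated through inner products because \<open>ext_d\<close> picks each
  representative independently.\<close>

lemma ext_d_add:
  assumes "\<omega> \<in> H_d \<Omega> j" "\<eta> \<in> H_d \<Omega> j" "w \<in> L2_fields \<Omega>"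
  shows "l2_inner \<Omega> (ext_d \<Omega> j (\<omega> + \<eta>)) w = l2_inner \<Omega> (ext_d \<Omega> j \<omega>) w + l2_inner \<Omega> (ext_d \<Omega> j \<eta>) w"
  using weak_d_unique[OF ext_d_weak[OF H_d_add[OF assms(1,2)]] weak_d_add[OF ext_d_weak[OF assms(1)] ext_d_weak[OF assms(2)]] assms(3)]
  by (simp add: L2.ip_add_left ext_d_fields assms)

lemma ext_d_scale:
  assumes "\<omega> \<in> H_d \<Omega> j" "w \<in> L2_fields \<Omega>"
  shows "l2_inner \<Omega> (ext_d \<Omega> j (form_scale c \<omega>)) w = c * l2_inner \<Omega> (ext_d \<Omega> j \<omega>) w"
  using weak_d_unique[OF ext_d_weak[OF H_d_scale[OF assms(1)]] weak_d_scale[OF ext_d_weak[OF assms(1)]] assms(2)]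
  by (simp add: L2.ip_scale_left ext_d_fields assms)

lemma ext_d_null:
  assumes "\<omega> \<in> H_d \<Omega> j" "w \<in> L2_fields \<Omega>" "l2_inner \<Omega> \<omega> \<omega> = 0"
  shows "l2_inner \<Omega> (ext_d \<Omega> j \<omega>) w = 0"
  using weak_d_null[OF ext_d_weak[OF assms(1)] assms(3)] L2.ip_null_left ext_d_fields assms by blast

lemma H0_subset_L2_forms: "H0 \<Omega> j \<subseteq> L2_forms \<Omega> j"
  by (auto simp: H0_def H_d_def weak_d_def)

text \<open>In the top degree every form is weakly closed, as there are no test forms of degree \<open>n + 1\<close>.\<close>

lemma H0_subset_H_d: "H0 \<Omega> j \<subseteq> H_d \<Omega> j"
proof (cases "j = int DIM('a)")
  case True
  have "weak_d \<Omega> j \<omega> 0" if "\<omega> \<in> H0 \<Omega> j" for \<omega>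
    unfolding weak_d_def
  proof (intro conjI ballI)
    show "\<omega> \<in> L2_forms \<Omega> j" using that H0_subset_L2_forms by blast
    show "0 \<in> L2_forms \<Omega> (j + 1)" by (rule form.subspace_0[OF subspace_L2_forms])
    fix \<phi> assume \<phi>: "\<phi> \<in> test_forms \<Omega> (j + 1)"
    have "classical_codiff \<phi> x vs = 0" if vs: "vs \<in> basis_lists" for x vs
    proof -
      \<comment> \<open>Either the list repeats a vector, or it is a distinct list of basis vectors
        and hence too short for degree \<open>n + 1\<close>.\<close>
      have "\<phi> y (e # vs) = 0" if e: "e \<in> Basis" for e y
      proof (cases "e \<in> set vs")
        case True
        then show ?thesis using \<phi> by (auto simp: test_forms_def smooth_forms_def alternating_def)
      next
        case False
        then have "e # vs \<in> basis_lists" using vs e by (auto simp: basis_lists_def)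
        then have "length (e # vs) \<le> DIM('a)" by (rule length_basis_lists)
        then have "int (length (e # vs)) \<noteq> j + 1" using True by simp
        then show ?thesis using \<phi> unfolding test_forms_def smooth_forms_def alternating_def by blast
      qed
      then show ?thesis by (simp add: classical_codiff_def)
    qed
    then have "l2_inner \<Omega> \<omega> (classical_codiff \<phi>) = 0" by (simp add: l2_inner_def alt_inner_eq)
    then show "l2_inner \<Omega> \<omega> (classical_codiff \<phi>) = l2_inner \<Omega> 0 \<phi>"
      using \<phi> by (simp add: L2.ip_zero_left test_forms_fields)
  qed
  then show ?thesis by (auto simp: H_d_def)
qed (auto simp: H0_def)

lemma boundary_trace_add:
  assumes "\<omega> \<in> H_d \<Omega> j" "\<eta> \<in> H_d \<Omega> j" "\<mu> \<in> smooth_forms (j + 1)"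
  shows "boundary_trace \<Omega> j (\<omega> + \<eta>) \<mu> = boundary_trace \<Omega> j \<omega> \<mu> + boundary_trace \<Omega> j \<eta> \<mu>"
proof -
  have "\<mu> \<in> L2_fields \<Omega>" "classical_codiff \<mu> \<in> L2_fields \<Omega>"
    using assms smooth_forms_subset_L2_fields[OF domain_sets bounded_domain]
      classical_codiff_in_L2_fields[OF domain_sets bounded_domain] by blast+
  moreover have "\<omega> \<in> L2_fields \<Omega>" "\<eta> \<in> L2_fields \<Omega>" using assms weak_d_fields ext_d_weak by blast+
  ultimately show ?thesis using assms by (simp add: boundary_trace_def ext_d_add L2.ip_add_left)
qed

lemma boundary_trace_scale:
  assumes "\<omega> \<in> H_d \<Omega> j" "\<mu> \<in> smooth_forms (j + 1)"
  shows "boundary_trace \<Omega> j (form_scale c \<omega>) \<mu> = c * boundary_trace \<Omega> j \<omega> \<mu>"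
proof -
  have "\<mu> \<in> L2_fields \<Omega>" "classical_codiff \<mu> \<in> L2_fields \<Omega>"
    using assms smooth_forms_subset_L2_fields[OF domain_sets bounded_domain]
      classical_codiff_in_L2_fields[OF domain_sets bounded_domain] by blast+
  moreover have "\<omega> \<in> L2_fields \<Omega>" using assms weak_d_fields ext_d_weak by blast+
  ultimately show ?thesis
    using assms by (simp add: boundary_trace_def ext_d_scale L2.ip_scale_left right_diff_distrib)
qed

lemma subspace_H0: "form.subspace (H0 \<Omega> j)"
proof (cases "j = int DIM('a)")
  case True
  have int: "integrable (lebesgue_on \<Omega>) (\<lambda>x. \<omega> x vs)" if "\<omega> \<in> L2_forms \<Omega> j" for \<omega> vs
    using that by (intro square_integrable_imp_integrable domain_lmeasurable) (auto simp: L2_forms_eq)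
  show ?thesis
    unfolding H0_def if_P[OF True]
    using int form.subspace_0[OF subspace_L2_forms] form.subspace_add[OF subspace_L2_forms]
      form.subspace_scale[OF subspace_L2_forms]
    by (intro form.subspaceI) (auto simp: form_scale_def)
next
  case False
  show ?thesis
    unfolding H0_def if_not_P[OF False]
  proof (rule form.subspaceI)
    have 0: "0 \<in> H_d \<Omega> j" using weak_d_zero by (auto simp: H_d_def)
    moreover have "boundary_trace \<Omega> j 0 \<mu> = 0" if "\<mu> \<in> smooth_forms (j + 1)" for \<mu>
      using boundary_trace_scale[OF 0 that, of 0] by simp
    ultimately show "0 \<in> {\<omega> \<in> H_d \<Omega> j. \<forall>\<mu>\<in>smooth_forms (j + 1). boundary_trace \<Omega> j \<omega> \<mu> = 0}" by simp
  qed (auto simp: H_d_add H_d_scale boundary_trace_add boundary_trace_scale)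
qed

end


section \<open>Finite element spaces\<close>

definition fun_scale :: "real \<Rightarrow> ('a \<Rightarrow> real) \<Rightarrow> 'a \<Rightarrow> real" where
  "fun_scale c f = (\<lambda>x. c * f x)"

interpretation fn: vector_space fun_scale
  by standard (auto simp: fun_scale_def fun_eq_iff algebra_simps)

lemma poly_combination_add:
  assumes "poly_combination A p" "poly_combination A q" shows "poly_combination A (\<lambda>x. p x + q x)"
proof -
  obtain c d where "p = (\<lambda>x. \<Sum>a\<in>A. c a * monomial a x)" "q = (\<lambda>x. \<Sum>a\<in>A. d a * monomial a x)"
    using assms unfolding poly_combination_def by blast
  then show ?thesis unfolding poly_combination_def
    by (intro exI[of _ "\<lambda>a. c a + d a"]) (simp add: distrib_right sum.distrib)
qed

lemma poly_combination_scale: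
  assumes "poly_combination A p" shows "poly_combination A (\<lambda>x. r * p x)"
proof -
  obtain c where "p = (\<lambda>x. \<Sum>a\<in>A. c a * monomial a x)"
    using assms unfolding poly_combination_def by blast
  then show ?thesis unfolding poly_combination_def
    by (intro exI[of _ "\<lambda>a. r * c a"]) (simp add: sum_distrib_left mult.assoc)
qed

lemma poly_combination_zero: "poly_combination A (\<lambda>x. 0)"
  unfolding poly_combination_def by (intro exI[of _ "\<lambda>a. 0"]) simp

lemma poly_combination_span: "poly_combination A p \<Longrightarrow> p \<in> fn.span (monomial ` A)"
proof -
  assume "poly_combination A p"
  then obtain c where p: "p = (\<lambda>x. \<Sum>a\<in>A. c a * monomial a x)"
    unfolding poly_combination_def by blast
  have "p = (\<Sum>a\<in>A. fun_scale (c a) (monomial a))" by (simp add: p fun_eq_iff sum_apply fun_scale_def)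
  also have "\<dots> \<in> fn.span (monomial ` A)"
    by (intro fn.span_sum fn.span_scale fn.span_base) simp
  finally show ?thesis .
qed

lemma subspace_poly_like:
  "form.subspace {p. (\<forall>x. alternating j (p x)) \<and> (\<forall>vs. poly_combination A (\<lambda>x. p x vs))}"
proof (rule form.subspaceI)
  show "form_scale c p \<in> {p. (\<forall>x. alternating j (p x)) \<and> (\<forall>vs. poly_combination A (\<lambda>x. p x vs))}"
    if "p \<in> {p. (\<forall>x. alternating j (p x)) \<and> (\<forall>vs. poly_combination A (\<lambda>x. p x vs))}" for c p
    using that alternating_scale[of j "p _" c]
    by (auto simp: form_scale_def alt_scale_def poly_combination_scale)
qed (auto simp: poly_combination_add poly_combination_zero alternating_add alternating_zero)

lemma subspace_poly_forms: "form.subspace (poly_forms s j)"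
  and subspace_hom_poly_forms: "form.subspace (hom_poly_forms s j)"
  unfolding poly_forms_def hom_poly_forms_def by (rule subspace_poly_like)+

lemma koszul_add: "koszul (p + q) = koszul p + koszul q"
  and koszul_scale: "koszul (form_scale c p) = form_scale c (koszul p)"
  and koszul_zero: "koszul 0 = 0"
  by (auto simp: koszul_def form_scale_def fun_eq_iff)

lemma subspace_trimmed_poly_forms: "form.subspace (trimmed_poly_forms s j :: 'a::euclidean_space form set)"
proof (rule form.subspaceI)
  let ?P = "poly_forms (s - 1) j :: 'a form set" and ?Q = "hom_poly_forms (s - 1) (j + 1) :: 'a form set"
  have I: "p + koszul q \<in> trimmed_poly_forms s j" if "p \<in> ?P" "q \<in> ?Q" for p q :: "'a form"
    using that unfolding trimmed_poly_forms_def by blast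
  have P: "form.subspace ?P" and Q: "form.subspace ?Q"
    by (rule subspace_poly_forms subspace_hom_poly_forms)+
  show "(0 :: 'a form) \<in> trimmed_poly_forms s j"
    using I[OF form.subspace_0[OF P] form.subspace_0[OF Q]] by (simp add: koszul_zero)
  fix v w :: "'a form" assume v: "v \<in> trimmed_poly_forms s j"
  then obtain p q where pq: "v = p + koszul q" "p \<in> ?P" "q \<in> ?Q" unfolding trimmed_poly_forms_def by blast
  have "form_scale c v = form_scale c p + koszul (form_scale c q)" for c
    by (simp add: pq(1) koszul_scale form.scale_right_distrib)
  then show "form_scale c v \<in> trimmed_poly_forms s j" for c
    using I[OF form.subspace_scale[OF P pq(2)] form.subspace_scale[OF Q pq(3)]] by metis
  assume w: "w \<in> trimmed_poly_forms s j"
  then obtain p' q' where pq': "w = p' + koszul q'" "p' \<in> ?P" "q' \<in> ?Q" unfolding trimmed_poly_forms_def by blast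
  have "v + w = (p + p') + koszul (q + q')" by (simp add: pq(1) pq'(1) koszul_add add_ac)
  then show "v + w \<in> trimmed_poly_forms s j"
    using I[OF form.subspace_add[OF P pq(2) pq'(2)] form.subspace_add[OF Q pq(3) pq'(3)]] by metis
qed

lemma subspace_local_space: "form.subspace (local_space F r j)"
  by (cases F) (simp_all add: subspace_poly_forms subspace_trimmed_poly_forms)

lemma continuous_monomial: "continuous_on S (monomial a)"
  unfolding monomial_def[abs_def] by (intro continuous_intros)

lemma poly_combination_finite_span:
  "\<exists>Q. finite Q \<and> (\<forall>q\<in>Q. continuous_on UNIV q) \<and> (\<forall>p. poly_combination A p \<longrightarrow> p \<in> fn.span Q)"
proof (cases "finite A")
  case True
  then show ?thesis
    by (intro exI[of _ "monomial ` A"]) (auto simp: poly_combination_span continuous_monomial)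
next
  case False
  \<comment> \<open>A sum over an infinite index set is 0 by convention, so no count of the
    multi-indices is needed.\<close>
  then have "p = 0" if "poly_combination A p" for p
    using that by (auto simp: poly_combination_def)
  then show ?thesis by (intro exI[of _ "{}"]) auto
qed

text \<open>Turns the Koszul operator, which inserts the point \<open>x\<close> as a vector, into a
  combination of coordinates times coefficient functions.\<close>

lemma alternating_expand_head:
  assumes "alternating j \<alpha>"
  shows "\<alpha> (x # vs) = (\<Sum>b\<in>Basis. (x \<bullet> b) * \<alpha> (b # vs))"
proof -
  have "\<forall>us ws. linear (\<lambda>v. \<alpha> (us @ v # ws))" using assms by (simp add: alternating_def)
  then have "linear (\<lambda>v. \<alpha> ([] @ v # vs))" by blast
  then have lin: "linear (\<lambda>v. \<alpha> (v # vs))" by simp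
  have "\<alpha> (x # vs) = \<alpha> ((\<Sum>b\<in>Basis. (x \<bullet> b) *\<^sub>R b) # vs)" by (simp add: euclidean_representation)
  also have "\<dots> = (\<Sum>b\<in>Basis. (x \<bullet> b) * \<alpha> (b # vs))"
    using linear_sum[OF lin, of "\<lambda>b. (x \<bullet> b) *\<^sub>R b" Basis] linear_cmul[OF lin] by simp
  finally show ?thesis .
qed

text \<open>A single finite \<open>Q\<close> has to work for all argument lists \<open>vs\<close>.
  In the trimmed family it also contains the products of a coordinate with the generators of the
  homogeneous part, which account for the Koszul term.\<close>

lemma local_space_finite_span:
  "\<exists>Q. finite Q \<and> (\<forall>q\<in>Q. continuous_on UNIV q) \<and>
     (\<forall>p\<in>local_space F r j. \<forall>vs. (\<lambda>x. p x vs) \<in> fn.span (Q :: ('a::euclidean_space \<Rightarrow> real) set))"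
proof (cases F)
  case Full
  show ?thesis
    unfolding Full local_space.simps poly_forms_def
    using poly_combination_finite_span by (smt (verit, best) mem_Collect_eq)
next
  case Trimmed
  define A where "A = {a :: 'a \<Rightarrow> nat. (\<forall>i. i \<notin> Basis \<longrightarrow> a i = 0) \<and> int (\<Sum>i\<in>Basis. a i) \<le> r - 1}"
  define A' where "A' = {a :: 'a \<Rightarrow> nat. (\<forall>i. i \<notin> Basis \<longrightarrow> a i = 0) \<and> int (\<Sum>i\<in>Basis. a i) = r - 1}"
  obtain Q where Q: "finite Q" "\<And>q. q \<in> Q \<Longrightarrow> continuous_on UNIV q" "\<And>p. poly_combination A p \<Longrightarrow> p \<in> fn.span Q"
    using poly_combination_finite_span[of A] by blast
  obtain Q' where Q': "finite Q'" "\<And>q. q \<in> Q' \<Longrightarrow> continuous_on UNIV q" "\<And>p. poly_combination A' p \<Longrightarrow> p \<in> fn.span Q'"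
    using poly_combination_finite_span[of A'] by blast
  define M where "M b q = (\<lambda>x::'a. (x \<bullet> b) * q x)" for b and q :: "'a \<Rightarrow> real"
  define R where "R = Q \<union> (\<Union>b\<in>Basis. M b ` Q')"
  have M: "M b f \<in> fn.span R" if f: "f \<in> fn.span Q'" and b: "b \<in> Basis" for f b
  proof -
    obtain u where u: "f = (\<Sum>q\<in>Q'. fun_scale (u q) q)" using f fn.span_finite[OF Q'(1)] by auto
    have "M b f = (\<Sum>q\<in>Q'. fun_scale (u q) (M b q))"
      by (simp add: u M_def fun_eq_iff sum_apply fun_scale_def sum_distrib_left mult_ac)
    also have "\<dots> \<in> fn.span R"
      using b by (intro fn.span_sum fn.span_scale fn.span_base) (auto simp: R_def)
    finally show ?thesis .
  qed
  have "(\<lambda>x. p x vs) \<in> fn.span R" if p_in: "p \<in> local_space F r j" for p :: "'a form" and vs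
  proof -
    obtain p0 q0 where p: "p = p0 + koszul q0" and p0: "p0 \<in> poly_forms (r - 1) j" and q0: "q0 \<in> hom_poly_forms (r - 1) (j + 1)"
      using p_in unfolding Trimmed local_space.simps trimmed_poly_forms_def by blast
    have 1: "(\<lambda>x. p0 x vs) \<in> fn.span R"
      using p0 Q(3) fn.span_mono[of Q R] by (auto simp: poly_forms_def A_def R_def)
    have "(\<lambda>x. q0 x (b # vs)) \<in> fn.span Q'" for b
      using q0 by (intro Q'(3)) (simp add: hom_poly_forms_def A'_def)
    then have 2: "(\<Sum>b\<in>Basis. M b (\<lambda>x. q0 x (b # vs))) \<in> fn.span R"
      by (intro fn.span_sum M)
    have "q0 x (x # vs) = (\<Sum>b\<in>Basis. (x \<bullet> b) * q0 x (b # vs))" for x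
      using q0 by (intro alternating_expand_head[of "j + 1"]) (simp add: hom_poly_forms_def)
    then have "(\<lambda>x. p x vs) = (\<lambda>x. p0 x vs) + (\<Sum>b\<in>Basis. M b (\<lambda>x. q0 x (b # vs)))"
      by (simp add: p koszul_def fun_eq_iff sum_apply M_def)
    then show ?thesis using fn.span_add[OF 1 2] by simp
  qed
  moreover have "continuous_on UNIV q" if "q \<in> R" for q
    using that Q(2) Q'(2) by (auto simp: R_def M_def intro!: continuous_intros)
  moreover have "finite R" using Q Q' by (simp add: R_def)
  ultimately show ?thesis by blast
qed

lemma square_integrable_indicator:
  assumes \<Omega>: "\<Omega> \<in> sets lebesgue" and A: "A \<in> sets lebesgue" and h: "square_integrable \<Omega> h"
  shows "square_integrable \<Omega> (\<lambda>x. indicator A x * h x)"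
proof -
  have "(\<lambda>x. indicator A x :: real) \<in> borel_measurable (lebesgue_on \<Omega>)"
    using A by (intro measurable_restrict_space1) auto
  then have meas: "(\<lambda>x. indicator A x * h x) \<in> borel_measurable (lebesgue_on \<Omega>)"
    using h by (auto simp: square_integrable_def)
  moreover have "integrable (lebesgue_on \<Omega>) (\<lambda>x. (indicator A x * h x)\<^sup>2)"
  proof (rule Bochner_Integration.integrable_bound)
    show "integrable (lebesgue_on \<Omega>) (\<lambda>x. (h x)\<^sup>2)" using h by (simp add: square_integrable_def)
    show "AE x in lebesgue_on \<Omega>. norm ((indicator A x * h x)\<^sup>2) \<le> norm ((h x)\<^sup>2)"
      by (auto simp: indicator_def)
  qed (use meas in measurable)
  ultimately show ?thesis by (simp add: square_integrable_def)
qed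

context bounded_open_set
begin

lemma subspace_fe_space: "form.subspace (fe_space F r \<Omega> \<T> j)"
proof (rule form.subspaceI)
  show "0 \<in> fe_space F r \<Omega> \<T> j"
    using form.subspace_0[OF subspace_H0] form.subspace_0[OF subspace_local_space]
    unfolding fe_space_def by fastforce
  fix v w assume v: "v \<in> fe_space F r \<Omega> \<T> j"
  show "form_scale c v \<in> fe_space F r \<Omega> \<T> j" for c
    unfolding fe_space_def
  proof (intro CollectI conjI ballI)
    show "form_scale c v \<in> H0 \<Omega> j" using v by (simp add: fe_space_def form.subspace_scale[OF subspace_H0])
    fix K assume "K \<in> \<T>"
    then obtain p where p: "p \<in> local_space F r j" "AE x in lebesgue_on K. v x = p x"
      using v by (auto simp: fe_space_def)
    have "AE x in lebesgue_on K. form_scale c v x = form_scale c p x"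
      using p(2) by eventually_elim (simp add: form_scale_def)
    then show "\<exists>p\<in>local_space F r j. AE x in lebesgue_on K. form_scale c v x = p x"
      using form.subspace_scale[OF subspace_local_space p(1)] by blast
  qed
  assume w: "w \<in> fe_space F r \<Omega> \<T> j"
  show "v + w \<in> fe_space F r \<Omega> \<T> j"
    unfolding fe_space_def
  proof (intro CollectI conjI ballI)
    show "v + w \<in> H0 \<Omega> j" using v w by (simp add: fe_space_def form.subspace_add[OF subspace_H0])
    fix K assume K: "K \<in> \<T>"
    obtain p where p: "p \<in> local_space F r j" "AE x in lebesgue_on K. v x = p x"
      using v K by (auto simp: fe_space_def)
    obtain q where q: "q \<in> local_space F r j" "AE x in lebesgue_on K. w x = q x"
      using w K by (auto simp: fe_space_def)
    have "AE x in lebesgue_on K. (v + w) x = (p + q) x"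
      using p(2) q(2) by eventually_elim simp
    then show "\<exists>p\<in>local_space F r j. AE x in lebesgue_on K. (v + w) x = p x"
      using form.subspace_add[OF subspace_local_space p(1) q(1)] by blast
  qed
qed

text \<open>The sets of points lying in exactly the simplices of a given subset of the mesh partition
  the domain, and on each of them a finite element form is polynomial.\<close>

lemma fe_space_orthonormal_basis:
  assumes "triangulation_of \<T> \<Omega>"
  shows "\<exists>B. L2.orthonormal_basis \<Omega> B (fe_space F r \<Omega> \<T> j)"
proof -
  have fin: "finite \<T>" and cover: "\<Omega> \<subseteq> \<Union>\<T>" and simp: "\<And>K. K \<in> \<T> \<Longrightarrow> int DIM('a) simplex K"
    using assms closure_subset[of \<Omega>] unfolding triangulation_of_def triangulation_def by metis+
  have K: "K \<in> sets lebesgue" if "K \<in> \<T>" for K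
    using polytope_imp_closed[OF simplex_imp_polytope[OF simp[OF that]]] by auto
  define atom where "atom S = {x. \<forall>K\<in>\<T>. x \<in> K \<longleftrightarrow> K \<in> S}" for S
  have atom: "atom S \<in> sets lebesgue" for S
  proof -
    have "{x. x \<in> K \<longleftrightarrow> K \<in> S} \<in> sets lebesgue" if "K \<in> \<T>" for K
      using K[OF that] by (cases "K \<in> S") (auto simp: Compl_eq[symmetric] Compl_in_sets_lebesgue)
    then have "{x \<in> space lebesgue. \<forall>K\<in>\<T>. x \<in> K \<longleftrightarrow> K \<in> S} \<in> sets lebesgue"
      by (intro sets.sets_Collect_finite_All fin) auto
    then show ?thesis by (simp add: atom_def)
  qed
  obtain Q where Q: "finite Q" "\<And>q. q \<in> Q \<Longrightarrow> continuous_on UNIV q"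
    "\<And>p vs. p \<in> local_space F r j \<Longrightarrow> (\<lambda>x. p x vs) \<in> fn.span (Q :: ('a \<Rightarrow> real) set)"
    using local_space_finite_span[of F r j] by blast
  \<comment> \<open>The generators: one coefficient function on one piece of the mesh and one basis
    list. They jump across faces and are not alternating, so they are placed in
    \<open>L2_fields\<close> only.\<close>
  define L where "L S us f = (\<lambda>x vs. if vs = us then indicator (atom S) x * f x else 0)"
    for S and us :: "'a list" and f :: "'a \<Rightarrow> real"
  define E where "E = (\<Union>S\<in>Pow \<T>. \<Union>us\<in>basis_lists. L S us ` Q)"
  have finE: "finite E" using fin Q(1) by (simp add: E_def finite_basis_lists)
  have L: "L S us f \<in> form.span E" if f: "f \<in> fn.span Q" and "S \<subseteq> \<T>" "us \<in> basis_lists" for S us f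
  proof -
    obtain u where u: "f = (\<Sum>q\<in>Q. fun_scale (u q) q)" using f fn.span_finite[OF Q(1)] by auto
    have "L S us f = (\<Sum>q\<in>Q. form_scale (u q) (L S us q))"
      by (simp add: u L_def fun_eq_iff sum_apply fun_scale_def form_scale_def sum_distrib_left mult_ac)
    also have "\<dots> \<in> form.span E"
      using that by (intro form.span_sum form.span_scale form.span_base) (auto simp: E_def)
    finally show ?thesis .
  qed
  have EL2: "e \<in> L2_fields \<Omega>" if e_in: "e \<in> E" for e
  proof -
    obtain S us q where e: "e = L S us q" "q \<in> Q" using e_in by (auto simp: E_def)
    have "square_integrable \<Omega> (\<lambda>x. indicator (atom S) x * q x)"
      by (intro square_integrable_indicator domain_sets atom square_integrable_continuous bounded_domain Q(2) e(2))
    then have "square_integrable \<Omega> (\<lambda>x. L S us q x vs)" for vs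
      by (cases "vs = us") (simp_all add: L_def square_integrable_zero)
    then show ?thesis by (simp add: L2_fields_def e(1))
  qed
  show ?thesis
  proof (rule L2.ex_orthonormal_basis[where e = "\<lambda>e. e", OF finE subspace_fe_space])
    show "fe_space F r \<Omega> \<T> j \<subseteq> L2_fields \<Omega>"
      unfolding fe_space_def using H0_subset_L2_forms[of j] L2_forms_subset_fields[of \<Omega> j] by blast
    fix v assume v: "v \<in> fe_space F r \<Omega> \<T> j"
    then have "\<forall>K\<in>\<T>. \<exists>p. p \<in> local_space F r j \<and> (AE x in lebesgue_on K. v x = p x)"
      by (auto simp: fe_space_def)
    then obtain p where p: "\<And>K. K \<in> \<T> \<Longrightarrow> p K \<in> local_space F r j"
      and ae: "\<And>K. K \<in> \<T> \<Longrightarrow> AE x in lebesgue_on K. v x = p K x" by metis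
    \<comment> \<open>On an atom any simplex containing it may provide the polynomial, since almost
      everywhere all of them agree with \<open>v\<close> there. Shared faces thus need no separate
      argument.\<close>
    define \<kappa> where "\<kappa> S = (SOME K. K \<in> S)" for S :: "'a set set"
    have \<kappa>: "\<kappa> S \<in> S" if "S \<noteq> {}" for S using that unfolding \<kappa>_def by (simp add: some_in_eq)
    define w where "w = (\<Sum>S\<in>Pow \<T> - {{}}. \<Sum>us\<in>basis_lists. L S us (\<lambda>x. p (\<kappa> S) x us))"
    have "w \<in> form.span E"
      unfolding w_def using \<kappa> by (intro form.span_sum L Q(3) p) auto
    then obtain c where c: "w = (\<Sum>e\<in>E. form_scale (c e) e)" using form.span_finite[OF finE] by auto
    have "AE x in lebesgue. x \<in> K \<longrightarrow> v x = p K x" if "K \<in> \<T>" for K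
      using ae[OF that] K[OF that] by (simp add: AE_lebesgue_on_iff)
    then have "AE x in lebesgue. \<forall>K\<in>\<T>. x \<in> K \<longrightarrow> v x = p K x"
      by (intro AE_finite_allI fin)
    then have "AE x in lebesgue. x \<in> \<Omega> \<longrightarrow> alt_inner ((v - w) x) ((v - w) x) = 0"
    proof (rule eventually_mono, intro impI)
      fix x assume x: "\<forall>K\<in>\<T>. x \<in> K \<longrightarrow> v x = p K x" "x \<in> \<Omega>"
      define S where "S = {K\<in>\<T>. x \<in> K}"
      have S: "S \<in> Pow \<T> - {{}}" using x(2) cover by (auto simp: S_def)
      have ind: "indicator (atom S') x = (if S' = S then 1 else 0 :: real)" if "S' \<in> Pow \<T> - {{}}" for S'
        using that by (auto simp: atom_def S_def indicator_def)
      have "w x vs = v x vs" if vs: "vs \<in> basis_lists" for vs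
      proof -
        have "w x vs = (\<Sum>S'\<in>Pow \<T> - {{}}. indicator (atom S') x * p (\<kappa> S') x vs)"
          using vs by (simp add: w_def sum_apply L_def finite_basis_lists)
        also have "\<dots> = (\<Sum>S'\<in>Pow \<T> - {{}}. if S' = S then p (\<kappa> S') x vs else 0)"
          using ind by (intro sum.cong refl) auto
        also have "\<dots> = p (\<kappa> S) x vs" using S fin by simp
        also have "\<dots> = v x vs" using x(1) \<kappa>[of S] S by (auto simp: S_def)
        finally show ?thesis .
      qed
      then show "alt_inner ((v - w) x) ((v - w) x) = 0"
        by (simp add: alt_inner_eq)
    qed
    then have "l2_inner \<Omega> (v - w) (v - w) = 0"
      unfolding l2_inner_def by (intro integral_eq_zero_AE) (simp add: AE_lebesgue_on_iff domain_sets)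
    then show "\<exists>c. l2_inner \<Omega> (v - (\<Sum>e\<in>E. form_scale (c e) e)) (v - (\<Sum>e\<in>E. form_scale (c e) e)) = 0"
      unfolding c by blast
  qed (rule EL2)
qed

end


section \<open>Bochner integrable families of forms\<close>

text \<open>Off a measurable null set the convergence holds everywhere, and completeness of Lebesgue
  measure lets the limit be restored on that set.\<close>

lemma borel_measurable_lebesgue_on_AE_LIMSEQ:
  fixes G :: "real \<Rightarrow> real"
  assumes S: "S \<in> sets lebesgue" and F: "\<And>i. F i \<in> borel_measurable (lebesgue_on S)"
    and lim: "AE t in lebesgue_on S. (\<lambda>i. F i t) \<longlonglongrightarrow> G t"
  shows "G \<in> borel_measurable (lebesgue_on S)"
proof -
  obtain N where N: "N \<in> null_sets (lebesgue_on S)" "{t \<in> S. \<not> (\<lambda>i. F i t) \<longlonglongrightarrow> G t} \<subseteq> N"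
    using lim by (auto simp: eventually_ae_filter)
  define G' where "G' t = (if t \<in> N then 0 else G t)" for t
  have [measurable]: "N \<in> sets (lebesgue_on S)" using N by auto
  note F[measurable]
  have "G' \<in> borel_measurable (lebesgue_on S)"
  proof (rule borel_measurable_LIMSEQ_metric)
    show "(\<lambda>t. if t \<in> N then 0 else F i t) \<in> borel_measurable (lebesgue_on S)" for i by measurable
    show "(\<lambda>i. if t \<in> N then 0 else F i t) \<longlonglongrightarrow> G' t" if "t \<in> space (lebesgue_on S)" for t
      using that N(2) by (auto simp: G'_def)
  qed
  then have 1: "(\<lambda>t. if t \<in> S then G' t else 0) \<in> borel_measurable lebesgue"
    using S by (simp add: borel_measurable_if)
  have "AE t in lebesgue_on S. G' t = G t"
    using AE_not_in[OF N(1)] by eventually_elim (simp add: G'_def)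
  then have 2: "AE t in lebesgue. (if t \<in> S then G' t else 0) = (if t \<in> S then G t else 0)"
    unfolding AE_lebesgue_on_iff[OF S] by eventually_elim simp
  have "(\<lambda>t. if t \<in> S then G t else 0) \<in> borel_measurable lebesgue"
    by (rule borel_measurable_AE[OF 1 2])
  then show ?thesis using S by (simp add: borel_measurable_if)
qed

lemma l2_norm_nonneg: "0 \<le> l2_norm \<Omega> \<omega>"
  by (simp add: l2_norm_def real_sqrt_ge_zero l2_inner_def Bochner_Integration.integral_nonneg alt.ip_nonneg)

lemma l2_inner_le: "\<lbrakk>\<omega> \<in> L2_fields \<Omega>; \<eta> \<in> L2_fields \<Omega>\<rbrakk> \<Longrightarrow> \<bar>l2_inner \<Omega> \<omega> \<eta>\<bar> \<le> l2_norm \<Omega> \<omega> * l2_norm \<Omega> \<eta>"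
  unfolding l2_norm_def by (rule L2.abs_ip_le)

lemma bochner_AE_L2_forms: "f \<in> bochner_L1 \<Omega> T j \<Longrightarrow> AE t in lebesgue_on {0<..<T}. f t \<in> L2_forms \<Omega> j"
  by (simp add: bochner_L1_def)

lemma bochner_integrable_norm: "f \<in> bochner_L1 \<Omega> T j \<Longrightarrow> integrable (lebesgue_on {0..T}) (\<lambda>t. l2_norm \<Omega> (f t))"
  by (simp add: bochner_L1_def integrable_open_interval)

text \<open>Composing the approximating simple functions with the inner product gives real simple
  functions, and Cauchy-Schwarz turns strong convergence into convergence of these. It also gives
  the integrable majorant.\<close>

lemma bochner_integrable_inner:
  assumes f: "f \<in> bochner_L1 \<Omega> T j" and v: "v \<in> L2_fields \<Omega>"
  shows "integrable (lebesgue_on {0..T}) (\<lambda>t. l2_inner \<Omega> (f t) v)"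
proof -
  let ?M = "lebesgue_on {0<..<T}"
  obtain s where simple: "\<And>i. simple_function ?M (s i)"
    and sL2: "\<And>i t. t \<in> {0<..<T} \<Longrightarrow> s i t \<in> L2_forms \<Omega> j"
    and lim: "AE t in ?M. (\<lambda>i. l2_norm \<Omega> (s i t - f t)) \<longlonglongrightarrow> 0"
    using f unfolding bochner_L1_def strongly_measurable_def by blast
  have fL2: "AE t in ?M. f t \<in> L2_forms \<Omega> j" by (rule bochner_AE_L2_forms[OF f])
  have meas: "(\<lambda>t. l2_inner \<Omega> (f t) v) \<in> borel_measurable ?M"
  proof (rule borel_measurable_lebesgue_on_AE_LIMSEQ)
    show "(\<lambda>t. l2_inner \<Omega> (s i t) v) \<in> borel_measurable ?M" for i
      using simple_function_compose[OF simple[of i], of "\<lambda>\<omega>. l2_inner \<Omega> \<omega> v"]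
      by (intro borel_measurable_simple_function) (simp add: comp_def)
    show "AE t in ?M. (\<lambda>i. l2_inner \<Omega> (s i t) v) \<longlonglongrightarrow> l2_inner \<Omega> (f t) v"
      using lim fL2 AE_space
    proof eventually_elim
      case (elim t)
      have ft: "f t \<in> L2_fields \<Omega>" by (rule L2_forms_fields[OF elim(2)])
      have st: "s i t \<in> L2_fields \<Omega>" for i using L2_forms_fields[OF sL2] elim(3) by simp
      have "(\<lambda>i. l2_norm \<Omega> (s i t - f t) * l2_norm \<Omega> v) \<longlonglongrightarrow> 0"
        using tendsto_mult_left_zero[OF elim(1)] .
      moreover
      have "\<bar>l2_inner \<Omega> (s i t) v - l2_inner \<Omega> (f t) v\<bar> \<le> l2_norm \<Omega> (s i t - f t) * l2_norm \<Omega> v" for i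
        using l2_inner_le[OF L2.X_diff[OF st ft] v, of i] by (simp add: L2.ip_diff_left st ft v)
      then have "\<forall>\<^sub>F i in sequentially. norm (l2_inner \<Omega> (s i t) v - l2_inner \<Omega> (f t) v) \<le> l2_norm \<Omega> (s i t - f t) * l2_norm \<Omega> v"
        by simp
      ultimately have "(\<lambda>i. l2_inner \<Omega> (s i t) v - l2_inner \<Omega> (f t) v) \<longlonglongrightarrow> 0"
        by (rule Lim_null_comparison[rotated])
      then show ?case by (simp add: LIM_zero_iff)
    qed
  qed simp
  have "integrable ?M (\<lambda>t. l2_inner \<Omega> (f t) v)"
  proof (rule Bochner_Integration.integrable_bound)
    show "integrable ?M (\<lambda>t. l2_norm \<Omega> (f t) * l2_norm \<Omega> v)"
      using f by (simp add: bochner_L1_def)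
    show "AE t in ?M. norm (l2_inner \<Omega> (f t) v) \<le> norm (l2_norm \<Omega> (f t) * l2_norm \<Omega> v)"
      using fL2
    proof eventually_elim
      case (elim t)
      then have "\<bar>l2_inner \<Omega> (f t) v\<bar> \<le> l2_norm \<Omega> (f t) * l2_norm \<Omega> v"
        by (intro l2_inner_le v L2_forms_fields)
      then show ?case by simp
    qed
  qed (rule meas)
  then show ?thesis by (simp add: integrable_open_interval)
qed

lemma weak_time_derivative_inner:
  assumes T: "0 < T" and weak: "has_weak_time_derivative \<Omega> T j f g" and v: "v \<in> L2_forms \<Omega> j"
  shows "\<exists>\<alpha>. AE t in lebesgue_on {0..T}. l2_inner \<Omega> (f t) v = \<alpha> + (LINT s|lebesgue_on {0..t}. l2_inner \<Omega> (g s) v)"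
proof (rule weak_time_derivative_imp_primitive[OF T])
  have vL: "v \<in> L2_fields \<Omega>" by (rule L2_forms_fields[OF v])
  show "integrable (lebesgue_on {0..T}) (\<lambda>t. l2_inner \<Omega> (f t) v)"
    "integrable (lebesgue_on {0..T}) (\<lambda>t. l2_inner \<Omega> (g t) v)"
    using weak by (auto simp: has_weak_time_derivative_def intro: bochner_integrable_inner vL)
  fix \<phi> :: "real \<Rightarrow> real" and C
  assume "smooth_fun UNIV \<phi>" "compact C" "C \<subseteq> {0<..<T}" "\<And>t. t \<notin> C \<Longrightarrow> \<phi> t = 0"
  then have "(LINT t|lebesgue_on {0<..<T}. deriv \<phi> t * l2_inner \<Omega> (f t) v) =
        - (LINT t|lebesgue_on {0<..<T}. \<phi> t * l2_inner \<Omega> (g t) v)"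
    using weak v unfolding has_weak_time_derivative_def by blast
  then show "(LINT t|lebesgue_on {0..T}. deriv \<phi> t * l2_inner \<Omega> (f t) v) =
        - (LINT t|lebesgue_on {0..T}. \<phi> t * l2_inner \<Omega> (g t) v)"
    by (simp add: integral_lebesgue_on_open_interval)
qed

text \<open>Strong measurability makes \<open>g\<close> almost separably valued, so that it suffices to test it
  against countably many forms.\<close>

lemma weak_time_derivative_zero:
  assumes weak: "has_weak_time_derivative \<Omega> T j f g"
    and f: "AE t in lebesgue_on {0<..<T}. ae_eq \<Omega> (f t) 0"
  shows "AE t in lebesgue_on {0<..<T}. l2_norm \<Omega> (g t) = 0"
proof -
  let ?M = "lebesgue_on {0<..<T}"
  have g: "g \<in> bochner_L1 \<Omega> T j" using weak by (simp add: has_weak_time_derivative_def)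
  obtain s where simple: "\<And>i. simple_function ?M (s i)"
    and sL2: "\<And>i t. t \<in> {0<..<T} \<Longrightarrow> s i t \<in> L2_forms \<Omega> j"
    and lim: "AE t in ?M. (\<lambda>i. l2_norm \<Omega> (s i t - g t)) \<longlonglongrightarrow> 0"
    using g unfolding bochner_L1_def strongly_measurable_def by blast
  have inner0: "AE t in ?M. l2_inner \<Omega> (g t) v = 0" if v: "v \<in> L2_forms \<Omega> j" for v
  proof (rule AE_eq_0_if_orthogonal_to_bumps)
    have "v \<in> L2_fields \<Omega>" by (rule L2_forms_fields[OF v])
    then show "integrable ?M (\<lambda>t. l2_inner \<Omega> (g t) v)"
      using bochner_integrable_inner[OF g] by (simp add: integrable_open_interval)
    fix \<psi> :: "real \<Rightarrow> real" and C
    assume \<psi>: "\<psi> \<in> bump_algebra" "compact C" "C \<subseteq> {0<..<T}" "\<And>t. t \<notin> C \<Longrightarrow> \<psi> t = 0"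
    have "(LINT t|?M. deriv \<psi> t * l2_inner \<Omega> (f t) v) = - (LINT t|?M. \<psi> t * l2_inner \<Omega> (g t) v)"
      using weak v \<psi> bump_algebra_smooth[OF \<psi>(1)] unfolding has_weak_time_derivative_def by blast
    moreover have "(LINT t|?M. deriv \<psi> t * l2_inner \<Omega> (f t) v) = 0"
      by (rule integral_eq_zero_AE) (use f in \<open>auto simp: l2_inner_null_if_ae_eq elim!: eventually_mono\<close>)
    ultimately show "(LINT t|?M. \<psi> t * l2_inner \<Omega> (g t) v) = 0" by simp
  qed simp
  define D where "D = (\<Union>i. s i ` {0<..<T})"
  have "finite (s i ` {0<..<T})" for i using simple[of i] by (simp add: simple_function_def)
  then have "countable D" unfolding D_def by (intro countable_UN) (auto intro: countable_finite)
  moreover have "D \<subseteq> L2_forms \<Omega> j" using sL2 by (auto simp: D_def)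
  ultimately have "AE t in ?M. \<forall>v\<in>D. l2_inner \<Omega> (g t) v = 0"
    using inner0 by (subst AE_ball_countable) auto
  then show ?thesis
    using lim bochner_AE_L2_forms[OF g] AE_space
  proof eventually_elim
    case (elim t)
    have gt: "g t \<in> L2_fields \<Omega>" by (rule L2_forms_fields[OF elim(3)])
    have st: "s i t \<in> L2_fields \<Omega>" for i using L2_forms_fields[OF sL2] elim(4) by simp
    \<comment> \<open>Orthogonality to \<open>s i t\<close> rewrites the square of the norm of
      \<open>g t\<close> as minus the inner product of \<open>s i t - g t\<close> with
      \<open>g t\<close>, which tends to 0.\<close>
    have "\<bar>l2_inner \<Omega> (g t) (g t)\<bar> \<le> l2_norm \<Omega> (s i t - g t) * l2_norm \<Omega> (g t)" for i
    proof -
      have "s i t \<in> D" using elim(4) unfolding D_def by (intro UN_I[of i] imageI) simp_all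
      then have "l2_inner \<Omega> (s i t) (g t) = 0" using elim(1) by (simp add: L2.ip_commute[of _ "s i t"])
      then have "l2_inner \<Omega> (s i t - g t) (g t) = - l2_inner \<Omega> (g t) (g t)"
        using gt st by (simp add: L2.ip_diff_left)
      then show ?thesis using l2_inner_le[OF L2.X_diff[OF st gt] gt, of i] by simp
    qed
    moreover have "(\<lambda>i. l2_norm \<Omega> (s i t - g t) * l2_norm \<Omega> (g t)) \<longlonglongrightarrow> 0"
      using tendsto_mult_left_zero[OF elim(2)] .
    ultimately have "\<bar>l2_inner \<Omega> (g t) (g t)\<bar> \<le> 0"
      using LIMSEQ_le_const by blast
    then show ?case by (simp add: l2_norm_def)
  qed
qed


section \<open>The semi-discrete system\<close>

definition form3_scale :: "real \<Rightarrow> 'a form3 \<Rightarrow> 'a form3" where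
  "form3_scale c u = (form_scale c (fst u), form_scale c (fst (snd u)), form_scale c (snd (snd u)))"

interpretation form3: vector_space form3_scale
  by standard (auto simp: form3_scale_def form.scale_right_distrib form.scale_left_distrib prod_eq_iff)

definition L2_fields3 :: "'a::euclidean_space set \<Rightarrow> 'a form3 set" where
  "L2_fields3 \<Omega> = L2_fields \<Omega> \<times> L2_fields \<Omega> \<times> L2_fields \<Omega>"

lemma inner3_eq:
  "inner3 \<Omega> u v = l2_inner \<Omega> (fst u) (fst v) + l2_inner \<Omega> (fst (snd u)) (fst (snd v))
     + l2_inner \<Omega> (snd (snd u)) (snd (snd v))"
  by (cases u; cases v) simp

lemma subspace_Times3:
  assumes "form.subspace A" "form.subspace B" "form.subspace C"
  shows "form3.subspace (A \<times> B \<times> C)"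
  using assms
  by (intro form3.subspaceI)
    (auto simp: form3_scale_def form.subspace_0 form.subspace_add form.subspace_scale zero_prod_def)

interpretation L23: semi_inner_product form3_scale "L2_fields3 \<Omega>" "inner3 \<Omega>" for \<Omega> :: "'a::euclidean_space set"
proof
  show "form3.subspace (L2_fields3 \<Omega>)"
    unfolding L2_fields3_def by (intro subspace_Times3 subspace_L2_fields)
  show "inner3 \<Omega> u v = inner3 \<Omega> v u" for u v by (simp add: inner3_eq L2.ip_commute)
  show "inner3 \<Omega> (u + v) w = inner3 \<Omega> u w + inner3 \<Omega> v w"
    if "u \<in> L2_fields3 \<Omega>" "v \<in> L2_fields3 \<Omega>" "w \<in> L2_fields3 \<Omega>" for u v w
    using that by (auto simp: inner3_eq L2_fields3_def L2.ip_add_left)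
  show "inner3 \<Omega> (form3_scale c u) w = c * inner3 \<Omega> u w"
    if "u \<in> L2_fields3 \<Omega>" "w \<in> L2_fields3 \<Omega>" for c u w
    using that by (auto simp: inner3_eq L2_fields3_def form3_scale_def L2.ip_scale_left algebra_simps)
  show "0 \<le> inner3 \<Omega> u u" if "u \<in> L2_fields3 \<Omega>" for u
    using that by (auto simp: inner3_eq L2_fields3_def L2.ip_nonneg)
qed

lemma sum_triple: "(\<Sum>i\<in>I. (f i, g i, h i)) = (\<Sum>i\<in>I. f i, \<Sum>i\<in>I. g i, \<Sum>i\<in>I. h i)"
  by (induction I rule: infinite_finite_induct) (auto simp: zero_prod_def)

lemma inner3_zero:
  assumes "v \<in> L2_fields3 \<Omega>"
  shows "inner3 \<Omega> (0, g, 0) v = l2_inner \<Omega> g (fst (snd v))"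
  using assms by (auto simp: inner3_eq L2_fields3_def L2.ip_zero_left)

text \<open>What the stability argument retains of the finite element method: a linear space with a
  finite basis modulo null forms in each degree, and \<open>d\<close> mapping within the family in
  degrees \<open>k - 1\<close> and \<open>k\<close>.\<close>

locale discrete_complex = bounded_open_set \<Omega> for \<Omega> :: "'a::euclidean_space set" +
  fixes V :: "int \<Rightarrow> 'a form set" and k :: int
  assumes V_H0: "V j \<subseteq> H0 \<Omega> j"
    and V_subspace: "form.subspace (V j)"
    and V_basis: "\<exists>B. L2.orthonormal_basis \<Omega> B (V j)"
    and V_complex: "j \<in> {k - 1, k} \<Longrightarrow> v \<in> V j \<Longrightarrow> ext_d \<Omega> j v \<in> V (j + 1)"
begin

lemma V_forms: "v \<in> V j \<Longrightarrow> v \<in> L2_forms \<Omega> j" and V_fields: "v \<in> V j \<Longrightarrow> v \<in> L2_fields \<Omega>"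
  and V_H_d: "v \<in> V j \<Longrightarrow> v \<in> H_d \<Omega> j"
  using V_H0 H0_subset_L2_forms L2_forms_subset_fields H0_subset_H_d by blast+

text \<open>Riesz representation of the functional that pairs \<open>w\<close> with
  \<open>ext_d\<close>; it kills null forms, so a representer exists and the choice in the
  definition is meaningful.\<close>

lemma disc_codiff:
  assumes j: "j \<in> {k, k + 1}" and w: "w \<in> L2_fields \<Omega>"
  shows "disc_codiff \<Omega> V j w \<in> V (j - 1)"
    and "v \<in> V (j - 1) \<Longrightarrow> l2_inner \<Omega> (disc_codiff \<Omega> V j w) v = l2_inner \<Omega> w (ext_d \<Omega> (j - 1) v)"
proof -
  obtain B where B: "L2.orthonormal_basis \<Omega> B (V (j - 1))" using V_basis by blast
  define L where "L v = l2_inner \<Omega> (ext_d \<Omega> (j - 1) v) w" for v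
  have "\<exists>s\<in>V (j - 1). \<forall>v\<in>V (j - 1). l2_inner \<Omega> s v = L v"
  proof (rule L2.orthonormal_Riesz[where L = L, OF B])
    show "L (x + y) = L x + L y" if "x \<in> V (j - 1)" "y \<in> V (j - 1)" for x y
      unfolding L_def using that w by (intro ext_d_add V_H_d)
    show "L (form_scale a x) = a * L x" if "x \<in> V (j - 1)" for a x
      unfolding L_def using that w by (intro ext_d_scale V_H_d)
    show "L x = 0" if "x \<in> V (j - 1)" "l2_inner \<Omega> x x = 0" for x
      unfolding L_def using that w by (intro ext_d_null V_H_d)
  qed (auto intro: V_fields V_subspace)
  then have "\<exists>s. s \<in> V (j - 1) \<and> (\<forall>v\<in>V (j - 1). l2_inner \<Omega> s v = l2_inner \<Omega> w (ext_d \<Omega> (j - 1) v))"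
    by (auto simp: L_def L2.ip_commute[of _ w])
  from someI_ex[OF this] show "disc_codiff \<Omega> V j w \<in> V (j - 1)"
    and "v \<in> V (j - 1) \<Longrightarrow> l2_inner \<Omega> (disc_codiff \<Omega> V j w) v = l2_inner \<Omega> w (ext_d \<Omega> (j - 1) v)"
    by (simp_all add: disc_codiff_def)
qed

lemma W_h_fields: "u \<in> W_h V k \<Longrightarrow> u \<in> L2_fields3 \<Omega>"
  by (auto simp: W_h_def L2_fields3_def V_fields)

lemma subspace_W_h: "form3.subspace (W_h V k)"
  unfolding W_h_def by (intro subspace_Times3 V_subspace)

lemma W_h_basis: "\<exists>B. L23.orthonormal_basis \<Omega> B (W_h V k)"
proof -
  obtain B1 B2 B3 where B: "L2.orthonormal_basis \<Omega> B1 (V (k - 1))" "L2.orthonormal_basis \<Omega> B2 (V k)"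
    "L2.orthonormal_basis \<Omega> B3 (V (k + 1))" using V_basis by metis
  then have fin: "finite B1" "finite B2" "finite B3"
    and sub: "B1 \<subseteq> V (k - 1)" "B2 \<subseteq> V k" "B3 \<subseteq> V (k + 1)"
    by (auto simp: L2.orthonormal_basis_def)
  have BF: "b \<in> L2_fields \<Omega>" if "b \<in> B1 \<union> B2 \<union> B3" for b
    using that sub V_fields by blast
  define e :: "'a form + 'a form + 'a form \<Rightarrow> 'a form3"
    where "e = case_sum (\<lambda>b. (b, 0, 0)) (case_sum (\<lambda>b. (0, b, 0)) (\<lambda>b. (0, 0, b)))"
  show ?thesis
  proof (rule L23.ex_orthonormal_basis[where e = e and I = "B1 <+> (B2 <+> B3)", OF _ subspace_W_h])
    show "finite (B1 <+> (B2 <+> B3))" using fin by simp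
    show "W_h V k \<subseteq> L2_fields3 \<Omega>" using W_h_fields by blast
    show "e i \<in> L2_fields3 \<Omega>" if "i \<in> B1 <+> (B2 <+> B3)" for i
      using that BF by (auto simp: e_def L2_fields3_def L2.X_zero)
    fix u assume "u \<in> W_h V k"
    then obtain \<sigma> \<mu> \<omega> where u: "u = (\<sigma>, \<mu>, \<omega>)" "\<sigma> \<in> V (k - 1)" "\<mu> \<in> V k" "\<omega> \<in> V (k + 1)"
      by (auto simp: W_h_def)
    define c where "c = case_sum (l2_inner \<Omega> \<sigma>) (case_sum (l2_inner \<Omega> \<mu>) (l2_inner \<Omega> \<omega>))"
    have "(\<Sum>i\<in>B1 <+> (B2 <+> B3). form3_scale (c i) (e i))
      = (\<Sum>b\<in>B1. form_scale (l2_inner \<Omega> \<sigma> b) b, \<Sum>b\<in>B2. form_scale (l2_inner \<Omega> \<mu> b) b,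
         \<Sum>b\<in>B3. form_scale (l2_inner \<Omega> \<omega> b) b)"
      using fin by (simp add: sum.Plus e_def c_def form3_scale_def sum_triple)
    then have "inner3 \<Omega> (u - (\<Sum>i\<in>B1 <+> (B2 <+> B3). form3_scale (c i) (e i)))
        (u - (\<Sum>i\<in>B1 <+> (B2 <+> B3). form3_scale (c i) (e i))) = 0"
      using B u by (simp add: L2.orthonormal_basis_def)
    then show "\<exists>c. inner3 \<Omega> (u - (\<Sum>i\<in>B1 <+> (B2 <+> B3). form3_scale (c i) (e i)))
        (u - (\<Sum>i\<in>B1 <+> (B2 <+> B3). form3_scale (c i) (e i))) = 0" by blast
  qed
qed

text \<open>Needed so that Parseval in \<open>W_h\<close> computes the norm of \<open>A_h\<close>
  applied to a solution.\<close>

lemma A_h_in_W_h: "u \<in> W_h V k \<Longrightarrow> A_h \<Omega> V k u \<in> W_h V k"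
  using V_complex[of k] V_complex[of "k - 1"] disc_codiff(1)[of k] disc_codiff(1)[of "k + 1"]
    form.subspace_add[OF V_subspace] form.subspace_neg[OF V_subspace] V_fields
  by (cases u) (auto simp: W_h_def)

lemma V_uminus: "v \<in> L2_fields \<Omega> \<Longrightarrow> w \<in> L2_fields \<Omega> \<Longrightarrow> l2_inner \<Omega> (- v) w = - l2_inner \<Omega> v w"
  using L2.ip_diff_left[of 0 \<Omega> v w] by (simp add: L2.ip_zero_left L2.X_zero)

text \<open>The pairing of \<open>A_h u\<close> with \<open>v\<close> after the discrete
  coderivatives have been moved to the test side. The four terms cancel in pairs under exchange of
  \<open>u\<close> and \<open>v\<close>, which makes the skew-symmetry visible.\<close>

definition bilinear_form :: "'a form3 \<Rightarrow> 'a form3 \<Rightarrow> real" where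
  "bilinear_form u v = - l2_inner \<Omega> (fst (snd u)) (ext_d \<Omega> (k - 1) (fst v))
     + l2_inner \<Omega> (ext_d \<Omega> (k - 1) (fst u)) (fst (snd v))
     + l2_inner \<Omega> (snd (snd u)) (ext_d \<Omega> k (fst (snd v)))
     - l2_inner \<Omega> (ext_d \<Omega> k (fst (snd u))) (snd (snd v))"

lemma inner3_A_h:
  assumes u: "u \<in> W_h V k" and v: "v \<in> W_h V k"
  shows "inner3 \<Omega> (A_h \<Omega> V k u) v = bilinear_form u v"
proof -
  obtain \<sigma> \<mu> \<omega> where u': "u = (\<sigma>, \<mu>, \<omega>)" "\<sigma> \<in> V (k - 1)" "\<mu> \<in> V k" "\<omega> \<in> V (k + 1)"
    using u by (auto simp: W_h_def)
  obtain \<tau> w \<phi> where v': "v = (\<tau>, w, \<phi>)" "\<tau> \<in> V (k - 1)" "w \<in> V k" "\<phi> \<in> V (k + 1)"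
    using v by (auto simp: W_h_def)
  have F: "\<mu> \<in> L2_fields \<Omega>" "\<omega> \<in> L2_fields \<Omega>" "\<tau> \<in> L2_fields \<Omega>" "w \<in> L2_fields \<Omega>" "\<phi> \<in> L2_fields \<Omega>"
    using u' v' V_fields by blast+
  have d: "ext_d \<Omega> (k - 1) \<sigma> \<in> L2_fields \<Omega>" "ext_d \<Omega> k \<mu> \<in> L2_fields \<Omega>"
    using u' ext_d_fields V_H_d by blast+
  have \<delta>: "disc_codiff \<Omega> V k \<mu> \<in> L2_fields \<Omega>" "disc_codiff \<Omega> V (k + 1) \<omega> \<in> L2_fields \<Omega>"
    using disc_codiff(1)[of k \<mu>] disc_codiff(1)[of "k + 1" \<omega>] F V_fields by auto
  have "l2_inner \<Omega> (disc_codiff \<Omega> V k \<mu>) \<tau> = l2_inner \<Omega> \<mu> (ext_d \<Omega> (k - 1) \<tau>)"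
    "l2_inner \<Omega> (disc_codiff \<Omega> V (k + 1) \<omega>) w = l2_inner \<Omega> \<omega> (ext_d \<Omega> k w)"
    using disc_codiff(2)[of k \<mu> \<tau>] disc_codiff(2)[of "k + 1" \<omega> w] F v' by auto
  then show ?thesis
    using F d \<delta> by (simp add: u'(1) v'(1) V_uminus L2.ip_add_left bilinear_form_def)
qed

lemma bilinear_form_skew: "bilinear_form u v = - bilinear_form v u"
  by (simp add: bilinear_form_def L2.ip_commute[of _ "ext_d \<Omega> _ _"])

text \<open>In its first argument the form is linear and vanishes on null triples, so it is
  determined by its values on the basis.\<close>

lemma bilinear_form_expand:
  assumes B: "L23.orthonormal_basis \<Omega> B (W_h V k)" and u: "u \<in> W_h V k" and v: "v \<in> W_h V k"
  shows "bilinear_form u v = (\<Sum>b\<in>B. inner3 \<Omega> u b * bilinear_form b v)"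
proof (rule L23.orthonormal_functional[where L = "\<lambda>u. bilinear_form u v", OF B _ subspace_W_h _ _ _ u])
  obtain \<tau> w \<phi> where v': "v = (\<tau>, w, \<phi>)" "\<tau> \<in> V (k - 1)" "w \<in> V k" "\<phi> \<in> V (k + 1)"
    using v by (auto simp: W_h_def)
  have F: "w \<in> L2_fields \<Omega>" "\<phi> \<in> L2_fields \<Omega>" "ext_d \<Omega> (k - 1) \<tau> \<in> L2_fields \<Omega>" "ext_d \<Omega> k w \<in> L2_fields \<Omega>"
    using v' V_fields ext_d_fields V_H_d by blast+
  show "W_h V k \<subseteq> L2_fields3 \<Omega>" using W_h_fields by blast
  fix x assume x: "x \<in> W_h V k"
  then have X: "fst x \<in> H_d \<Omega> (k - 1)" "fst (snd x) \<in> H_d \<Omega> k" "fst (snd x) \<in> L2_fields \<Omega>" "snd (snd x) \<in> L2_fields \<Omega>"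
    and X1: "fst x \<in> L2_fields \<Omega>"
    by (auto simp: W_h_def V_H_d V_fields)
  show "bilinear_form (form3_scale a x) v = a * bilinear_form x v" for a
    using X F by (simp add: bilinear_form_def v'(1) form3_scale_def ext_d_scale L2.ip_scale_left algebra_simps)
  show "bilinear_form (x + y) v = bilinear_form x v + bilinear_form y v" if "y \<in> W_h V k" for y
  proof -
    have Y: "fst y \<in> H_d \<Omega> (k - 1)" "fst (snd y) \<in> H_d \<Omega> k" "fst (snd y) \<in> L2_fields \<Omega>" "snd (snd y) \<in> L2_fields \<Omega>"
      using that by (auto simp: W_h_def V_H_d V_fields)
    show ?thesis
      using X Y F by (simp add: bilinear_form_def v'(1) ext_d_add L2.ip_add_left)
  qed
  show "bilinear_form x v = 0" if "inner3 \<Omega> x x = 0"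
  proof -
    have "l2_inner \<Omega> (fst x) (fst x) = 0" "l2_inner \<Omega> (fst (snd x)) (fst (snd x)) = 0"
      "l2_inner \<Omega> (snd (snd x)) (snd (snd x)) = 0"
      using that L2.ip_nonneg[OF X1] L2.ip_nonneg[OF X(3)] L2.ip_nonneg[OF X(4)] by (auto simp: inner3_eq)
    then show ?thesis
      using X F by (simp add: bilinear_form_def v'(1) ext_d_null L2.ip_null_left)
  qed
qed

text \<open>The operator equation is the sum of the three mixed ones. Testing with triples having
  two zero slots separates them again.\<close>

lemma mixed_iff_operator:
  assumes u: "u \<in> W_h V k"
  shows "mixed_equations \<Omega> V k g u' u \<longleftrightarrow> operator_equation \<Omega> V k g u' u"
proof -
  obtain \<sigma>' \<mu>' \<omega>' where u': "u' = (\<sigma>', \<mu>', \<omega>')" by (cases u')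
  obtain \<sigma> \<mu> \<omega> where uu: "u = (\<sigma>, \<mu>, \<omega>)" by (cases u)
  have zero: "l2_inner \<Omega> 0 x = 0" "l2_inner \<Omega> x 0 = 0" for x by (simp_all add: l2_inner_def alt_inner_eq)
  have V0: "0 \<in> V j" for j by (rule form.subspace_0[OF V_subspace])
  \<comment> \<open>The representative chosen for the derivative of 0 need not be the zero function;
    it is only null.\<close>
  have dzero: "l2_inner \<Omega> (ext_d \<Omega> j 0) x = 0" if "x \<in> L2_fields \<Omega>" for j x
    using that V0 by (intro ext_d_null V_H_d) (auto simp: zero)
  have X: "\<mu> \<in> L2_fields \<Omega>" "\<omega> \<in> L2_fields \<Omega>" using u by (auto simp: uu W_h_def V_fields)
  define E1 where "E1 \<tau> = l2_inner \<Omega> \<sigma>' \<tau> - l2_inner \<Omega> (ext_d \<Omega> (k - 1) \<tau>) \<mu>" for \<tau>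
  define E2 where "E2 v = l2_inner \<Omega> \<mu>' v + l2_inner \<Omega> (ext_d \<Omega> (k - 1) \<sigma>) v
        + l2_inner \<Omega> \<omega> (ext_d \<Omega> k v) - l2_inner \<Omega> g v" for v
  define E3 where "E3 \<phi> = l2_inner \<Omega> \<omega>' \<phi> - l2_inner \<Omega> (ext_d \<Omega> k \<mu>) \<phi>" for \<phi>
  have E0: "E1 0 = 0" "E2 0 = 0" "E3 0 = 0"
    using X by (auto simp: E1_def E2_def E3_def zero dzero L2.ip_commute[of _ \<omega>])
  have sum: "inner3 \<Omega> u' v + inner3 \<Omega> (A_h \<Omega> V k u) v - inner3 \<Omega> (0, g, 0) v = E1 (fst v) + E2 (fst (snd v)) + E3 (snd (snd v))"
    if v: "v \<in> W_h V k" for v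
    unfolding inner3_A_h[OF u v] inner3_zero[OF W_h_fields[OF v]]
    by (simp add: inner3_eq bilinear_form_def E1_def E2_def E3_def u' uu L2.ip_commute[of _ \<mu>])
  have "operator_equation \<Omega> V k g u' u \<longleftrightarrow> (\<forall>v\<in>W_h V k. E1 (fst v) + E2 (fst (snd v)) + E3 (snd (snd v)) = 0)"
    unfolding operator_equation_def using sum by (metis eq_iff_diff_eq_0)
  also have "\<dots> \<longleftrightarrow> (\<forall>\<tau>\<in>V (k - 1). E1 \<tau> = 0) \<and> (\<forall>v\<in>V k. E2 v = 0) \<and> (\<forall>\<phi>\<in>V (k + 1). E3 \<phi> = 0)"
    (is "?L \<longleftrightarrow> ?R")
  proof
    assume L: ?L
    have "E1 \<tau> = 0" if "\<tau> \<in> V (k - 1)" for \<tau>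
      using L[rule_format, of "(\<tau>, 0, 0)"] that V0 E0 by (simp add: W_h_def)
    moreover have "E2 v = 0" if "v \<in> V k" for v
      using L[rule_format, of "(0, v, 0)"] that V0 E0 by (simp add: W_h_def)
    moreover have "E3 \<phi> = 0" if "\<phi> \<in> V (k + 1)" for \<phi>
      using L[rule_format, of "(0, 0, \<phi>)"] that V0 E0 by (simp add: W_h_def)
    ultimately show ?R by blast
  qed (auto simp: W_h_def)
  also have "\<dots> \<longleftrightarrow> mixed_equations \<Omega> V k g u' u"
    by (simp add: u' uu E1_def E2_def E3_def)
  finally show ?thesis by simp
qed

lemma evolution_mixed_iff_operator:
  "evolution_solution \<Omega> T V k (mixed_equations \<Omega> V k) f w \<longleftrightarrow> evolution_solution \<Omega> T V k (operator_equation \<Omega> V k) f w"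
proof (cases "\<forall>t\<in>{0..T}. w t \<in> W_h V k")
  case True
  have "(AE t in lebesgue_on {0<..<T}. mixed_equations \<Omega> V k (f t) (w' t) (w t)) \<longleftrightarrow>
      (AE t in lebesgue_on {0<..<T}. operator_equation \<Omega> V k (f t) (w' t) (w t))" for w'
    using True by (intro AE_cong mixed_iff_operator) auto
  then show ?thesis by (simp add: evolution_solution_def)
qed (auto simp: evolution_solution_def)

end


section \<open>Stability and conservation\<close>

lemma ac_primitive:
  assumes ac: "has_ac_time_derivative \<Omega> T j u g" and v: "v \<in> L2_forms \<Omega> j"
  shows "primitive T (\<lambda>t. l2_inner \<Omega> (u t) v) (\<lambda>t. l2_inner \<Omega> (g t) v)"
  unfolding primitive_def
proof (intro conjI ballI)
  show "integrable (lebesgue_on {0..T}) (\<lambda>t. l2_inner \<Omega> (g t) v)"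
    using ac by (intro bochner_integrable_inner[of _ _ _ j] L2_forms_fields[OF v]) (simp add: has_ac_time_derivative_def)
  show "l2_inner \<Omega> (u t) v = l2_inner \<Omega> (u 0) v + (LINT s|lebesgue_on {0..t}. l2_inner \<Omega> (g s) v)"
    if "t \<in> {0..T}" for t
    using ac v that unfolding has_ac_time_derivative_def by blast
qed

context discrete_complex
begin

text \<open>The equation is tested with \<open>b\<close> while \<open>u\<close> is expanded in the
  first argument of the form, hence the transposed order in the matrix entry
  \<open>bilinear_form b' b\<close>.\<close>

lemma evolution_coefficients:
  assumes T: "0 < T" and sol: "evolution_solution \<Omega> T V k (operator_equation \<Omega> V k) f u"
    and B: "L23.orthonormal_basis \<Omega> B (W_h V k)"
  obtains g where "skew_evolution T B (\<lambda>b b'. bilinear_form b' b) (\<lambda>b t. inner3 \<Omega> (u t) b) g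
    (\<lambda>b t. l2_inner \<Omega> (f t) (fst (snd b)))"
proof -
  obtain u' where W: "\<And>t. t \<in> {0..T} \<Longrightarrow> u t \<in> W_h V k"
    and ac1: "has_ac_time_derivative \<Omega> T (k - 1) (\<lambda>t. fst (u t)) (\<lambda>t. fst (u' t))"
    and ac2: "has_ac_time_derivative \<Omega> T k (\<lambda>t. fst (snd (u t))) (\<lambda>t. fst (snd (u' t)))"
    and ac3: "has_ac_time_derivative \<Omega> T (k + 1) (\<lambda>t. snd (snd (u t))) (\<lambda>t. snd (snd (u' t)))"
    and eq: "AE t in lebesgue_on {0<..<T}. operator_equation \<Omega> V k (f t) (u' t) (u t)"
    using sol unfolding evolution_solution_def by blast
  have BW: "b \<in> W_h V k" if "b \<in> B" for b using B that by (auto simp: L23.orthonormal_basis_def)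
  show ?thesis
  proof (rule that)
    show "skew_evolution T B (\<lambda>b b'. bilinear_form b' b) (\<lambda>b t. inner3 \<Omega> (u t) b)
        (\<lambda>b t. inner3 \<Omega> (u' t) b) (\<lambda>b t. l2_inner \<Omega> (f t) (fst (snd b)))"
    proof
      show "0 < T" by (rule T)
      show "finite B" using B by (simp add: L23.orthonormal_basis_def)
      show "bilinear_form b' b = - bilinear_form b b'" for b b' by (rule bilinear_form_skew)
      show "primitive T (\<lambda>t. inner3 \<Omega> (u t) b) (\<lambda>t. inner3 \<Omega> (u' t) b)" if "b \<in> B" for b
      proof -
        have "fst b \<in> L2_forms \<Omega> (k - 1)" "fst (snd b) \<in> L2_forms \<Omega> k" "snd (snd b) \<in> L2_forms \<Omega> (k + 1)"
          using BW[OF that] V_forms by (auto simp: W_h_def)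
        then show ?thesis
          unfolding inner3_eq
          by (intro primitive_add ac_primitive[OF ac1] ac_primitive[OF ac2] ac_primitive[OF ac3])
      qed
      show "AE s in lebesgue_on {0..T}. \<forall>b\<in>B. inner3 \<Omega> (u' s) b =
          l2_inner \<Omega> (f s) (fst (snd b)) - (\<Sum>b'\<in>B. bilinear_form b' b * inner3 \<Omega> (u s) b')"
        using eq[unfolded AE_open_interval] AE_space
      proof eventually_elim
        case (elim s)
        have us: "u s \<in> W_h V k" using W elim by simp
        show ?case
        proof
          fix b assume "b \<in> B"
          note b = BW[OF this]
          have "inner3 \<Omega> (u' s) b + inner3 \<Omega> (A_h \<Omega> V k (u s)) b = inner3 \<Omega> (0, f s, 0) b"
            using elim b unfolding operator_equation_def by blast
          then have "inner3 \<Omega> (u' s) b + (\<Sum>b'\<in>B. inner3 \<Omega> (u s) b' * bilinear_form b' b)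
              = l2_inner \<Omega> (f s) (fst (snd b))"
            unfolding inner3_A_h[OF us b] bilinear_form_expand[OF B us b] inner3_zero[OF W_h_fields[OF b]] .
          moreover have "(\<Sum>b'\<in>B. inner3 \<Omega> (u s) b' * bilinear_form b' b)
              = (\<Sum>b'\<in>B. bilinear_form b' b * inner3 \<Omega> (u s) b')"
            by (intro sum.cong refl mult.commute)
          ultimately show "inner3 \<Omega> (u' s) b =
              l2_inner \<Omega> (f s) (fst (snd b)) - (\<Sum>b'\<in>B. bilinear_form b' b * inner3 \<Omega> (u s) b')"
            by linarith
        qed
      qed
    qed
  qed
qed

section \<open>Norms in coordinates and the estimates\<close>

lemma norm3_coefficients:
  assumes B: "L23.orthonormal_basis \<Omega> B (W_h V k)" and w: "w \<in> W_h V k"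
  shows "norm3 \<Omega> w = L2_set (\<lambda>b. inner3 \<Omega> w b) B"
  using L23.orthonormal_Parseval[OF B subsetI[OF W_h_fields] w] by (simp add: norm3_def L2_set_def)

lemma norm3_A_h_coefficients:
  assumes B: "L23.orthonormal_basis \<Omega> B (W_h V k)" and w: "w \<in> W_h V k"
  shows "norm3 \<Omega> (A_h \<Omega> V k w) = L2_set (\<lambda>b. \<Sum>b'\<in>B. bilinear_form b' b * inner3 \<Omega> w b') B"
proof -
  have "inner3 \<Omega> (A_h \<Omega> V k w) b = (\<Sum>b'\<in>B. bilinear_form b' b * inner3 \<Omega> w b')" if "b \<in> B" for b
  proof -
    have b: "b \<in> W_h V k" using B that by (auto simp: L23.orthonormal_basis_def)
    show ?thesis
      unfolding inner3_A_h[OF w b] bilinear_form_expand[OF B w b] by (intro sum.cong refl mult.commute)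
  qed
  then show ?thesis
    unfolding norm3_coefficients[OF B A_h_in_W_h[OF w]] by (intro L2_set_cong refl)
qed

text \<open>Bessel rather than Parseval for the triple \<open>(0, g, 0)\<close>, as \<open>g\<close>
  is an arbitrary square-integrable form.\<close>

lemma load_bound:
  assumes B: "L23.orthonormal_basis \<Omega> B (W_h V k)" and g: "g \<in> L2_forms \<Omega> k"
  shows "L2_set (\<lambda>b. l2_inner \<Omega> g (fst (snd b))) B \<le> l2_norm \<Omega> g"
proof -
  have g3: "(0, g, 0) \<in> L2_fields3 \<Omega>"
    using L2_forms_fields[OF g] L2.X_zero by (simp add: L2_fields3_def)
  have "inner3 \<Omega> (0, g, 0) b = l2_inner \<Omega> g (fst (snd b))" if "b \<in> B" for b
    using B that by (intro inner3_zero W_h_fields) (auto simp: L23.orthonormal_basis_def)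
  then have "(\<Sum>b\<in>B. (l2_inner \<Omega> g (fst (snd b)))\<^sup>2) = (\<Sum>b\<in>B. (inner3 \<Omega> (0, g, 0) b)\<^sup>2)"
    by (intro sum.cong) auto
  also have "\<dots> \<le> inner3 \<Omega> (0, g, 0) (0, g, 0)"
    using W_h_fields by (intro L23.Bessel[OF B _ g3]) blast
  also have "\<dots> = l2_inner \<Omega> g g" using inner3_zero[OF g3] by simp
  finally show ?thesis by (simp add: L2_set_def l2_norm_def)
qed

lemma stability:
  assumes T: "0 < T" and f: "f \<in> bochner_L1 \<Omega> T k"
    and sol: "evolution_solution \<Omega> T V k (operator_equation \<Omega> V k) f u" and t: "t \<in> {0..T}"
  shows "norm3 \<Omega> (u t) \<le> norm3 \<Omega> (u 0) + 2 * (LINT s|lebesgue_on {0..T}. l2_norm \<Omega> (f s))"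
proof -
  obtain B where B: "L23.orthonormal_basis \<Omega> B (W_h V k)" using W_h_basis by blast
  obtain g where "skew_evolution T B (\<lambda>b b'. bilinear_form b' b) (\<lambda>b t. inner3 \<Omega> (u t) b) g
    (\<lambda>b t. l2_inner \<Omega> (f t) (fst (snd b)))" by (rule evolution_coefficients[OF T sol B])
  then interpret skew_evolution T B "\<lambda>b b'. bilinear_form b' b" "\<lambda>b t. inner3 \<Omega> (u t) b" g
    "\<lambda>b t. l2_inner \<Omega> (f t) (fst (snd b))" .
  have W: "u s \<in> W_h V k" if "s \<in> {0..T}" for s using sol that by (simp add: evolution_solution_def)
  have "AE s in lebesgue_on {0..T}. L2_set (\<lambda>b. l2_inner \<Omega> (f s) (fst (snd b))) B \<le> l2_norm \<Omega> (f s)"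
    using bochner_AE_L2_forms[OF f, unfolded AE_open_interval] by eventually_elim (rule load_bound[OF B])
  from bound[OF bochner_integrable_norm[OF f] this t] show ?thesis
    using W[OF t] W[of 0] T by (simp add: norm3_coefficients[OF B])
qed

lemma operator_stability:
  assumes T: "0 < T" and weak: "has_weak_time_derivative \<Omega> T k f ft"
    and sol: "evolution_solution \<Omega> T V k (operator_equation \<Omega> V k) f u"
    and m: "AE s in lebesgue_on {0..T}. l2_norm \<Omega> (f s) \<le> m" and t: "t \<in> {0..T}"
  shows "norm3 \<Omega> (A_h \<Omega> V k (u t)) \<le> norm3 \<Omega> (A_h \<Omega> V k (u 0)) + 2 * m
     + 2 * (LINT s|lebesgue_on {0..T}. l2_norm \<Omega> (ft s))"
proof -
  obtain B where B: "L23.orthonormal_basis \<Omega> B (W_h V k)" using W_h_basis by blast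
  obtain g where "skew_evolution T B (\<lambda>b b'. bilinear_form b' b) (\<lambda>b t. inner3 \<Omega> (u t) b) g
    (\<lambda>b t. l2_inner \<Omega> (f t) (fst (snd b)))" by (rule evolution_coefficients[OF T sol B])
  then interpret skew_evolution T B "\<lambda>b b'. bilinear_form b' b" "\<lambda>b t. inner3 \<Omega> (u t) b" g
    "\<lambda>b t. l2_inner \<Omega> (f t) (fst (snd b))" .
  have W: "u s \<in> W_h V k" if "s \<in> {0..T}" for s using sol that by (simp add: evolution_solution_def)
  have f: "f \<in> bochner_L1 \<Omega> T k" and ft: "ft \<in> bochner_L1 \<Omega> T k"
    using weak by (auto simp: has_weak_time_derivative_def)
  have Bv: "fst (snd b) \<in> L2_forms \<Omega> k" if "b \<in> B" for b
    using B that V_forms by (auto simp: L23.orthonormal_basis_def W_h_def)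
  have "\<forall>b\<in>B. \<exists>\<alpha>. AE t in lebesgue_on {0..T}. l2_inner \<Omega> (f t) (fst (snd b))
      = \<alpha> + (LINT s|lebesgue_on {0..t}. l2_inner \<Omega> (ft s) (fst (snd b)))"
    using weak_time_derivative_inner[OF T weak Bv] by blast
  \<comment> \<open>One integration constant for each basis vector. As the basis is finite, the
    exceptional null sets can be merged below.\<close>
  from bchoice[OF this] obtain \<alpha> where \<alpha>: "\<forall>b\<in>B. AE t in lebesgue_on {0..T}. l2_inner \<Omega> (f t) (fst (snd b))
      = \<alpha> b + (LINT s|lebesgue_on {0..t}. l2_inner \<Omega> (ft s) (fst (snd b)))" ..
  have "L2_set (\<lambda>b. \<Sum>b'\<in>B. bilinear_form b' b * inner3 \<Omega> (u t) b') B
      \<le> L2_set (\<lambda>b. \<Sum>b'\<in>B. bilinear_form b' b * inner3 \<Omega> (u 0) b') B + 2 * m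
       + 2 * (LINT s|lebesgue_on {0..T}. l2_norm \<Omega> (ft s))"
  proof (rule operator_bound[where F = "\<lambda>s. l2_norm \<Omega> (ft s)"
        and \<Phi> = "\<lambda>b t. \<alpha> b + (LINT s|lebesgue_on {0..t}. l2_inner \<Omega> (ft s) (fst (snd b)))"
        and \<psi> = "\<lambda>b t. l2_inner \<Omega> (ft t) (fst (snd b))"])
    show "primitive T (\<lambda>t. \<alpha> b + (LINT s|lebesgue_on {0..t}. l2_inner \<Omega> (ft s) (fst (snd b))))
        (\<lambda>t. l2_inner \<Omega> (ft t) (fst (snd b)))" if "b \<in> B" for b
      using T by (intro primitive_integral bochner_integrable_inner[OF ft] L2_forms_fields[OF Bv[OF that]]) simp
    show "AE s in lebesgue_on {0..T}. \<forall>b\<in>B. l2_inner \<Omega> (f s) (fst (snd b))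
        = \<alpha> b + (LINT r|lebesgue_on {0..s}. l2_inner \<Omega> (ft r) (fst (snd b)))"
      by (rule AE_finite_allI[OF finite_I]) (rule bspec[OF \<alpha>])
    show "integrable (lebesgue_on {0..T}) (\<lambda>s. l2_norm \<Omega> (ft s))" by (rule bochner_integrable_norm[OF ft])
    show "AE s in lebesgue_on {0..T}. L2_set (\<lambda>b. l2_inner \<Omega> (ft s) (fst (snd b))) B \<le> l2_norm \<Omega> (ft s)"
      using bochner_AE_L2_forms[OF ft, unfolded AE_open_interval] by eventually_elim (rule load_bound[OF B])
    show "AE s in lebesgue_on {0..T}. L2_set (\<lambda>b. l2_inner \<Omega> (f s) (fst (snd b))) B \<le> m"
      using bochner_AE_L2_forms[OF f, unfolded AE_open_interval] m
      by eventually_elim (rule order_trans[OF load_bound[OF B]])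
  qed (rule t)
  then show ?thesis using W[OF t] W[of 0] T by (simp add: norm3_A_h_coefficients[OF B])
qed

lemma conservation:
  assumes T: "0 < T" and sol: "evolution_solution \<Omega> T V k (operator_equation \<Omega> V k) f u"
    and f0: "AE s in lebesgue_on {0<..<T}. ae_eq \<Omega> (f s) 0" and t: "t \<in> {0..T}"
  shows "norm3 \<Omega> (u t) = norm3 \<Omega> (u 0)" "norm3 \<Omega> (A_h \<Omega> V k (u t)) = norm3 \<Omega> (A_h \<Omega> V k (u 0))"
proof -
  obtain B where B: "L23.orthonormal_basis \<Omega> B (W_h V k)" using W_h_basis by blast
  obtain g where "skew_evolution T B (\<lambda>b b'. bilinear_form b' b) (\<lambda>b t. inner3 \<Omega> (u t) b) g
    (\<lambda>b t. l2_inner \<Omega> (f t) (fst (snd b)))" by (rule evolution_coefficients[OF T sol B])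
  then interpret skew_evolution T B "\<lambda>b b'. bilinear_form b' b" "\<lambda>b t. inner3 \<Omega> (u t) b" g
    "\<lambda>b t. l2_inner \<Omega> (f t) (fst (snd b))" .
  have W: "u s \<in> W_h V k" if "s \<in> {0..T}" for s using sol that by (simp add: evolution_solution_def)
  have 0: "AE s in lebesgue_on {0..T}. \<forall>b\<in>B. l2_inner \<Omega> (f s) (fst (snd b)) = 0"
    using f0[unfolded AE_open_interval] by eventually_elim (simp add: l2_inner_null_if_ae_eq)
  show "norm3 \<Omega> (u t) = norm3 \<Omega> (u 0)"
    using conserved[OF 0 t] W[OF t] W[of 0] T by (simp add: norm3_coefficients[OF B])
  show "norm3 \<Omega> (A_h \<Omega> V k (u t)) = norm3 \<Omega> (A_h \<Omega> V k (u 0))"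
    using operator_conserved[OF 0 t] W[OF t] W[of 0] T by (simp add: norm3_A_h_coefficients[OF B])
qed

end

section \<open>The essential supremum in time and the final statement\<close>

lemma Linf_L2_norm_nonneg:
  assumes "0 < T" shows "0 \<le> Linf_L2_norm \<Omega> T f"
proof (rule ccontr)
  assume "\<not> 0 \<le> Linf_L2_norm \<Omega> T f"
  then have neg: "\<not> ereal (l2_norm \<Omega> (f t)) \<le> Linf_L2_norm \<Omega> T f" for t
    using l2_norm_nonneg[of \<Omega> "f t"] by (meson ereal_less_eq(5) order_trans)
  have "AE t in lebesgue_on {0..T}. ereal (l2_norm \<Omega> (f t)) \<le> Linf_L2_norm \<Omega> T f"
    unfolding Linf_L2_norm_def by (rule esssup_AE)
  \<comment> \<open>A negative essential supremum would make a false statement hold almost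
    everywhere on an interval of positive length.\<close>
  then have "AE t in lebesgue_on {0..T}. (0::real) \<le> - 1"
    by eventually_elim (simp add: neg)
  then have "(0::real) \<le> - 1"
    using assms by (intro AE_le_continuous_imp_le[of T "\<lambda>_. 0" _ 0]) auto
  then show False by simp
qed

lemma Linf_L2_norm_zero:
  assumes T: "0 < T" and f: "f \<in> bochner_L1 \<Omega> T j"
    and f0: "AE t in lebesgue_on {0..T}. l2_norm \<Omega> (f t) = 0"
  shows "Linf_L2_norm \<Omega> T f = 0"
proof (rule antisym)
  have "(\<lambda>t. ereal (l2_norm \<Omega> (f t))) \<in> borel_measurable (lebesgue_on {0..T})"
    using bochner_integrable_norm[OF f] by (intro borel_measurable_ereal borel_measurable_integrable)
  then show "Linf_L2_norm \<Omega> T f \<le> 0"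
    unfolding Linf_L2_norm_def using f0 by (intro esssup_I) (auto elim!: eventually_mono)
qed (rule Linf_L2_norm_nonneg[OF T])

theorem theorem3p6:
  fixes \<Omega> :: "(real ^ 'n) set"
    and T C :: real
    and k r :: int
    and \<T> :: "(real ^ 'n) set set"
    and F :: fe_family
    and V :: "int \<Rightarrow> (real ^ 'n) form set"
    and u0 u1 :: "(real ^ 'n) form"
    and f :: "real \<Rightarrow> (real ^ 'n) form"
    and u :: "real \<Rightarrow> (real ^ 'n) form3"
  assumes dim: "CARD('n) \<ge> 2"
    and domain: "admissible_domain \<Omega>"
    and harmonic: "\<forall>j\<in>{1..int CARD('n) - 1}. trivial_harmonic \<Omega> j"
    and T: "0 < T"
    and k: "0 \<le> k" "k \<le> int CARD('n)"
    and mesh: "triangulation_of \<T> \<Omega>" "shape_regular C \<T>"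
    and degree: "fe_degree_ok F (int CARD('n)) k r"
    and V: "V = fe_space F r \<Omega> \<T>"
    and subcomplex: "subcomplex_at \<Omega> V (k - 1)" "subcomplex_at \<Omega> V k"
    and exact: "\<forall>j\<in>{1..int CARD('n)}. exact_at \<Omega> V j"
    and u0: "u0 \<in> H_codiff \<Omega> k" "codiff \<Omega> k u0 \<in> H0 \<Omega> (k - 1)"
            "u0 \<in> H_d \<Omega> k" "ext_d \<Omega> k u0 \<in> H0 \<Omega> (k + 1)"
    and u1: "u1 \<in> H0 \<Omega> k"
    and f: "f \<in> bochner_L1 \<Omega> T k"
    and solution: "evolution_solution \<Omega> T V k (mixed_equations \<Omega> V k) f u"
    and initial: "initial_condition \<Omega> V k u0 u1 (u 0)"
  shows
    "(\<forall>w. evolution_solution \<Omega> T V k (mixed_equations \<Omega> V k) f w \<longleftrightarrow>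
          evolution_solution \<Omega> T V k (operator_equation \<Omega> V k) f w) \<and>
     (SUP t\<in>{0..T}. ereal (norm3 \<Omega> (u t)))
        \<le> ereal (norm3 \<Omega> (u 0)) + 2 * ereal (LINT s|lebesgue_on {0..T}. l2_norm \<Omega> (f s)) \<and>
     (\<forall>ft. has_weak_time_derivative \<Omega> T k f ft \<longrightarrow>
        (SUP t\<in>{0..T}. ereal (norm3 \<Omega> (A_h \<Omega> V k (u t))))
          \<le> ereal (norm3 \<Omega> (A_h \<Omega> V k (u 0))) + 4 * Linf_L2_norm \<Omega> T f
             + 2 * ereal (LINT s|lebesgue_on {0..T}. l2_norm \<Omega> (ft s))) \<and>
     ((AE t in lebesgue_on {0<..<T}. ae_eq \<Omega> (f t) 0) \<longrightarrow>
        (SUP t\<in>{0..T}. ereal (norm3 \<Omega> (u t)))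
          = ereal (norm3 \<Omega> (u 0)) + 2 * ereal (LINT s|lebesgue_on {0..T}. l2_norm \<Omega> (f s)) \<and>
        (\<forall>ft. has_weak_time_derivative \<Omega> T k f ft \<longrightarrow>
          (SUP t\<in>{0..T}. ereal (norm3 \<Omega> (A_h \<Omega> V k (u t))))
            = ereal (norm3 \<Omega> (A_h \<Omega> V k (u 0))) + 4 * Linf_L2_norm \<Omega> T f
               + 2 * ereal (LINT s|lebesgue_on {0..T}. l2_norm \<Omega> (ft s))) \<and>
        (\<forall>t\<in>{0<..T}. norm3 \<Omega> (u t) = norm3 \<Omega> (u 0) \<and>
            norm3 \<Omega> (A_h \<Omega> V k (u t)) = norm3 \<Omega> (A_h \<Omega> V k (u 0))))"
proof -
  interpret bounded_open_set \<Omega>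
    using domain by unfold_locales (auto simp: admissible_domain_def)
  interpret discrete_complex \<Omega> V k
  proof
    show "V j \<subseteq> H0 \<Omega> j" for j by (auto simp: V fe_space_def)
    show "form.subspace (V j)" for j unfolding V by (rule subspace_fe_space)
    show "\<exists>B. L2.orthonormal_basis \<Omega> B (V j)" for j unfolding V by (rule fe_space_orthonormal_basis[OF mesh(1)])
    show "ext_d \<Omega> j v \<in> V (j + 1)" if "j \<in> {k - 1, k}" "v \<in> V j" for j v
    proof -
      from that(1) consider "j = k - 1" | "j = k" by blast
      then show ?thesis
        using subcomplex that(2) by cases (simp_all add: subcomplex_at_def)
    qed
  qed
  have sol: "evolution_solution \<Omega> T V k (operator_equation \<Omega> V k) f u"
    using solution evolution_mixed_iff_operator by blast
  have SUP_const: "(SUP t\<in>{0..T}. ereal (h t)) = ereal (h 0)" if "\<And>t. t \<in> {0..T} \<Longrightarrow> h t = h 0" for h :: "real \<Rightarrow> real"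
  proof -
    have "(SUP t\<in>{0..T}. ereal (h t)) = (SUP t\<in>{0..T}. ereal (h 0))"
      by (intro SUP_cong refl arg_cong[where f = ereal] that)
    also have "\<dots> = ereal (h 0)"
      by (rule SUP_const) (use T in simp)
    finally show ?thesis .
  qed
  have bound: "(SUP t\<in>{0..T}. ereal (norm3 \<Omega> (u t)))
      \<le> ereal (norm3 \<Omega> (u 0)) + 2 * ereal (LINT s|lebesgue_on {0..T}. l2_norm \<Omega> (f s))"
    using stability[OF T f sol] by (intro SUP_least) simp
  have A_bound: "(SUP t\<in>{0..T}. ereal (norm3 \<Omega> (A_h \<Omega> V k (u t))))
      \<le> ereal (norm3 \<Omega> (A_h \<Omega> V k (u 0))) + 4 * Linf_L2_norm \<Omega> T f
         + 2 * ereal (LINT s|lebesgue_on {0..T}. l2_norm \<Omega> (ft s))"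
    if weak: "has_weak_time_derivative \<Omega> T k f ft" for ft
  proof (cases "Linf_L2_norm \<Omega> T f")
    case (real m)
    then have m: "0 \<le> m" using Linf_L2_norm_nonneg[OF T, of \<Omega> f] by simp
    have "AE t in lebesgue_on {0..T}. ereal (l2_norm \<Omega> (f t)) \<le> ereal m"
      unfolding real[symmetric] Linf_L2_norm_def by (rule esssup_AE)
    then have "AE t in lebesgue_on {0..T}. l2_norm \<Omega> (f t) \<le> m" by simp
    \<comment> \<open>This gives the bound with \<open>2 * m\<close>, which \<open>0 \<le> m\<close>
      weakens to \<open>4 * m\<close>.\<close>
    from operator_stability[OF T weak sol this]
    have "norm3 \<Omega> (A_h \<Omega> V k (u t)) \<le> norm3 \<Omega> (A_h \<Omega> V k (u 0)) + 4 * m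
        + 2 * (LINT s|lebesgue_on {0..T}. l2_norm \<Omega> (ft s))" if "t \<in> {0..T}" for t
      using that m by fastforce
    then show ?thesis unfolding real by (intro SUP_least) simp
  next
    case PInf
    then show ?thesis by simp
  next
    case MInf
    then show ?thesis using Linf_L2_norm_nonneg[OF T, of \<Omega> f] by simp
  qed
  have conserved: "(SUP t\<in>{0..T}. ereal (norm3 \<Omega> (u t)))
          = ereal (norm3 \<Omega> (u 0)) + 2 * ereal (LINT s|lebesgue_on {0..T}. l2_norm \<Omega> (f s)) \<and>
        (\<forall>ft. has_weak_time_derivative \<Omega> T k f ft \<longrightarrow>
          (SUP t\<in>{0..T}. ereal (norm3 \<Omega> (A_h \<Omega> V k (u t))))
            = ereal (norm3 \<Omega> (A_h \<Omega> V k (u 0))) + 4 * Linf_L2_norm \<Omega> T f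
               + 2 * ereal (LINT s|lebesgue_on {0..T}. l2_norm \<Omega> (ft s))) \<and>
        (\<forall>t\<in>{0<..T}. norm3 \<Omega> (u t) = norm3 \<Omega> (u 0) \<and>
            norm3 \<Omega> (A_h \<Omega> V k (u t)) = norm3 \<Omega> (A_h \<Omega> V k (u 0)))"
    if f0: "AE t in lebesgue_on {0<..<T}. ae_eq \<Omega> (f t) 0"
  proof (intro conjI allI impI)
    note cons = conservation[OF T sol f0]
    have n0: "AE t in lebesgue_on {0..T}. l2_norm \<Omega> (f t) = 0"
      using f0[unfolded AE_open_interval] by eventually_elim (simp add: l2_norm_def l2_inner_null_if_ae_eq)
    have "(LINT s|lebesgue_on {0..T}. l2_norm \<Omega> (f s)) = 0"
      using n0 by (rule integral_eq_zero_AE)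
    then show "(SUP t\<in>{0..T}. ereal (norm3 \<Omega> (u t)))
        = ereal (norm3 \<Omega> (u 0)) + 2 * ereal (LINT s|lebesgue_on {0..T}. l2_norm \<Omega> (f s))"
      using SUP_const[of "\<lambda>t. norm3 \<Omega> (u t)", OF cons(1)] by simp
    show "\<forall>t\<in>{0<..T}. norm3 \<Omega> (u t) = norm3 \<Omega> (u 0) \<and>
        norm3 \<Omega> (A_h \<Omega> V k (u t)) = norm3 \<Omega> (A_h \<Omega> V k (u 0))"
      using cons by (meson atLeastAtMost_iff greaterThanAtMost_iff less_imp_le)
    fix ft assume weak: "has_weak_time_derivative \<Omega> T k f ft"
    \<comment> \<open>For equality both load terms on the right must vanish: \<open>f_t\<close> by
      this step, the essential supremum of \<open>f\<close> by
      \<open>Linf_L2_norm_zero\<close>.\<close>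
    have "(LINT s|lebesgue_on {0..T}. l2_norm \<Omega> (ft s)) = 0"
      using weak_time_derivative_zero[OF weak f0, unfolded AE_open_interval] by (rule integral_eq_zero_AE)
    then show "(SUP t\<in>{0..T}. ereal (norm3 \<Omega> (A_h \<Omega> V k (u t))))
        = ereal (norm3 \<Omega> (A_h \<Omega> V k (u 0))) + 4 * Linf_L2_norm \<Omega> T f
           + 2 * ereal (LINT s|lebesgue_on {0..T}. l2_norm \<Omega> (ft s))"
      using SUP_const[of "\<lambda>t. norm3 \<Omega> (A_h \<Omega> V k (u t))", OF cons(2)] by (simp add: Linf_L2_norm_zero[OF T f n0])
  qed
  show ?thesis
    using evolution_mixed_iff_operator bound A_bound conserved by blast
qed

end
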